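(* There is a randomized algorithm that takes as input an instance $(H,\bar c,\bar b)$ of $k$-Objective Hypergraph Budgeted-Cut and has the following properties: (i) if the instance has a budget-feasible cut, then the algorithm returns a budget-feasible cut with probability at least $1/n^{2k}$, and otherwise, returns FAIL; and (ii) the expected run-time of the algorithm is $(m+1)^{5k\log_2 n}$, where $m$ and $n$ are the number of hyperedges and the number of vertices of the input hypergraph.
   Context: A hypergraph $H=(V,E)$ is specified by a vertex set $V$ and a hyperedge set $E$ (an indexed multiset), where each hyperedge is a subset of $V$. For $\emptyset\ne U\subsetneq V$, $\delta_H(U):=\{e\in E: e\cap U\ne\emptyset \text{ and } e\setminus U\neq\emptyset\}$. A set $F\subseteq E$ is a cut if $F=\delta_H(U)$ for some non-empty proper subset $U\subsetneq V$. For $c:E\to\mathbb{Z}_{\ge 0}$ and $F\subseteq E$, $c(F):=\sum_{e\in F}c(e)$. $k$-Objective Hypergraph Budgeted-Cut (for a fixed constant $k$): given a hypergraph $H=(V,E)$, hyperedge-cost functions $\bar c=(c_1,\dots,c_k)$ with $c_i\in\mathbb{Z}_{\ge 0}^E$, and budgets $\bar b=(b_1,\dots,b_k)\in\mathbb{Z}_{\ge0}^k$, return a budget-feasible cut for $(H,\bar c,\bar b)$ if one exists. A cut $F$ is budget-feasible for $(H,\bar c,\bar b)$ if $c_i(F)\le b_i$ for every $i\in[k]$. *)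

theory Defs
  imports "HOL-Probability.Probability"
begin

section \<open>Hypergraphs and budget-feasible cuts\<close>

text \<open>The hyperedges are an indexed multiset: an index set \<open>hedges\<close> together with the vertex set
  \<open>ends e\<close> of each index \<open>e\<close>, so parallel, singleton and empty hyperedges are allowed. A set of
  hyperedges is a set of indices.\<close>

record ('v, 'e) hypergraph =
  verts :: "'v set"
  hedges :: "'e set"
  ends :: "'e \<Rightarrow> 'v set"

definition hypergraph :: "('v, 'e) hypergraph \<Rightarrow> bool" where
  "hypergraph H \<longleftrightarrow> finite (verts H) \<and> verts H \<noteq> {} \<and> finite (hedges H) \<and>
     (\<forall>e \<in> hedges H. ends H e \<subseteq> verts H)"

definition boundary :: "('v, 'e) hypergraph \<Rightarrow> 'v set \<Rightarrow> 'e set" where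
  "boundary H U = {e \<in> hedges H. ends H e \<inter> U \<noteq> {} \<and> ends H e - U \<noteq> {}}"

definition is_cut :: "('v, 'e) hypergraph \<Rightarrow> 'e set \<Rightarrow> bool" where
  "is_cut H F \<longleftrightarrow> (\<exists>U. U \<noteq> {} \<and> U \<subset> verts H \<and> F = boundary H U)"

text \<open>The objectives are indexed by \<open>0, \<dots>, k - 1\<close>; \<open>c i e\<close> is the \<open>i\<close>-th cost of \<open>e\<close>.\<close>

definition budget_feasible ::
  "nat \<Rightarrow> ('v, 'e) hypergraph \<Rightarrow> (nat \<Rightarrow> 'e \<Rightarrow> nat) \<Rightarrow> (nat \<Rightarrow> nat) \<Rightarrow> 'e set \<Rightarrow> bool" where
  "budget_feasible k H c b F \<longleftrightarrow> is_cut H F \<and> (\<forall>i<k. (\<Sum>e\<in>F. c i e) \<le> b i)"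


section \<open>Randomized algorithms\<close>

text \<open>An algorithm is a program of a structured random access machine. The memory consists of
  arrays of natural numbers; a program, being finite, mentions only finitely many of them. The
  primitive operations are constants, reading and writing a cell at a computed address, addition,
  truncated subtraction, comparison, and drawing a uniformly distributed number from a computed
  range; each of them takes one unit of time, irrespective of the size of the numbers.
  Multiplication is deliberately not a primitive: at unit cost it would make the machine
  unrealistically powerful.\<close>

type_synonym state = "string \<Rightarrow> nat \<Rightarrow> nat"

datatype aexp = Const nat | Cell string aexp | Plus aexp aexp | Minus aexp aexp

datatype bexp = Less aexp aexp | Neg bexp | Conj bexp bexp

datatype com =
    Skip
  | Store string aexp aexp
  | Rand string aexp aexp
  | Seq com com
  | Cond bexp com com
  | While bexp com

primrec aval :: "aexp \<Rightarrow> state \<Rightarrow> nat" where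
  "aval (Const a) s = a"
| "aval (Cell x i) s = s x (aval i s)"
| "aval (Plus a a') s = aval a s + aval a' s"
| "aval (Minus a a') s = aval a s - aval a' s"

primrec acost :: "aexp \<Rightarrow> nat" where
  "acost (Const a) = 1"
| "acost (Cell x i) = 1 + acost i"
| "acost (Plus a a') = 1 + acost a + acost a'"
| "acost (Minus a a') = 1 + acost a + acost a'"

primrec bval :: "bexp \<Rightarrow> state \<Rightarrow> bool" where
  "bval (Less a a') s \<longleftrightarrow> aval a s < aval a' s"
| "bval (Neg t) s \<longleftrightarrow> \<not> bval t s"
| "bval (Conj t t') s \<longleftrightarrow> bval t s \<and> bval t' s"

primrec bcost :: "bexp \<Rightarrow> nat" where
  "bcost (Less a a') = 1 + acost a + acost a'"
| "bcost (Neg t) = 1 + bcost t"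
| "bcost (Conj t t') = 1 + bcost t + bcost t'"

definition update :: "state \<Rightarrow> string \<Rightarrow> nat \<Rightarrow> nat \<Rightarrow> state" where
  "update s x i a = s(x := (s x)(i := a))"

text \<open>\<open>exec p s\<close> is the joint subdistribution of the final state and the running time of \<open>p\<close>
  started in \<open>s\<close>, as a least fixed point; the missing mass is the probability of divergence.
  \<open>Rand x i a\<close> stores in cell \<open>i\<close> of array \<open>x\<close> a uniform element of \<open>{0, \<dots>, a}\<close>, with \<open>a\<close>
  included, so that the range is never empty.\<close>

definition tick :: "nat \<Rightarrow> (state \<times> nat) spmf \<Rightarrow> (state \<times> nat) spmf" where
  "tick t R = map_spmf (\<lambda>(s, t'). (s, t + t')) R"

lemma tick_mono [partial_function_mono]:
  assumes "mono_spmf R"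
  shows "mono_spmf (\<lambda>f. tick t (R f))"
  unfolding tick_def using assms by (rule map_spmf_mono)

partial_function (spmf) exec :: "com \<Rightarrow> state \<Rightarrow> (state \<times> nat) spmf" where
  "exec p s = (case p of
     Skip \<Rightarrow> return_spmf (s, 1)
   | Store x i a \<Rightarrow>
       return_spmf (update s x (aval i s) (aval a s), 1 + acost i + acost a)
   | Rand x i a \<Rightarrow>
       map_spmf (\<lambda>r. (update s x (aval i s) r, 1 + acost i + acost a)) (spmf_of_set {..aval a s})
   | Seq p1 p2 \<Rightarrow> bind_spmf (exec p1 s) (\<lambda>(s', t). tick t (exec p2 s'))
   | Cond e p1 p2 \<Rightarrow> tick (1 + bcost e) (if bval e s then exec p1 s else exec p2 s)
   | While e p1 \<Rightarrow> tick (1 + bcost e)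
       (if bval e s then bind_spmf (exec p1 s) (\<lambda>(s', t). tick t (exec (While e p1) s'))
        else return_spmf (s, 0)))"

definition expected_time :: "com \<Rightarrow> state \<Rightarrow> ennreal" where
  "expected_time p s =
     (if lossless_spmf (exec p s)
      then \<integral>\<^sup>+ r. ennreal (real (snd r)) \<partial>measure_spmf (exec p s)
      else \<infinity>)"


section \<open>Algorithms for k-Objective Hypergraph Budgeted-Cut\<close>

text \<open>To be given to a machine, the vertices and the hyperedges are numbered from 0.\<close>

definition numbered :: "(nat, nat) hypergraph \<Rightarrow> bool" where
  "numbered H \<longleftrightarrow> verts H = {..<card (verts H)} \<and> hedges H = {..<card (hedges H)}"

text \<open>The input is in memory when the program starts: \<open>n\<close>, \<open>m\<close>, the incidence matrix and
  the cost matrix (both row by row, with rows indexed by hyperedges and objectives, respectively),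
  and the budgets. All other cells are 0.\<close>

definition encode ::
  "nat \<Rightarrow> (nat, nat) hypergraph \<Rightarrow> (nat \<Rightarrow> nat \<Rightarrow> nat) \<Rightarrow> (nat \<Rightarrow> nat) \<Rightarrow> state" where
  "encode k H c b = (let n = card (verts H); m = card (hedges H) in
     (\<lambda>x j.
        if x = ''n'' \<and> j = 0 then n
        else if x = ''m'' \<and> j = 0 then m
        else if x = ''inc'' \<and> j < m * n then (if j mod n \<in> ends H (j div n) then 1 else 0)
        else if x = ''cost'' \<and> j < k * m then c (j div m) (j mod m)
        else if x = ''budget'' \<and> j < k then b j
        else 0))"

datatype answer = FAIL | Cut "nat set"

text \<open>A program returns a set of hyperedges by setting cell 0 of \<open>found\<close> to a nonzero value and
  storing the characteristic vector of the set in \<open>out\<close>.\<close>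

definition decode :: "(nat, nat) hypergraph \<Rightarrow> state \<Rightarrow> answer" where
  "decode H s = (if s ''found'' 0 = 0 then FAIL else Cut {e \<in> hedges H. s ''out'' e \<noteq> 0})"

definition answer_dist ::
  "com \<Rightarrow> nat \<Rightarrow> (nat, nat) hypergraph \<Rightarrow> (nat \<Rightarrow> nat \<Rightarrow> nat) \<Rightarrow> (nat \<Rightarrow> nat) \<Rightarrow> answer spmf" where
  "answer_dist p k H c b = map_spmf (\<lambda>(s, t). decode H s) (exec p (encode k H c b))"

end

theory Submission imports Defs begin

text \<open>A trial contracts hyperedges at random. It stops as soon as the star of some block is
  budget-feasible; otherwise every block violates one of the budgets, and the step depends on the sizes
  of the undecided hyperedges, where \<open>N + 1\<close> is the number of blocks. If some undecided hyperedge
  has size at least \<open>N / (3 k) + 1\<close>, then it is guessed whether it belongs to the target cut: with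
  probability \<open>1 / (m + 1)\<close> it is contracted, which shrinks \<open>N\<close> by the factor \<open>1 - 1 / (3 k)\<close> and
  hence happens at most \<open>3 k ln n\<close> times, and otherwise it is charged to the target cut, which
  happens at most \<open>m\<close> times and costs a constant factor in total. If all undecided hyperedges are
  small, then some objective \<open>i\<close> is violated by a fraction \<open>1 / k\<close> of the blocks, so the undecided
  hyperedges are much heavier than what is left of the \<open>i\<close>-th budget, and a hyperedge is contracted
  with probability proportional to its \<open>i\<close>-th cost; as in Karger's analysis this loses a factor
  \<open>n\<^sup>3\<^sup>k\<close> over the whole trial. Repeating the trial \<open>6 n\<^sup>k (m + 1)\<^sup>d\<close> times, where \<open>d\<close>
  bounds the number of successful guesses, lifts the success probability to \<open>1 / n\<^sup>2\<^sup>k\<close>.\<close>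

section \<open>Execution of programs\<close>

text \<open>Karger's argument needs each contraction to cost few blocks; a hyperedge spanning a
  constant share of them would ruin the estimate, hence the separate treatment of large ones. The
  threshold and the exponent belong together: below size \<open>N / (3 k) + 1\<close> the target cut
  takes up, to first order, at most a third of the weighted total size; the other two thirds, halved
  by \<open>s - 1 >= s / 2\<close>, leave one third, so the exponent \<open>3 k\<close> just pays
  for draws from the target cut. A trial thus succeeds with probability at least
  \<open>q = 1 / (3 (m + 1)^d n^(3 k))\<close>, where the 3 bounds the constant lost to guessed
  deletions. With \<open>r = 6 n^k (m + 1)^d\<close> trials \<open>r q = 2 / n^(2 k)\<close>, and
  the spare factor 2 covers the gap between \<open>r q\<close> and \<open>1 - (1 - q)^r\<close>. The
  program never sees the target cut: the analysis fixes one and carries lower bounds backwards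
  through expectations. The time bound holds for every outcome, which avoids integrating running
  times. The machine has neither division nor logarithms, so \<open>d\<close> is an integer
  recursion that the program can replay.\<close>

lemma exec_Skip [simp]: "exec Skip s = return_spmf (s, 1)"
  by (subst exec.simps) simp

lemma exec_Store [simp]:
  "exec (Store x i a) s = return_spmf (update s x (aval i s) (aval a s), 1 + acost i + acost a)"
  by (subst exec.simps) simp

lemma exec_Rand [simp]:
  "exec (Rand x i a) s =
     map_spmf (\<lambda>r. (update s x (aval i s) r, 1 + acost i + acost a)) (spmf_of_set {..aval a s})"
  by (subst exec.simps) simp

lemma exec_Seq [simp]: "exec (Seq p q) s = bind_spmf (exec p s) (\<lambda>(s', t). tick t (exec q s'))"
  by (subst exec.simps) simp

lemma exec_Cond [simp]:
  "exec (Cond e p q) s = tick (1 + bcost e) (if bval e s then exec p s else exec q s)"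
  by (subst exec.simps) simp

lemma exec_While:
  "exec (While e p) s = tick (1 + bcost e)
     (if bval e s then exec (Seq p (While e p)) s else return_spmf (s, 0))"
  by (subst exec.simps) simp

lemma lossless_tick [simp]: "lossless_spmf (tick t R) \<longleftrightarrow> lossless_spmf R"
  by (simp add: tick_def)

lemma set_tick [simp]: "set_spmf (tick t R) = (\<lambda>(s, t'). (s, t + t')) ` set_spmf R"
  by (simp add: tick_def)

lemma set_exec_Seq:
  "r \<in> set_spmf (exec (Seq p q) s) \<longleftrightarrow>
     (\<exists>s' t s'' t'. (s', t) \<in> set_spmf (exec p s) \<and> (s'', t') \<in> set_spmf (exec q s') \<and> r = (s'', t + t'))"
  by (force simp: set_bind_spmf)

lemma lossless_exec_Seq:
  "lossless_spmf (exec (Seq p q) s) \<longleftrightarrow>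
     lossless_spmf (exec p s) \<and> (\<forall>(s', t) \<in> set_spmf (exec p s). lossless_spmf (exec q s'))"
  by (auto split: prod.splits)

declare exec_Seq [simp del]

primrec writes :: "com \<Rightarrow> string set" where
  "writes Skip = {}"
| "writes (Store x i a) = {x}"
| "writes (Rand x i a) = {x}"
| "writes (Seq p q) = writes p \<union> writes q"
| "writes (Cond e p q) = writes p \<union> writes q"
| "writes (While e p) = writes p"

text \<open>\<open>While\<close> unfolds to itself, so structural induction on \<open>p\<close> is
  not enough. Fixed-point induction applies because an upper bound on the support is preserved by
  limits and holds for the everywhere divergent start, whose support is empty.\<close>

lemma set_exec_frame: "\<forall>p s. set_spmf (exec p s) \<subseteq> {r. \<forall>x. x \<notin> writes p \<longrightarrow> fst r x = s x}"
proof (induction rule: exec.fixp_induct)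
  case 1
  show ?case unfolding curry_def
    by (intro admissible_all) (rule admissible_leI mcont_const cont_intro | simp)+
next
  case 2
  show ?case by simp
next
  case (3 f)
  let ?F = "\<lambda>p s. {r. \<forall>x. x \<notin> writes p \<longrightarrow> fst r x = s x}"
  have IH: "s' x = s x" if "(s', t) \<in> set_spmf (f p s)" "x \<notin> writes p" for p s s' t x
    using 3 that by fastforce
  show ?case
  proof (intro allI)
    fix p s
    show "set_spmf (case p of
     Skip \<Rightarrow> return_spmf (s, 1)
   | Store x i a \<Rightarrow>
       return_spmf (update s x (aval i s) (aval a s), 1 + acost i + acost a)
   | Rand x i a \<Rightarrow>
       map_spmf (\<lambda>r. (update s x (aval i s) r, 1 + acost i + acost a)) (spmf_of_set {..aval a s})
   | Seq p1 p2 \<Rightarrow> bind_spmf (f p1 s) (\<lambda>(s', t). tick t (f p2 s'))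
   | Cond e p1 p2 \<Rightarrow> tick (1 + bcost e) (if bval e s then f p1 s else f p2 s)
   | While e p1 \<Rightarrow> tick (1 + bcost e)
       (if bval e s then bind_spmf (f p1 s) (\<lambda>(s', t). tick t (f (While e p1) s'))
        else return_spmf (s, 0))) \<subseteq> ?F p s"
      by (cases p) (auto simp: update_def set_bind_spmf tick_def dest: IH, (metis IH writes.simps(6))+)
  qed
qed

lemma exec_frame:
  assumes "(s', t) \<in> set_spmf (exec p s)" "x \<notin> writes p"
  shows "s' x = s x"
  using assms set_exec_frame by fastforce

section \<open>Counting loops\<close>

text \<open>Scalar variables are arrays of which only cell 0 is used.\<close>

abbreviation V :: "string \<Rightarrow> aexp" where
  "V x \<equiv> Cell x (Const 0)"

definition incr :: "string \<Rightarrow> com" where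
  "incr x = Store x (Const 0) (Plus (V x) (Const 1))"

text \<open>The bound \<open>a\<close> is evaluated anew before every round, so the rules below ask
  that it be constant on all states that the loop can reach.\<close>

definition For :: "string \<Rightarrow> aexp \<Rightarrow> com \<Rightarrow> com" where
  "For x a p = Seq (Store x (Const 0) (Const 0)) (While (Less (V x) a) (Seq p (incr x)))"

text \<open>Frame conditions are tracked per array, not per cell: \<open>W\<close> holds the arrays
  that may have changed, usually \<open>writes p\<close>.\<close>

definition agree :: "string set \<Rightarrow> state \<Rightarrow> state \<Rightarrow> bool" where
  "agree W s s' \<longleftrightarrow> (\<forall>x. x \<notin> W \<longrightarrow> s' x = s x)"

lemma agreeD: "agree W s s' \<Longrightarrow> x \<notin> W \<Longrightarrow> s' x = s x"
  by (simp add: agree_def)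

lemma agree_refl [simp]: "agree W s s"
  by (simp add: agree_def)

lemma agree_update: "x \<in> W \<Longrightarrow> agree W s (update s' x i a) \<longleftrightarrow> agree W s s'"
  by (auto simp: agree_def update_def)

lemma update_same [simp]: "update s x i a x i = a"
  by (simp add: update_def)

lemma writes_incr [simp]: "writes (incr x) = {x}"
  by (simp add: incr_def)

lemma writes_For [simp]: "writes (For x a p) = insert x (writes p)"
  by (auto simp: For_def)

lemma exec_agree: "(s', t) \<in> set_spmf (exec p s) \<Longrightarrow> agree (writes p) s s'"
  using exec_frame by (auto simp: agree_def)

lemma set_exec_incr:
  "r \<in> set_spmf (exec (Seq p (incr x)) s) \<longleftrightarrow>
     (\<exists>s' t. (s', t) \<in> set_spmf (exec p s) \<and> r = (update s' x 0 (Suc (s' x 0)), t + 6))"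
  by (auto simp: set_exec_Seq incr_def)

section \<open>Running times\<close>

text \<open>A bound for all outcomes at once composes by addition, without integrals. Losslessness
  is bundled in because \<open>expected_time\<close> is infinite without it.\<close>

definition runs_within :: "state \<Rightarrow> com \<Rightarrow> nat \<Rightarrow> bool" where
  "runs_within s p T \<longleftrightarrow> lossless_spmf (exec p s) \<and> (\<forall>(s', t) \<in> set_spmf (exec p s). t \<le> T)"

lemma runs_withinI:
  assumes "lossless_spmf (exec p s)" "\<And>s' t. (s', t) \<in> set_spmf (exec p s) \<Longrightarrow> t \<le> T"
  shows "runs_within s p T"
  using assms unfolding runs_within_def by blast

lemma runs_withinD: "runs_within s p T \<Longrightarrow> (s', t) \<in> set_spmf (exec p s) \<Longrightarrow> t \<le> T"
  unfolding runs_within_def by blast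

lemma runs_within_lossless: "runs_within s p T \<Longrightarrow> lossless_spmf (exec p s)"
  unfolding runs_within_def by blast

lemma runs_within_mono: "runs_within s p T \<Longrightarrow> T \<le> T' \<Longrightarrow> runs_within s p T'"
  by (intro runs_withinI) (auto dest: runs_within_lossless runs_withinD intro: order_trans)

lemma runs_within_tick:
  assumes "runs_within s q T" "exec p s' = tick t (exec q s)" "t + T \<le> T'"
  shows "runs_within s' p T'"
  using assms unfolding runs_within_def by fastforce

text \<open>Partial correctness over the support: divergence is excluded separately, through the
  running-time bounds.\<close>

definition post :: "com \<Rightarrow> state \<Rightarrow> (state \<Rightarrow> bool) \<Rightarrow> bool" where
  "post p s Q \<longleftrightarrow> (\<forall>(s', t) \<in> set_spmf (exec p s). Q s')"

text \<open>The postcondition \<open>P\<close> lets the time of the second part depend on a value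
  computed by the first, as the main loop depends on the number of repetitions left by
  \<open>prepare\<close>.\<close>

lemma runs_within_Seq_post:
  assumes "runs_within s p T" "post p s P" and "\<And>s'. agree (writes p) s s' \<Longrightarrow> P s' \<Longrightarrow> runs_within s' q T'"
  shows "runs_within s (Seq p q) (T + T')"
proof (rule runs_withinI)
  have *: "runs_within s' q T'" if "(s', t) \<in> set_spmf (exec p s)" for s' t
    using that assms(2,3) exec_agree unfolding post_def by blast
  show "lossless_spmf (exec (Seq p q) s)"
    using runs_within_lossless[OF assms(1)] runs_within_lossless[OF *] by (auto simp: lossless_exec_Seq)
  show "t \<le> T + T'" if "(s', t) \<in> set_spmf (exec (Seq p q) s)" for s' t
    using that runs_withinD[OF assms(1)] runs_withinD[OF *] by (fastforce simp: set_exec_Seq intro: add_mono)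
qed

lemma runs_within_Seq:
  assumes "runs_within s p T" and "\<And>s'. agree (writes p) s s' \<Longrightarrow> runs_within s' q T'"
  shows "runs_within s (Seq p q) (T + T')"
  using assms by (intro runs_within_Seq_post[where P = "\<lambda>s'. True"]) (auto simp: post_def)

lemma runs_within_Cond:
  assumes "bval e s \<Longrightarrow> runs_within s p T" "\<not> bval e s \<Longrightarrow> runs_within s q T"
  shows "runs_within s (Cond e p q) (1 + bcost e + T)"
  using assms by (cases "bval e s") (auto simp: runs_within_def)

text \<open>Induction on \<open>d\<close>, which bounds the rounds left. The entry state
  \<open>s\<close> stays fixed while the current state \<open>s0\<close> moves, so the hypotheses
  survive the induction. A round costs at most \<open>T\<close> for the body, 6 for the increment
  and \<open>acost a + 4\<close> for the test.\<close>

lemma runs_within_While: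
  fixes x :: string and p :: com
  defines "W \<equiv> insert x (writes p)"
  assumes body: "\<And>s'. agree W s s' \<Longrightarrow> runs_within s' p T"
    and a: "\<And>s'. agree W s s' \<Longrightarrow> aval a s' = B"
    and x: "x \<notin> writes p"
    and "agree W s s0" and "B - s0 x 0 \<le> d"
  shows "runs_within s0 (While (Less (V x) a) (Seq p (incr x))) (d * (T + acost a + 11) + (acost a + 11))"
  using assms(5,6)
proof (induction d arbitrary: s0)
  case 0
  then have "\<not> s0 x 0 < aval a s0" using a by simp
  then show ?case by (simp add: exec_While runs_within_def)
next
  case (Suc d)
  let ?w = "While (Less (V x) a) (Seq p (incr x))" and ?T = "d * (T + acost a + 11) + (acost a + 11)"
  show ?case
  proof (cases "s0 x 0 < B")
    case False
    then have "\<not> s0 x 0 < aval a s0" using a Suc by simp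
    then show ?thesis by (simp add: exec_While runs_within_def)
  next
    case True
    have 1: "runs_within s0 p T" using body Suc by simp
    have "runs_within s0 (Seq (Seq p (incr x)) ?w) (T + 6 + ?T)"
    proof (rule runs_withinI)
      have A: "lossless_spmf (exec (Seq p (incr x)) s0)"
        using runs_within_lossless[OF 1] by (auto simp: lossless_exec_Seq incr_def)
      have B: "t \<le> T + 6 \<and> agree W s s' \<and> s' x 0 = Suc (s0 x 0)"
        if h: "(s', t) \<in> set_spmf (exec (Seq p (incr x)) s0)" for s' t
      proof -
        obtain s1 t1 where 2: "(s1, t1) \<in> set_spmf (exec p s0)" "s' = update s1 x 0 (s1 x 0 + 1)" "t = t1 + 6"
          using h by (auto simp: set_exec_incr)
        have "agree W s s1" using Suc.prems(1) exec_agree[OF 2(1)]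
          by (auto simp: W_def agree_def)
        then show ?thesis
          using runs_withinD[OF 1 2(1)] 2 exec_frame[OF 2(1) x] by (auto simp: W_def agree_update)
      qed
      have C: "runs_within s' ?w ?T"
        if "(s', t) \<in> set_spmf (exec (Seq p (incr x)) s0)" for s' t
        using B[OF that] Suc.prems by (intro Suc.IH) (auto simp: agree_def)
      show "lossless_spmf (exec (Seq (Seq p (incr x)) ?w) s0)"
        using A runs_within_lossless[OF C] by (auto simp: lossless_exec_Seq[of "Seq p (incr x)"])
      show "t \<le> T + 6 + ?T"
        if h: "(s', t) \<in> set_spmf (exec (Seq (Seq p (incr x)) ?w) s0)" for s' t
      proof -
        obtain s1 t1 t2 where 2: "(s1, t1) \<in> set_spmf (exec (Seq p (incr x)) s0)"
          "(s', t2) \<in> set_spmf (exec ?w s1)" "t = t1 + t2"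
          using h by (auto simp: set_exec_Seq[of _ "Seq p (incr x)"])
        show ?thesis
          using B[OF 2(1)] runs_withinD[OF C[OF 2(1)] 2(2)] 2(3) by simp
      qed
    qed
    moreover have "exec ?w s0 = tick (1 + bcost (Less (V x) a)) (exec (Seq (Seq p (incr x)) ?w) s0)"
      using True a Suc by (subst exec_While) simp
    ultimately show ?thesis
      by (rule runs_within_tick) simp
  qed
qed

lemma runs_within_For:
  assumes "\<And>s'. agree (insert x (writes p)) s s' \<Longrightarrow> runs_within s' p T"
    and "\<And>s'. agree (insert x (writes p)) s s' \<Longrightarrow> aval a s' = B"
    and "x \<notin> writes p"
  shows "runs_within s (For x a p) (B * (T + acost a + 11) + (acost a + 14))"
proof -
  let ?w = "While (Less (V x) a) (Seq p (incr x))"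
  have "runs_within s (Store x (Const 0) (Const 0)) 3"
    by (simp add: runs_within_def)
  moreover have "runs_within s' ?w (B * (T + acost a + 11) + (acost a + 11))"
    if "agree (writes (Store x (Const 0) (Const 0))) s s'" for s'
    using assms that by (intro runs_within_While[where s = s and B = B]) (auto simp: agree_def)
  ultimately show ?thesis
    unfolding For_def by (intro runs_within_mono[OF runs_within_Seq]) auto
qed

text \<open>Bounds are monomials in the sizes found in memory, up to a factor depending on the
  program alone. As \<open>n\<close> and \<open>m\<close> are at least 1, every additive constant is
  absorbed into \<open>K\<close>.\<close>

definition cost_bounded_by :: "nat \<Rightarrow> com \<Rightarrow> nat \<Rightarrow> nat \<Rightarrow> bool" where
  "cost_bounded_by K p i j \<longleftrightarrow> (\<forall>s. 1 \<le> s ''n'' 0 \<longrightarrow> 1 \<le> s ''m'' 0 \<longrightarrow>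
     runs_within s p (K * s ''n'' 0 ^ i * (s ''m'' 0 + 1) ^ j))"

definition cost_bounded :: "com \<Rightarrow> nat \<Rightarrow> nat \<Rightarrow> bool" where
  "cost_bounded p i j \<longleftrightarrow> (\<exists>K. cost_bounded_by K p i j)"

lemma cost_boundedI:
  assumes "\<And>s. 1 \<le> s ''n'' 0 \<Longrightarrow> 1 \<le> s ''m'' 0 \<Longrightarrow> runs_within s p (K * s ''n'' 0 ^ i * (s ''m'' 0 + 1) ^ j)"
  shows "cost_bounded p i j"
  unfolding cost_bounded_def cost_bounded_by_def using assms by blast

lemma cost_bounded_byD:
  "cost_bounded_by K p i j \<Longrightarrow> 1 \<le> s ''n'' 0 \<Longrightarrow> 1 \<le> s ''m'' 0 \<Longrightarrow>
    runs_within s p (K * s ''n'' 0 ^ i * (s ''m'' 0 + 1) ^ j)"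
  unfolding cost_bounded_by_def by blast

lemma const_le_cost: "1 \<le> n \<Longrightarrow> K \<le> K * n ^ i * (m + 1 :: nat) ^ j"
  using mult_le_mono[of "K * 1" "K * n ^ i" 1 "(m + 1) ^ j"] by (simp add: Suc_le_eq)

lemma cost_bounded_const:
  assumes "\<And>s. runs_within s p K"
  shows "cost_bounded p i j"
  by (rule cost_boundedI, rule runs_within_mono[OF assms], rule const_le_cost)

lemma cost_bounded_Skip: "cost_bounded Skip i j"
  by (rule cost_bounded_const[where K = 1]) (simp add: runs_within_def)

lemma cost_bounded_Store: "cost_bounded (Store x e a) i j"
  by (rule cost_bounded_const[where K = "1 + acost e + acost a"]) (simp add: runs_within_def)

lemma cost_bounded_Rand: "cost_bounded (Rand x e a) i j"
  by (rule cost_bounded_const[where K = "1 + acost e + acost a"]) (auto simp: runs_within_def)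

lemma cost_bounded_Seq:
  assumes "cost_bounded p i j" "cost_bounded q i j" "''n'' \<notin> writes p" "''m'' \<notin> writes p"
  shows "cost_bounded (Seq p q) i j"
proof -
  obtain K L where K': "cost_bounded_by K p i j" and L': "cost_bounded_by L q i j"
    using assms(1,2) unfolding cost_bounded_def by blast
  note K = cost_bounded_byD[OF K'] and L = cost_bounded_byD[OF L']
  show ?thesis
  proof (rule cost_boundedI[where K = "K + L"])
    fix s :: state assume s: "1 \<le> s ''n'' 0" "1 \<le> s ''m'' 0"
    have "runs_within s' q (L * s ''n'' 0 ^ i * (s ''m'' 0 + 1) ^ j)" if "agree (writes p) s s'" for s'
      using L[of s'] s agreeD[OF that assms(3)] agreeD[OF that assms(4)] by simp
    from runs_within_Seq[OF K[of s, OF s] this]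
    show "runs_within s (Seq p q) ((K + L) * s ''n'' 0 ^ i * (s ''m'' 0 + 1) ^ j)"
      by (simp add: algebra_simps)
  qed
qed

lemma cost_bounded_Cond:
  assumes "cost_bounded p i j" "cost_bounded q i j"
  shows "cost_bounded (Cond e p q) i j"
proof -
  obtain K L where K': "cost_bounded_by K p i j" and L': "cost_bounded_by L q i j"
    using assms(1,2) unfolding cost_bounded_def by blast
  note K = cost_bounded_byD[OF K'] and L = cost_bounded_byD[OF L']
  show ?thesis
  proof (rule cost_boundedI[where K = "1 + bcost e + (K + L)"])
    fix s :: state assume s: "1 \<le> s ''n'' 0" "1 \<le> s ''m'' 0"
    let ?f = "s ''n'' 0 ^ i * (s ''m'' 0 + 1) ^ j"
    have "runs_within s (Cond e p q) (1 + bcost e + (K + L) * ?f)"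
      by (intro runs_within_Cond runs_within_mono[OF K[of s, OF s]] runs_within_mono[OF L[of s, OF s]]) (auto simp: algebra_simps)
    then show "runs_within s (Cond e p q) ((1 + bcost e + (K + L)) * s ''n'' 0 ^ i * (s ''m'' 0 + 1) ^ j)"
      using const_le_cost[OF s(1), of "1 + bcost e" i "s ''m'' 0" j]
      by (elim runs_within_mono) (simp add: algebra_simps)
  qed
qed

text \<open>Exponents add, since a monomial number of rounds of monomial cost is executed. The round
  count is a function \<open>g\<close> of the two sizes, so it cannot change while the body leaves
  them alone.\<close>

lemma cost_bounded_For:
  assumes p: "cost_bounded p i j" and x: "x \<notin> writes p" "x \<noteq> ''n''" "x \<noteq> ''m''" "''n'' \<notin> writes p" "''m'' \<notin> writes p"
    and a: "\<And>s. aval a s = g (s ''n'' 0) (s ''m'' 0)"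
    and g: "\<And>n m. 1 \<le> n \<Longrightarrow> 1 \<le> m \<Longrightarrow> g n m \<le> L * n ^ i' * (m + 1) ^ j'"
  shows "cost_bounded (For x a p) (i + i') (j + j')"
proof -
  obtain K where K': "cost_bounded_by K p i j"
    using p unfolding cost_bounded_def by blast
  note K = cost_bounded_byD[OF K']
  show ?thesis
  proof (rule cost_boundedI[where K = "L * (K + acost a + 11) + (acost a + 14)"])
    fix s :: state assume s: "1 \<le> s ''n'' 0" "1 \<le> s ''m'' 0"
    let ?n = "s ''n'' 0" and ?m = "s ''m'' 0"
    let ?f = "?n ^ i * (?m + 1) ^ j" and ?h = "?n ^ i' * (?m + 1) ^ j'"
    have 1: "s' ''n'' = s ''n''" "s' ''m'' = s ''m''" if "agree (insert x (writes p)) s s'" for s'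
      using x by (auto intro!: agreeD[OF that])
    have "runs_within s (For x a p) (g ?n ?m * (K * ?f + acost a + 11) + (acost a + 14))"
    proof (rule runs_within_For[OF _ _ x(1)])
      fix s' assume *: "agree (insert x (writes p)) s s'"
      show "aval a s' = g ?n ?m"
        using a[of s'] 1[OF *] by simp
      show "runs_within s' p (K * ?f)"
        using K[of s'] s unfolding 1[OF *] mult.assoc by blast
    qed
    moreover have "g ?n ?m * (K * ?f + acost a + 11) + (acost a + 14)
        \<le> (L * (K + acost a + 11) + (acost a + 14)) * ?n ^ (i + i') * (?m + 1) ^ (j + j')"
    proof -
      have f: "1 \<le> ?f" and h: "1 \<le> ?h" using s by (simp_all add: Suc_le_eq)
      have 2: "K * ?f + acost a + 11 \<le> (K + acost a + 11) * ?f"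
        using mult_le_mono2[OF f, of "acost a + 11"] unfolding add_mult_distrib by linarith
      have 3: "acost a + 14 \<le> (acost a + 14) * (?f * ?h)"
        using mult_le_mono2[OF mult_le_mono[OF f h], of "acost a + 14"] by simp
      have "g ?n ?m * (K * ?f + acost a + 11) \<le> (L * ?h) * ((K + acost a + 11) * ?f)"
        using g[OF s] 2 by (intro mult_le_mono) (simp_all only: mult.assoc)
      then show ?thesis
        using 3 by (simp add: algebra_simps power_add)
    qed
    ultimately show "runs_within s (For x a p) ((L * (K + acost a + 11) + (acost a + 14)) * ?n ^ (i + i') * (?m + 1) ^ (j + j'))"
      by (rule runs_within_mono)
  qed
qed

lemmas cost_bounded_For_n = cost_bounded_For[where a = "V ''n''" and g = "\<lambda>n m. n" and L = 1 and i' = 1 and j' = 0, simplified]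

lemmas cost_bounded_For_m = cost_bounded_For[where a = "V ''m''" and g = "\<lambda>n m. m" and L = 1 and i' = 0 and j' = 1, simplified]

lemma cost_bounded_For_Suc_m:
  assumes "cost_bounded p i j" "x \<notin> writes p" "x \<noteq> ''n''" "x \<noteq> ''m''" "''n'' \<notin> writes p" "''m'' \<notin> writes p"
  shows "cost_bounded (For x (Plus (V ''m'') (Const 1)) p) i (Suc j)"
  using cost_bounded_For[OF assms, where g = "\<lambda>n m. m + 1" and L = 1 and i' = 0 and j' = 1] by simp

lemmas cost_bounded_For_Const = cost_bounded_For[where a = "Const u" and g = "\<lambda>n m. u" and L = u and i' = 0 and j' = 0, simplified] for u

section \<open>Properties of all outcomes\<close>

lemma post_Skip [simp]: "post Skip s Q \<longleftrightarrow> Q s"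
  by (simp add: post_def)

lemma post_Store [simp]: "post (Store x i a) s Q \<longleftrightarrow> Q (update s x (aval i s) (aval a s))"
  by (simp add: post_def)

lemma post_Rand [simp]: "post (Rand x i a) s Q \<longleftrightarrow> (\<forall>r \<le> aval a s. Q (update s x (aval i s) r))"
  by (auto simp: post_def)

lemma post_Seq [simp]: "post (Seq p q) s Q \<longleftrightarrow> post p s (\<lambda>s'. post q s' Q)"
  unfolding post_def by (fastforce simp: set_exec_Seq)

lemma post_Cond [simp]: "post (Cond e p q) s Q \<longleftrightarrow> (if bval e s then post p s Q else post q s Q)"
  by (auto simp: post_def)

lemma post_weaken:
  assumes "post p s Q" "\<And>s'. agree (writes p) s s' \<Longrightarrow> Q s' \<Longrightarrow> Q' s'"
  shows "post p s Q'"
  using assms exec_agree unfolding post_def by blast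

text \<open>The invariant is indexed by the counter, and the increment is built into the step
  hypothesis as an update after the body, so that only the body itself has to be verified.\<close>

lemma post_While:
  fixes x :: string and p :: com
  defines "W \<equiv> insert x (writes p)"
  assumes x: "x \<notin> writes p"
    and a: "\<And>s'. agree W s s' \<Longrightarrow> aval a s' = B"
    and step: "\<And>j s'. j < B \<Longrightarrow> agree W s s' \<Longrightarrow> s' x 0 = j \<Longrightarrow> I j s' \<Longrightarrow>
      post p s' (\<lambda>s''. I (Suc j) (update s'' x 0 (Suc j)))"
    and fin: "\<And>s'. agree W s s' \<Longrightarrow> s' x 0 = B \<Longrightarrow> I B s' \<Longrightarrow> Q s'"
    and "agree W s s0" "s0 x 0 + d = B" "I (s0 x 0) s0"
  shows "post (While (Less (V x) a) (Seq p (incr x))) s0 Q"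
  using assms(6-8)
proof (induction d arbitrary: s0)
  case 0
  then show ?case using fin a[of s0] by (simp add: exec_While post_def)
next
  case (Suc d)
  let ?w = "While (Less (V x) a) (Seq p (incr x))"
  have "post p s0 (\<lambda>s'. post ?w (update s' x 0 (Suc (s' x 0))) Q)"
  proof (rule post_weaken[OF step[OF _ Suc.prems(1) refl Suc.prems(3)]])
    fix s'
    assume *: "agree (writes p) s0 s'"
      "I (Suc (s0 x 0)) (update s' x 0 (Suc (s0 x 0)))"
    have "agree W s s'" using Suc.prems(1) *(1) by (auto simp: agree_def W_def)
    moreover have "s' x 0 = s0 x 0" using agreeD[OF *(1) x] by simp
    ultimately show "post ?w (update s' x 0 (Suc (s' x 0))) Q"
      using * Suc.prems(2) by (intro Suc.IH) (auto simp: W_def agree_update)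
  qed (use Suc.prems in simp)
  then have "post (Seq (Seq p (incr x)) ?w) s0 Q"
    by (simp add: incr_def)
  moreover have "exec ?w s0 = tick (1 + bcost (Less (V x) a)) (exec (Seq (Seq p (incr x)) ?w) s0)"
    using a Suc.prems by (subst exec_While) simp
  ultimately show ?case by (auto simp: post_def)
qed

lemma post_For:
  assumes "x \<notin> writes p"
    and "\<And>s'. agree (insert x (writes p)) s s' \<Longrightarrow> aval a s' = B"
    and "I 0 (update s x 0 0)"
    and "\<And>j s'. j < B \<Longrightarrow> agree (insert x (writes p)) s s' \<Longrightarrow> s' x 0 = j \<Longrightarrow> I j s' \<Longrightarrow>
      post p s' (\<lambda>s''. I (Suc j) (update s'' x 0 (Suc j)))"
    and "\<And>s'. agree (insert x (writes p)) s s' \<Longrightarrow> s' x 0 = B \<Longrightarrow> I B s' \<Longrightarrow> Q s'"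
  shows "post (For x a p) s Q"
  unfolding For_def post_Seq post_Store
  using assms by (intro post_While[where s = s and I = I and B = B and d = B]) (auto simp: agree_update)

section \<open>Expectations\<close>

text \<open>The weakest pre-expectation of \<open>f\<close>. Values in \<open>ennreal\<close> need
  no integrability, and diverging runs contribute 0.\<close>

definition expect :: "com \<Rightarrow> (state \<Rightarrow> ennreal) \<Rightarrow> state \<Rightarrow> ennreal" where
  "expect p f s = (\<integral>\<^sup>+ r. f (fst r) \<partial>measure_spmf (exec p s))"

lemma nn_integral_bind_spmf:
  "(\<integral>\<^sup>+ y. f y \<partial>measure_spmf (bind_spmf R S)) = (\<integral>\<^sup>+ x. \<integral>\<^sup>+ y. f y \<partial>measure_spmf (S x) \<partial>measure_spmf R)"
  unfolding measure_spmf_bind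
  by (subst nn_integral_bind[where B = "count_space UNIV"]) (auto simp: space_subprob_algebra)

lemma expect_tick: "(\<integral>\<^sup>+ r. f (fst r) \<partial>measure_spmf (tick t R)) = (\<integral>\<^sup>+ r. f (fst r) \<partial>measure_spmf R)"
  by (auto simp: tick_def intro!: nn_integral_cong split: prod.splits)

lemma expect_Store: "expect (Store x i a) f s = f (update s x (aval i s) (aval a s))"
  by (simp add: expect_def measure_spmf_return_spmf nn_integral_return)

lemma expect_Rand:
  "expect (Rand x i a) f s = (\<Sum>r \<le> aval a s. f (update s x (aval i s) r)) / (aval a s + 1)"
  by (simp add: expect_def nn_integral_spmf_of_set o_def)

lemma expect_Seq: "expect (Seq p q) f s = expect p (expect q f) s"
  unfolding expect_def exec_Seq
  by (simp add: nn_integral_bind_spmf case_prod_beta expect_tick)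

lemma expect_Cond: "expect (Cond e p q) f s = (if bval e s then expect p f s else expect q f s)"
  unfolding expect_def exec_Cond by (simp add: expect_tick)

lemma expect_cong:
  assumes "\<And>s'. agree (writes p) s s' \<Longrightarrow> f s' = g s'"
  shows "expect p f s = expect p g s"
  unfolding expect_def using exec_agree[of _ _ p s] assms by (intro nn_integral_cong_AE) auto

text \<open>This turns a fact about all outcomes into a lower bound on an expectation. Missing mass
  would count as 0, hence the losslessness.\<close>

lemma expect_ge_post:
  assumes "lossless_spmf (exec p s)" "post p s Q" "\<And>s'. Q s' \<Longrightarrow> agree (writes p) s s' \<Longrightarrow> c \<le> f s'"
  shows "c \<le> expect p f s"
proof -
  have "c = (\<integral>\<^sup>+ r. c \<partial>measure_spmf (exec p s))"
    using assms(1) by (simp add: measure_spmf.emeasure_eq_measure lossless_spmf_def weight_spmf_def)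
  also have "\<dots> \<le> expect p f s"
    unfolding expect_def using assms(2,3) exec_agree[of _ _ p s]
    by (intro nn_integral_mono_AE) (auto simp: post_def)
  finally show ?thesis .
qed

text \<open>\<open>G j s c\<close> reads: with counter \<open>j\<close> and state \<open>s\<close>,
  an expectation of at least \<open>c\<close> is promised. A relation instead of a function admits
  several kinds of promise for one state. The step hypothesis speaks of every \<open>g\<close> that
  keeps the promises of the next round, since this is all that is known about the value of the rest
  of the loop.\<close>

lemma expect_While_ge:
  fixes x :: string and p :: com
  defines "W \<equiv> insert x (writes p)"
  assumes x: "x \<notin> writes p"
    and a: "\<And>s'. agree W s s' \<Longrightarrow> aval a s' = B"
    and step: "\<And>j s' c g. j < B \<Longrightarrow> agree W s s' \<Longrightarrow> s' x 0 = j \<Longrightarrow> G j s' c \<Longrightarrow>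
      (\<And>s'' c'. G (Suc j) (update s'' x 0 (Suc j)) c' \<Longrightarrow> c' \<le> g s'') \<Longrightarrow> c \<le> expect p g s'"
    and fin: "\<And>s' c. agree W s s' \<Longrightarrow> G B s' c \<Longrightarrow> c \<le> f s'"
    and "agree W s s0" "s0 x 0 + d = B" "G (s0 x 0) s0 c"
  shows "c \<le> expect (While (Less (V x) a) (Seq p (incr x))) f s0"
  using assms(6-8)
proof (induction d arbitrary: s0 c)
  case 0
  then have "expect (While (Less (V x) a) (Seq p (incr x))) f s0 = f s0"
    using a[of s0] by (simp add: exec_While expect_def expect_tick measure_spmf_return_spmf nn_integral_return)
  then show ?case using fin 0 by simp
next
  case (Suc d)
  let ?w = "While (Less (V x) a) (Seq p (incr x))"
  define g where "g s' = expect ?w f (update s' x 0 (Suc (s' x 0)))" for s'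
  define g' where "g' s' = (if agree W s s' \<and> s' x 0 = s0 x 0 then g s' else \<top>)" for s'
  have "exec ?w s0 = tick (1 + bcost (Less (V x) a)) (exec (Seq (Seq p (incr x)) ?w) s0)"
    using a Suc.prems by (subst exec_While) simp
  then have "expect ?w f s0 = expect (Seq (Seq p (incr x)) ?w) f s0"
    unfolding expect_def by (simp only: expect_tick)
  also have "\<dots> = expect p g s0"
    by (simp add: expect_Seq[abs_def] expect_Store[abs_def] incr_def g_def[abs_def])
  also have "\<dots> = expect p g' s0"
  proof (rule expect_cong)
    fix s' assume *: "agree (writes p) s0 s'"
    then have "agree W s s'" using Suc.prems(1) by (auto simp: agree_def W_def)
    then show "g s' = g' s'" using agreeD[OF * x] by (simp add: g'_def)
  qed
  also have "c \<le> \<dots>"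
  proof (rule step[OF _ Suc.prems(1) refl Suc.prems(3)])
    show "s0 x 0 < B" using Suc.prems by simp
    fix s'' c'
    assume *: "G (Suc (s0 x 0)) (update s'' x 0 (Suc (s0 x 0))) c'"
    show "c' \<le> g' s''"
    proof (cases "agree W s s'' \<and> s'' x 0 = s0 x 0")
      case True
      then have "c' \<le> g s''"
        unfolding g_def using * Suc.prems(2)
        by (intro Suc.IH) (auto simp: W_def agree_update)
      then show ?thesis using True by (simp add: g'_def)
    qed (auto simp: g'_def)
  qed
  finally show ?case .
qed

lemma expect_For_ge:
  assumes "x \<notin> writes p"
    and "\<And>s'. agree (insert x (writes p)) s s' \<Longrightarrow> aval a s' = B"
    and "G 0 (update s x 0 0) c"
    and "\<And>j s' c g. j < B \<Longrightarrow> agree (insert x (writes p)) s s' \<Longrightarrow> s' x 0 = j \<Longrightarrow> G j s' c \<Longrightarrow>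
      (\<And>s'' c'. G (Suc j) (update s'' x 0 (Suc j)) c' \<Longrightarrow> c' \<le> g s'') \<Longrightarrow> c \<le> expect p g s'"
    and "\<And>s' c. agree (insert x (writes p)) s s' \<Longrightarrow> G B s' c \<Longrightarrow> c \<le> f s'"
  shows "c \<le> expect (For x a p) f s"
  unfolding For_def expect_Seq expect_Store
  using assms by (intro expect_While_ge[where s = s and G = G and B = B and d = B]) (auto simp: agree_update)

section \<open>Contractions\<close>

locale costed_hypergraph =
  fixes k n m :: nat and E :: "nat \<Rightarrow> nat set" and c :: "nat \<Rightarrow> nat \<Rightarrow> nat" and b :: "nat \<Rightarrow> nat"
  assumes k: "1 \<le> k" and E: "e < m \<Longrightarrow> E e \<subseteq> {..<n}"
begin

definition cut :: "nat set \<Rightarrow> nat set" where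
  "cut U = {e. e < m \<and> E e \<inter> U \<noteq> {} \<and> E e - U \<noteq> {}}"

definition labelling :: "(nat \<Rightarrow> nat) \<Rightarrow> bool" where
  "labelling l \<longleftrightarrow> (\<forall>v<n. l v < n \<and> l (l v) = l v)"

definition blocks :: "(nat \<Rightarrow> nat) \<Rightarrow> nat set" where
  "blocks l = {v. v < n \<and> l v = v}"

text \<open>The hyperedge as it appears after contraction; its cardinality is its current
  size.\<close>

definition trace :: "(nat \<Rightarrow> nat) \<Rightarrow> nat \<Rightarrow> nat set" where
  "trace l e = l ` E e"

definition crossing :: "(nat \<Rightarrow> nat) \<Rightarrow> nat set" where
  "crossing l = {e. e < m \<and> 1 < card (trace l e)}"

definition star :: "(nat \<Rightarrow> nat) \<Rightarrow> nat \<Rightarrow> nat set" where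
  "star l v = {e \<in> crossing l. v \<in> trace l e}"

text \<open>\<open>U\<close> is a union of blocks, that is, the target cut has survived all
  contractions.\<close>

definition saturated :: "(nat \<Rightarrow> nat) \<Rightarrow> nat set \<Rightarrow> bool" where
  "saturated l U \<longleftrightarrow> (\<forall>u<n. \<forall>v<n. l u = l v \<longrightarrow> (u \<in> U \<longleftrightarrow> v \<in> U))"

text \<open>The representative of the merged block is left open, so that the analysis does not
  depend on the program's choice.\<close>

definition contracts :: "(nat \<Rightarrow> nat) \<Rightarrow> nat \<Rightarrow> (nat \<Rightarrow> nat) \<Rightarrow> bool" where
  "contracts l e l' \<longleftrightarrow> (\<exists>r \<in> trace l e. \<forall>v<n. l' v = (if l v \<in> trace l e then r else l v))"

definition violators :: "(nat \<Rightarrow> nat) \<Rightarrow> nat \<Rightarrow> nat set" where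
  "violators l i = {v \<in> blocks l. b i < sum (c i) (star l v)}"

lemma finite_blocks [simp]: "finite (blocks l)"
  by (simp add: blocks_def)

lemma finite_crossing [simp]: "finite (crossing l)"
  by (simp add: crossing_def)

lemma finite_star [simp]: "finite (star l v)"
  by (simp add: star_def)

lemma finite_trace: "e < m \<Longrightarrow> finite (trace l e)"
  using E by (auto simp: trace_def intro: finite_subset)

lemma trace_subset_blocks: "labelling l \<Longrightarrow> e < m \<Longrightarrow> trace l e \<subseteq> blocks l"
  using E unfolding labelling_def trace_def blocks_def by fastforce

lemma one_less_card_iff: "finite A \<Longrightarrow> Suc 0 < card A \<longleftrightarrow> (\<exists>x \<in> A. \<exists>y \<in> A. x \<noteq> y)"
  using card_le_Suc0_iff_eq[of A] by (auto simp: not_le[symmetric])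

text \<open>A crossing hyperedge that meets block \<open>v\<close> also meets another block. Since
  stars are therefore cuts of the original hypergraph, a trial may stop at a cheap star.\<close>

lemma star_eq_cut: "star l v = cut {u. u < n \<and> l u = v}"
proof (intro set_eqI)
  fix e
  show "e \<in> star l v \<longleftrightarrow> e \<in> cut {u. u < n \<and> l u = v}"
  proof (cases "e < m")
    case True
    have "E e \<inter> {u. u < n \<and> l u = v} \<noteq> {} \<longleftrightarrow> v \<in> trace l e"
      "E e - {u. u < n \<and> l u = v} \<noteq> {} \<longleftrightarrow> (\<exists>w \<in> trace l e. w \<noteq> v)"
      using E[OF True] by (auto simp: trace_def)
    moreover have "e \<in> star l v \<longleftrightarrow> v \<in> trace l e \<and> (\<exists>w \<in> trace l e. w \<noteq> v)"
      using True finite_trace[OF True, of l] unfolding star_def crossing_def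
      by (simp add: one_less_card_iff) metis
    ultimately show ?thesis using True by (simp add: cut_def)
  qed (simp add: star_def crossing_def cut_def)
qed

lemma block_proper:
  assumes "v \<in> blocks l" "1 < card (blocks l)"
  shows "{u. u < n \<and> l u = v} \<noteq> {}" "{u. u < n \<and> l u = v} \<subset> {..<n}"
proof -
  obtain w where "w \<in> blocks l" "w \<noteq> v"
    using assms(2) one_less_card_iff[OF finite_blocks, of l] by (metis One_nat_def)
  then have "w < n" "w \<notin> {u. u < n \<and> l u = v}" by (simp_all add: blocks_def)
  then show "{u. u < n \<and> l u = v} \<noteq> {}" "{u. u < n \<and> l u = v} \<subset> {..<n}"
    using assms(1) unfolding blocks_def by blast+
qed

lemma cut_subset_crossing: "saturated l U \<Longrightarrow> cut U \<subseteq> crossing l"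
proof
  fix e assume "saturated l U" "e \<in> cut U"
  then obtain u v where "e < m" "u \<in> E e" "v \<in> E e" "u \<in> U" "v \<notin> U" by (auto simp: cut_def)
  moreover have "l u \<noteq> l v"
    using calculation E \<open>saturated l U\<close> unfolding saturated_def by blast
  ultimately show "e \<in> crossing l"
    using finite_trace[of e l] by (auto simp: crossing_def one_less_card_iff trace_def)
qed

text \<open>Both sides of a surviving target cut contain a block, so a run without mistakes always
  passes the program's test for two blocks.\<close>

lemma two_blocks:
  assumes "labelling l" "saturated l U" "U \<noteq> {}" "U \<subset> {..<n}"
  shows "1 < card (blocks l)"
proof -
  obtain u v where uv: "u \<in> U" "u < n" "v < n" "v \<notin> U" using assms by blast
  then have "l u \<noteq> l v" using assms(2) unfolding saturated_def by blast
  moreover have "l u \<in> blocks l" "l v \<in> blocks l"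
    using uv assms(1) by (auto simp: blocks_def labelling_def)
  ultimately show ?thesis by (auto simp: one_less_card_iff)
qed

lemma contracts_labelling:
  assumes "labelling l" "contracts l e l'" "e < m"
  shows "labelling l'"
proof -
  obtain r where r: "r \<in> trace l e" "\<And>v. v < n \<Longrightarrow> l' v = (if l v \<in> trace l e then r else l v)"
    using assms unfolding contracts_def by blast
  have "r < n" "l r = r"
    using r(1) trace_subset_blocks[OF assms(1,3)] by (auto simp: blocks_def)
  then show ?thesis
    using r assms(1) unfolding labelling_def by auto
qed

lemma contracts_blocks:
  assumes "labelling l" "contracts l e l'" "e < m"
  shows "card (blocks l') = card (blocks l) - (card (trace l e) - 1)"
    "card (trace l e) \<le> card (blocks l)"
proof -
  obtain r where r: "r \<in> trace l e" "\<And>v. v < n \<Longrightarrow> l' v = (if l v \<in> trace l e then r else l v)"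
    using assms unfolding contracts_def by blast
  have sub: "trace l e \<subseteq> blocks l" by (rule trace_subset_blocks[OF assms(1,3)])
  show "card (trace l e) \<le> card (blocks l)" using sub by (simp add: card_mono)
  have "blocks l' = insert r (blocks l - trace l e)"
    using r sub by (auto simp: blocks_def split: if_splits)
  then have "card (blocks l') = Suc (card (blocks l - trace l e))"
    using r(1) by simp
  also have "\<dots> = Suc (card (blocks l) - card (trace l e))"
    using sub finite_trace[OF assms(3)] by (simp add: card_Diff_subset)
  finally show "card (blocks l') = card (blocks l) - (card (trace l e) - 1)"
    using \<open>card (trace l e) \<le> card (blocks l)\<close> r(1) finite_trace[OF assms(3), of l]
    by (cases "card (trace l e)") auto
qed

text \<open>A hyperedge outside the cut lies on one side of \<open>U\<close>, and by saturation so
  do all blocks it meets; merging these keeps \<open>U\<close> a union of blocks.\<close>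

lemma contracts_saturated:
  assumes "saturated l U" "contracts l e l'" "e < m" "e \<notin> cut U"
  shows "saturated l' U"
proof -
  obtain r where r: "r \<in> trace l e" "\<And>v. v < n \<Longrightarrow> l' v = (if l v \<in> trace l e then r else l v)"
    using assms unfolding contracts_def by blast
  have E': "u < n" if "u \<in> E e" for u using E[OF assms(3)] that by auto
  have same: "u \<in> U \<longleftrightarrow> v \<in> U" if h: "u < n" "v < n" "l u \<in> trace l e" "l v \<in> trace l e" for u v
  proof -
    obtain u' v' where "u' \<in> E e" "v' \<in> E e" "l u = l u'" "l v = l v'"
      using h by (auto simp: trace_def)
    moreover have "u' \<in> U \<longleftrightarrow> v' \<in> U" using assms(3,4) calculation by (auto simp: cut_def)
    ultimately show ?thesis using assms(1) h E' unfolding saturated_def by metis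
  qed
  show ?thesis
    unfolding saturated_def
  proof (intro allI impI)
    fix u v assume uv: "u < n" "v < n" "l' u = l' v"
    show "u \<in> U \<longleftrightarrow> v \<in> U"
    proof (cases "l u \<in> trace l e \<and> l v \<in> trace l e")
      case True
      then show ?thesis using same uv by blast
    next
      case False
      \<comment> \<open>A vertex outside the merged blocks cannot have label \<open>r\<close>,
        because \<open>r\<close> itself belongs to the trace.\<close>
      then have "l u = l v" using r(1) r(2)[OF uv(1)] r(2)[OF uv(2)] uv(3) by metis
      then show ?thesis using assms(1) uv unfolding saturated_def by blast
    qed
  qed
qed

text \<open>Contraction never separates vertices, and it shrinks \<open>e\<close> to a single block.
  The strict decrease is what bounds the length of a trial.\<close>

lemma contracts_crossing:
  assumes "contracts l e l'" "e < m"
  shows "crossing l' \<subseteq> crossing l - {e}"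
proof
  obtain r where r: "r \<in> trace l e" "\<And>v. v < n \<Longrightarrow> l' v = (if l v \<in> trace l e then r else l v)"
    using assms unfolding contracts_def by blast
  fix f assume f: "f \<in> crossing l'"
  then have fm: "f < m" by (simp add: crossing_def)
  obtain u v where uv: "u \<in> E f" "v \<in> E f" "l' u \<noteq> l' v"
    using f finite_trace[OF fm, of l'] by (auto simp: crossing_def one_less_card_iff trace_def)
  have "u < n" "v < n" using uv E[OF fm] by auto
  then have "l' u = (if l u \<in> trace l e then r else l u)" "l' v = (if l v \<in> trace l e then r else l v)"
    using r(2) by blast+
  then have "l u \<noteq> l v" "\<not> (l u \<in> trace l e \<and> l v \<in> trace l e)" using uv(3) by metis+
  then have "l u \<noteq> l v" "f \<noteq> e" using uv by (auto simp: trace_def)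
  then show "f \<in> crossing l - {e}"
    using uv fm finite_trace[OF fm, of l] by (auto simp: crossing_def one_less_card_iff trace_def)
qed

text \<open>Double counting of incidences between violating blocks and undecided hyperedges. A
  violating star costs more than the budget, hence more than the target cut; removing
  \<open>D\<close> from both takes at least as much from the cut, because \<open>D\<close> lies
  inside it. The \<open>+ 1\<close> records strictness and keeps the bound useful when the rest of
  the cut is free.\<close>

lemma violators_cost:
  assumes l: "labelling l" and U: "saturated l U" "\<And>i. i < k \<Longrightarrow> sum (c i) (cut U) \<le> b i"
    and D: "D \<subseteq> cut U" and i: "i < k"
    and heavy: "card (blocks l) \<le> k * card (violators l i)"
  shows "card (blocks l) * (sum (c i) (cut U - D) + 1) \<le> k * (\<Sum>e \<in> crossing l - D. c i e * card (trace l e))"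
proof -
  let ?R = "crossing l - D"
  have cutX: "cut U \<subseteq> crossing l" by (rule cut_subset_crossing[OF U(1)])
  have fin: "finite (cut U)" using cutX by (rule finite_subset) simp
  have finD [simp]: "finite D" using D fin by (rule finite_subset)
  have star: "sum (c i) (cut U - D) + 1 \<le> sum (c i) (star l v - D)" if "v \<in> violators l i" for v
  proof -
    have "sum (c i) (cut U - D) + sum (c i) D = sum (c i) (cut U)"
      using D fin by (metis add.commute sum.subset_diff)
    moreover have "sum (c i) (star l v) \<le> sum (c i) (star l v - D) + sum (c i) D"
    proof -
      have "sum (c i) (star l v) \<le> sum (c i) ((star l v - D) \<union> D)"
        by (intro sum_mono2) auto
      also have "\<dots> = sum (c i) (star l v - D) + sum (c i) D"
        by (intro sum.union_disjoint) auto
      finally show ?thesis .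
    qed
    ultimately show ?thesis using that U(2)[OF i] by (simp add: violators_def)
  qed
  have "card (violators l i) * (sum (c i) (cut U - D) + 1) \<le> (\<Sum>v \<in> violators l i. sum (c i) (star l v - D))"
    using sum_bounded_below[of "violators l i" "sum (c i) (cut U - D) + 1"] star by simp
  also have "\<dots> \<le> (\<Sum>v \<in> blocks l. sum (c i) (star l v - D))"
    by (intro sum_mono2) (auto simp: violators_def)
  also have "\<dots> = (\<Sum>v \<in> blocks l. \<Sum>e \<in> ?R. if v \<in> trace l e then c i e else 0)"
  proof (rule sum.cong[OF refl])
    fix v assume "v \<in> blocks l"
    have "star l v - D = {e \<in> ?R. v \<in> trace l e}" by (auto simp: star_def)
    then show "sum (c i) (star l v - D) = (\<Sum>e \<in> ?R. if v \<in> trace l e then c i e else 0)"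
      using sum.inter_filter[of ?R "c i" "\<lambda>e. v \<in> trace l e"] by simp
  qed
  also have "\<dots> = (\<Sum>e \<in> ?R. \<Sum>v \<in> blocks l. if v \<in> trace l e then c i e else 0)"
    by (rule sum.swap)
  also have "\<dots> = (\<Sum>e \<in> ?R. c i e * card (trace l e))"
  proof (intro sum.cong refl)
    fix e assume "e \<in> ?R"
    then have "trace l e \<subseteq> blocks l" using trace_subset_blocks[OF l] by (auto simp: crossing_def)
    then have "{v \<in> blocks l. v \<in> trace l e} = trace l e" by auto
    then show "(\<Sum>v \<in> blocks l. if v \<in> trace l e then c i e else 0) = c i e * card (trace l e)"
      by (simp add: sum.inter_filter[symmetric])
  qed
  finally have "k * (card (violators l i) * (sum (c i) (cut U - D) + 1)) \<le> k * (\<Sum>e \<in> ?R. c i e * card (trace l e))"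
    by (rule mult_le_mono2)
  moreover have "card (blocks l) * (sum (c i) (cut U - D) + 1) \<le> k * card (violators l i) * (sum (c i) (cut U - D) + 1)"
    using heavy by (rule mult_le_mono1)
  ultimately show ?thesis unfolding mult.assoc by linarith
qed

end

section \<open>The potential\<close>

text \<open>Bounds the number of large contractions in a successful run, each of which shrinks
  \<open>N\<close> by the factor \<open>1 - 1 / a\<close>. It is an integer recursion and not a
  logarithm because the program replays it in \<open>repetitions\<close>.\<close>

function depth :: "nat \<Rightarrow> nat \<Rightarrow> nat" where
  "depth a N = (if N \<le> 1 \<or> a = 0 then 0 else Suc (depth a ((a - 1) * N div a)))"
  by auto
termination
  by (relation "Wellfounded.measure snd") (auto intro!: less_mult_imp_div_less simp: mult.commute)

declare depth.simps [simp del]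

lemma depth_mono: "M \<le> N \<Longrightarrow> depth a M \<le> depth a N"
proof (induction a N arbitrary: M rule: depth.induct)
  case (1 a N)
  show ?case
  proof (cases "M \<le> 1 \<or> a = 0")
    case True
    then show ?thesis by (simp add: depth.simps[of a M])
  next
    case False
    then have "(a - 1) * M div a \<le> (a - 1) * N div a" using 1(2) by (intro div_le_mono mult_le_mono2)
    then show ?thesis
      using False 1 by (simp add: depth.simps[of a M] depth.simps[of a N])
  qed
qed

lemma depth_shrink:
  assumes "1 \<le> N'" "N' < N" "a * N' \<le> (a - 1) * N" "0 < a"
  shows "Suc (depth a N') \<le> depth a N"
proof -
  have "N' \<le> (a - 1) * N div a" using assms by (simp add: less_eq_div_iff_mult_less_eq mult.commute)
  then show ?thesis using assms depth_mono by (simp add: depth.simps[of a N])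
qed

text \<open>One unfolding lowers \<open>a ln N\<close> by at least 1, as
  \<open>ln (1 - 1 / a) <= - 1 / a\<close>, and rounding down only helps.\<close>

lemma depth_le_ln:
  assumes "2 \<le> a" "1 \<le> N"
  shows "real (depth a N) \<le> real a * ln (real N)"
  using assms
proof (induction a N rule: depth.induct)
  case (1 a N)
  let ?N = "(a - 1) * N div a"
  show ?case
  proof (cases "N \<le> 1")
    case True
    then show ?thesis using 1 by (simp add: depth.simps[of a N])
  next
    case False
    \<comment> \<open>The next value stays at least 1, so that the induction hypothesis applies to
      it.\<close>
    have "a \<le> (a - 1) * 2" using 1(2) by linarith
    also have "\<dots> \<le> (a - 1) * N" using False by (intro mult_le_mono2) simp
    finally have "a \<le> (a - 1) * N" .
    then have N1: "1 \<le> ?N" using 1(2) by (simp add: less_eq_div_iff_mult_less_eq)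
    have "real ?N \<le> real ((a - 1) * N) / real a" by (rule of_nat_div_le_of_nat)
    also have "\<dots> = real N * (1 - 1 / real a)" using 1(2) by (simp add: field_simps of_nat_diff)
    finally have le: "real ?N \<le> real N * (1 - 1 / real a)" .
    have "real (depth a N) = 1 + real (depth a ?N)" using False 1(2) by (simp add: depth.simps[of a N])
    also have "\<dots> \<le> 1 + real a * ln (real ?N)" using 1(1) False 1(2) N1 by simp
    also have "\<dots> \<le> 1 + real a * ln (real N * (1 - 1 / real a))"
      using le N1 by (simp add: mult_left_mono)
    also have "\<dots> = 1 + real a * (ln (real N) + ln (1 - 1 / real a))"
      using False 1(2) by (subst ln_mult) (simp_all add: field_simps)
    also have "\<dots> \<le> 1 + real a * (ln (real N) + (- 1 / real a))"
      using 1(2) ln_le_minus_one[of "1 - 1 / real a"] by (intro add_left_mono mult_left_mono) simp_all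
    also have "\<dots> = real a * ln (real N)" using 1(2) by (simp add: field_simps)
    finally show ?thesis .
  qed
qed

text \<open>A Karger-type bound \<open>N^(-3 k)\<close>, shifted by \<open>2 k\<close> to absorb the
  additive 1 in the size bound \<open>N / (3 k) + 1\<close> of small hyperedges. The maximum keeps
  the value positive and at most 1 for small \<open>N\<close>.\<close>

definition decay :: "nat \<Rightarrow> nat \<Rightarrow> real" where
  "decay k N = 1 / real (max 1 (N - 2 * k)) ^ (3 * k)"

lemma decay_pos: "0 < decay k N"
  unfolding decay_def by (intro divide_pos_pos zero_less_power) auto

lemma decay_le_1: "decay k N \<le> 1"
proof -
  have "1 \<le> real (max 1 (N - 2 * k)) ^ (3 * k)" by (rule one_le_power) simp
  then show ?thesis unfolding decay_def by (subst divide_le_eq_1_pos) linarith+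
qed

lemma decay_antimono: "M \<le> N \<Longrightarrow> decay k N \<le> decay k M"
  unfolding decay_def by (intro divide_left_mono power_mono mult_pos_pos) auto

lemma decay_shrink:
  assumes "3 * k * x < N" "1 \<le> k" "1 \<le> x"
  shows "decay k N * (1 + 3 * real k * real x / (real N - 2 * real k)) \<le> decay k (N - x)"
proof -
  have "3 * k * x + 1 \<le> N" using assms by simp
  moreover have "3 * k * 1 \<le> 3 * k * x" using assms by (intro mult_le_mono2)
  moreover have "(x - 1) * 1 \<le> (x - 1) * (3 * k - 1)" using assms by (intro mult_le_mono2) simp
  \<comment> \<open>This identity yields \<open>x + 2 k < N\<close>, so the maximum in
    \<open>decay\<close> is inactive both at \<open>N\<close> and at \<open>N - x\<close>.\<close>
  moreover have "(x - 1) * (3 * k - 1) + x + (3 * k - 1)= 3 * k * x"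
    using assms by (cases x; cases k) (auto simp: algebra_simps)
  ultimately have *: "x + 2 * k + 1 \<le> N" using assms by linarith
  define y where "y = real N - 2 * real k"
  have y: "0 < y - real x" "real x \<ge> 1"
    using * assms unfolding y_def by linarith+
  have d1: "decay k N = 1 / y ^ (3 * k)" and d2: "decay k (N - x) = 1 / (y - x) ^ (3 * k)"
    using * by (simp_all add: decay_def y_def max_def of_nat_diff algebra_simps)
  \<comment> \<open>The ratio of the two values of \<open>decay\<close> is
    \<open>(1 + x / (y - x))^(3 k)\<close>; Bernoulli's inequality extracts the linear gain.\<close>
  have "1 + real (3 * k) * (x / (y - x)) \<le> (1 + x / (y - x)) ^ (3 * k)"
    using y by (intro Bernoulli_inequality) (simp add: field_simps)
  moreover have "x / y \<le> x / (y - x)" using y by (intro divide_left_mono) auto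
  then have "real (3 * k) * (x / y) \<le> real (3 * k) * (x / (y - x))" by (intro mult_left_mono) auto
  moreover have "1 + x / (y - x) = y / (y - x)" using y by (simp add: field_simps)
  ultimately have "1 + 3 * real k * real x / y \<le> (y / (y - x)) ^ (3 * k)" by simp
  then have "1 / y ^ (3 * k) * (1 + 3 * real k * real x / y) \<le> 1 / y ^ (3 * k) * (y / (y - x)) ^ (3 * k)"
    using y by (intro mult_left_mono) auto
  also have "\<dots> = 1 / (y - x) ^ (3 * k)" using y by (simp add: power_divide)
  finally show ?thesis using d1 d2 by (simp add: y_def)
qed

text \<open>Contracting a hyperedge outside the target cut gains, to first order, a factor
  \<open>1 + 3 k (s - 1) / N\<close>, and \<open>s - 1 \<ge> s / 2\<close>. The hyperedges of the target cut count for the total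
  size but yield nothing; since they all have size at most \<open>N / (3 k) + 1\<close>, they take at most about a
  third of it.\<close>

lemma weighted_contraction:
  fixes s w :: "nat \<Rightarrow> nat"
  assumes R: "finite R" and k: "1 \<le> k"
    and s: "\<And>e. e \<in> R \<Longrightarrow> 2 \<le> s e \<and> 3 * k * (s e - 1) < N" and FR: "F \<subseteq> R"
    and total: "(N + 1) * (sum w F + 1) \<le> k * (\<Sum>e \<in> R. w e * s e)"
  shows "real (sum w R) * decay k N \<le> (\<Sum>e \<in> R - F. real (w e) * decay k (N - (s e - 1)))"
proof -
  have "R \<noteq> {}" using total by auto
  then obtain e0 where "e0 \<in> R" by blast
  have N: "3 * k < N"
  proof -
    have "1 \<le> s e0 - 1" using s[OF \<open>e0 \<in> R\<close>] by linarith
    then have "3 * k * 1 \<le> 3 * k * (s e0 - 1)" by (rule mult_le_mono2)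
    then show ?thesis using s[OF \<open>e0 \<in> R\<close>] by linarith
  qed
  define y where "y = real N - 2 * real k"
  have y: "0 < y" using N unfolding y_def by linarith
  define \<beta> where "\<beta> = real (sum w F)"
  have split: "sum g R = sum g (R - F) + sum g F" for g :: "nat \<Rightarrow> real"
    using FR R by (rule sum.subset_diff)
  have F_le: "real k * (\<Sum>e \<in> F. real (w e) * real (s e)) \<le> (real N / 3 + real k) * \<beta>"
  proof -
    have "real k * (\<Sum>e \<in> F. real (w e) * real (s e)) = (\<Sum>e \<in> F. real (w e) * (real k * real (s e)))"
      by (simp add: sum_distrib_left mult_ac)
    also have "\<dots> \<le> (\<Sum>e \<in> F. real (w e) * (real N / 3 + real k))"
    proof (intro sum_mono mult_left_mono)
      fix e assume "e \<in> F"
      then have e: "2 \<le> s e" "3 * k * (s e - 1) < N" using s FR by auto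
      then have "real (3 * k * (s e - 1)) < real N" by (simp only: of_nat_less_iff)
      then have "3 * real k * (real (s e) - 1) < real N" using e(1) by (simp add: of_nat_diff)
      then show "real k * real (s e) \<le> real N / 3 + real k" by (simp add: algebra_simps)
    qed simp
    finally show ?thesis by (simp add: \<beta>_def sum_distrib_right mult.commute)
  qed
  have tot: "(real N + 1) * (\<beta> + 1) \<le> real k * (\<Sum>e \<in> R. real (w e) * real (s e))"
  proof -
    have "real ((N + 1) * (sum w F + 1)) \<le> real (k * (\<Sum>e \<in> R. w e * s e))"
      using total by (simp only: of_nat_le_iff)
    then show ?thesis by (simp add: \<beta>_def algebra_simps)
  qed
  \<comment> \<open>Multiplied out, this reads
    \<open>3 / 2 (k - 1) \<beta> <= 2 k \<beta> + 3 / 2 (N + 1)\<close>: the shift by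
    \<open>2 k\<close> in \<open>y\<close> is spent here.\<close>
  have "y * \<beta> \<le> 3 / 2 * ((real N + 1) * (\<beta> + 1) - (real N / 3 + real k) * \<beta>)"
  proof -
    have "0 \<le> \<beta>" unfolding \<beta>_def by (rule of_nat_0_le_iff)
    then show ?thesis by (simp add: y_def algebra_simps)
  qed
  also have "\<dots> \<le> 3 / 2 * (real k * (\<Sum>e \<in> R - F. real (w e) * real (s e)))"
    using tot F_le split[of "\<lambda>e. real (w e) * real (s e)"] by (simp add: distrib_left)
  also have "\<dots> = (\<Sum>e \<in> R - F. real (w e) * (3 * real k * (real (s e) / 2)))"
    by (simp add: sum_distrib_left mult_ac)
  also have "\<dots> \<le> (\<Sum>e \<in> R - F. real (w e) * (3 * real k * real (s e - 1)))"
    using s by (intro sum_mono mult_left_mono) (fastforce simp: of_nat_diff)+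
  finally have gain: "\<beta> \<le> (\<Sum>e \<in> R - F. real (w e) * (3 * real k * real (s e - 1) / y))"
    using y by (simp add: sum_divide_distrib[symmetric] pos_le_divide_eq mult.commute)
  \<comment> \<open>The weight \<open>\<beta>\<close> of the draws that yield nothing is made up for
    by the gain on the others.\<close>
  have "real (sum w R) = (\<Sum>e \<in> R - F. real (w e)) + \<beta>"
    using split[of "\<lambda>e. real (w e)"] by (simp add: \<beta>_def)
  also have "\<dots> \<le> (\<Sum>e \<in> R - F. real (w e) * (1 + 3 * real k * real (s e - 1) / y))"
    using gain by (simp add: distrib_left sum.distrib)
  finally have "real (sum w R) * decay k N \<le> (\<Sum>e \<in> R - F. real (w e) * (1 + 3 * real k * real (s e - 1) / y)) * decay k N"
    using decay_pos[of k N] by (intro mult_right_mono) auto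
  also have "\<dots> = (\<Sum>e \<in> R - F. real (w e) * (decay k N * (1 + 3 * real k * real (s e - 1) / y)))"
    by (simp add: sum_distrib_left mult_ac)
  also have "\<dots> \<le> (\<Sum>e \<in> R - F. real (w e) * decay k (N - (s e - 1)))"
  proof (intro sum_mono mult_left_mono)
    fix e assume "e \<in> R - F"
    then have "2 \<le> s e" "3 * k * (s e - 1) < N" using s by auto
    then show "decay k N * (1 + 3 * real k * real (s e - 1) / y) \<le> decay k (N - (s e - 1))"
      unfolding y_def using k by (intro decay_shrink) auto
  qed simp
  finally show ?thesis .
qed

text \<open>Lower bound for the success probability of a trial in which \<open>u\<close> hyperedges are undecided and
  \<open>N + 1\<close> blocks are left.\<close>

definition potential :: "nat \<Rightarrow> nat \<Rightarrow> nat \<Rightarrow> nat \<Rightarrow> real" where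
  "potential k m u N = (real m / (real m + 1)) ^ u * (1 / (real m + 1)) ^ depth (3 * k) N * decay k N"

lemma potential_nonneg: "0 \<le> potential k m u N"
  using decay_pos[of k N] by (simp add: potential_def)

lemma potential_le_1: "potential k m u N \<le> 1"
proof -
  have "(real m / (real m + 1)) ^ u \<le> 1" "(1 / (real m + 1)) ^ depth (3 * k) N \<le> 1"
    by (auto intro!: power_le_one)
  then show ?thesis
    unfolding potential_def using decay_le_1[of k N] decay_pos[of k N]
    by (intro mult_le_one) auto
qed

text \<open>Charging a hyperedge to the target cut is guessed with probability
  \<open>m / (m + 1)\<close>; the first factor of the potential pays for it.\<close>

lemma potential_delete:
  assumes "u' < u"
  shows "potential k m u N \<le> real m / (real m + 1) * potential k m u' N"
proof -
  have "(real m / (real m + 1)) ^ u \<le> (real m / (real m + 1)) ^ Suc u'"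
    using assms by (intro power_decreasing) auto
  then have "(real m / (real m + 1)) ^ u * ((1 / (real m + 1)) ^ depth (3 * k) N * decay k N)
      \<le> (real m / (real m + 1)) ^ Suc u' * ((1 / (real m + 1)) ^ depth (3 * k) N * decay k N)"
    using decay_pos[of k N] by (intro mult_right_mono) auto
  then show ?thesis by (simp add: potential_def mult_ac)
qed

text \<open>Contracting a large hyperedge is guessed only with probability
  \<open>1 / (m + 1)\<close>. A drop of \<open>depth\<close> pays for it, since
  \<open>N - x <= (1 - 1 / (3 k)) N\<close>.\<close>

lemma potential_contract_large:
  assumes "u' \<le> u" "1 \<le> k" "N \<le> 3 * k * x" "1 \<le> x" "x < N"
  shows "potential k m u N \<le> 1 / (real m + 1) * potential k m u' (N - x)"
proof -
  have "3 * k * (N - x) \<le> (3 * k - 1) * N"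
    using assms by (simp add: diff_mult_distrib diff_mult_distrib2)
  then have "Suc (depth (3 * k) (N - x)) \<le> depth (3 * k) N"
    using assms by (intro depth_shrink) auto
  then have 1: "(1 / (real m + 1)) ^ depth (3 * k) N \<le> (1 / (real m + 1)) ^ Suc (depth (3 * k) (N - x))"
    by (intro power_decreasing) auto
  have 2: "(real m / (real m + 1)) ^ u \<le> (real m / (real m + 1)) ^ u'"
    using assms by (intro power_decreasing) auto
  have 3: "decay k N \<le> decay k (N - x)" by (intro decay_antimono) simp
  have "potential k m u N \<le> (real m / (real m + 1)) ^ u' * (1 / (real m + 1)) ^ Suc (depth (3 * k) (N - x)) * decay k (N - x)"
    unfolding potential_def using 1 2 3 decay_pos[of k N] by (intro mult_mono) auto
  then show ?thesis by (simp add: potential_def mult_ac)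
qed

lemma potential_contract:
  assumes "u' \<le> u"
  shows "(real m / (real m + 1)) ^ u * (1 / (real m + 1)) ^ depth (3 * k) N * decay k (N - x)
    \<le> potential k m u' (N - x)"
  unfolding potential_def using assms decay_pos[of k "N - x"]
  by (intro mult_mono power_decreasing depth_mono) auto

text \<open>Only \<open>decay\<close> has to grow on average; contraction does not make the other
  two factors worse, so \<open>weighted_contraction\<close> carries over.\<close>

lemma potential_weighted:
  fixes s w u' :: "nat \<Rightarrow> nat"
  assumes "finite R" "1 \<le> k" "\<And>e. e \<in> R \<Longrightarrow> 2 \<le> s e \<and> 3 * k * (s e - 1) < N" "F \<subseteq> R"
    and "(N + 1) * (sum w F + 1) \<le> k * (\<Sum>e \<in> R. w e * s e)"
    and "\<And>e. e \<in> R - F \<Longrightarrow> u' e \<le> u"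
  shows "real (sum w R) * potential k m u N \<le> (\<Sum>e \<in> R - F. real (w e) * potential k m (u' e) (N - (s e - 1)))"
proof -
  let ?g = "(real m / (real m + 1)) ^ u * (1 / (real m + 1)) ^ depth (3 * k) N"
  have "real (sum w R) * potential k m u N = ?g * (real (sum w R) * decay k N)"
    by (simp add: potential_def)
  also have "\<dots> \<le> ?g * (\<Sum>e \<in> R - F. real (w e) * decay k (N - (s e - 1)))"
    using weighted_contraction[OF assms(1-5)] by (intro mult_left_mono) auto
  also have "\<dots> = (\<Sum>e \<in> R - F. real (w e) * (?g * decay k (N - (s e - 1))))"
    by (simp add: sum_distrib_left mult_ac)
  also have "\<dots> \<le> (\<Sum>e \<in> R - F. real (w e) * potential k m (u' e) (N - (s e - 1)))"
    using assms(6) by (intro sum_mono mult_left_mono potential_contract) auto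
  finally show ?thesis .
qed

section \<open>The program\<close>

text \<open>The contracted hypergraph is represented by labels: \<open>lab v\<close> is a fixed vertex of the block of
  \<open>v\<close>, so the blocks are the fixed points of \<open>lab\<close>. The array \<open>w\<close> holds the incidence matrix between
  hyperedges and blocks, \<open>row e = e * n\<close> and \<open>crow i = i * m\<close> replace the missing multiplication,
  and \<open>del e\<close> is nonzero if \<open>e\<close> has been guessed to lie in the target cut. A selected hyperedge
  \<open>sel = m\<close> means that nothing is to be contracted.\<close>

abbreviation If_then :: "bexp \<Rightarrow> com \<Rightarrow> com" where
  "If_then e p \<equiv> Cond e p Skip"

abbreviation assign :: "string \<Rightarrow> aexp \<Rightarrow> com" where
  "assign x a \<equiv> Store x (Const 0) a"

abbreviation at_most :: "aexp \<Rightarrow> aexp \<Rightarrow> bexp" where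
  "at_most a a' \<equiv> Neg (Less a' a)"

primrec scale :: "nat \<Rightarrow> aexp \<Rightarrow> aexp" where
  "scale 0 a = Const 0"
| "scale (Suc j) a = Plus a (scale j a)"

lemma aval_scale [simp]: "aval (scale j a) s = j * aval a s"
  by (induction j) auto

definition is_block :: bexp where
  "is_block = Conj (at_most (Cell ''lab'' (V ''v'')) (V ''v'')) (at_most (V ''v'') (Cell ''lab'' (V ''v'')))"

definition in_star :: bexp where
  "in_star = Conj (Less (Const 0) (Cell ''w'' (Plus (Cell ''row'' (V ''e'')) (V ''v''))))
     (Less (Const 1) (Cell ''sz'' (V ''e'')))"

definition undecided :: bexp where
  "undecided = Conj (Less (Cell ''del'' (V ''e'')) (Const 1)) (Less (Const 1) (Cell ''sz'' (V ''e'')))"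

text \<open>Row \<open>e\<close> has a column for every vertex, but only representatives get marked.
  The test for an unmarked column makes \<open>sz\<close> count each block once.\<close>

definition trace_row :: com where
  "trace_row = Seq (Store ''sz'' (V ''e'') (Const 0))
    (Seq (For ''v'' (V ''n'') (Store ''w'' (Plus (Cell ''row'' (V ''e'')) (V ''v'')) (Const 0)))
         (For ''v'' (V ''n'') (If_then (Conj (Less (Const 0) (Cell ''inc'' (Plus (Cell ''row'' (V ''e'')) (V ''v''))))
             (Less (Cell ''w'' (Plus (Cell ''row'' (V ''e'')) (Cell ''lab'' (V ''v'')))) (Const 1)))
           (Seq (Store ''w'' (Plus (Cell ''row'' (V ''e'')) (Cell ''lab'' (V ''v''))) (Const 1))
                (Store ''sz'' (V ''e'') (Plus (Cell ''sz'' (V ''e'')) (Const 1)))))))"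

definition traces :: com where
  "traces = For ''e'' (V ''m'') trace_row"

definition count_blocks :: com where
  "count_blocks = Seq (assign ''nn'' (Const 0))
     (For ''v'' (V ''n'') (If_then is_block (assign ''nn'' (Plus (V ''nn'') (Const 1)))))"

definition star_cost :: com where
  "star_cost = Seq (assign ''y'' (Const 0))
     (For ''e'' (V ''m'') (If_then in_star
        (assign ''y'' (Plus (V ''y'') (Cell ''cost'' (Plus (Cell ''crow'' (V ''i'')) (V ''e'')))))))"

text \<open>\<open>bad\<close> concerns the current block alone, while \<open>cnt\<close>
  accumulates over all blocks and is therefore cleared in \<open>test_stars\<close>.\<close>

definition test_star :: "nat \<Rightarrow> com" where
  "test_star k = Seq (assign ''bad'' (Const 0))
     (For ''i'' (Const k) (Seq star_cost
        (If_then (Less (Cell ''budget'' (V ''i'')) (V ''y''))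
          (Seq (assign ''bad'' (Const 1)) (Store ''cnt'' (V ''i'') (Plus (Cell ''cnt'' (V ''i'')) (Const 1)))))))"

definition return_star :: com where
  "return_star = Seq (assign ''found'' (Const 1))
     (For ''e'' (V ''m'') (Cond in_star (Store ''out'' (V ''e'') (Const 1)) (Store ''out'' (V ''e'') (Const 0))))"

text \<open>There is no early exit: a further feasible star overwrites \<open>out\<close>, and a
  violating one leaves it alone.\<close>

definition test_stars :: "nat \<Rightarrow> com" where
  "test_stars k = Seq (For ''i'' (Const k) (Store ''cnt'' (V ''i'') (Const 0)))
     (For ''v'' (V ''n'') (If_then is_block (Seq (test_star k) (If_then (Less (V ''bad'') (Const 1)) return_star))))"

text \<open>The value \<open>m\<close> of \<open>big\<close> stands for no large hyperedge. With
  \<open>N = nn - 1\<close> the test is \<open>sz >= N / (3 k) + 1\<close>, cleared of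
  denominators.\<close>

definition find_large :: "nat \<Rightarrow> com" where
  "find_large k = Seq (assign ''big'' (V ''m''))
     (For ''e'' (V ''m'') (If_then (Conj undecided
          (at_most (Minus (V ''nn'') (Const 1)) (scale (3 * k) (Minus (Cell ''sz'' (V ''e'')) (Const 1)))))
        (assign ''big'' (V ''e''))))"

definition find_objective :: "nat \<Rightarrow> com" where
  "find_objective k = Seq (assign ''h'' (Const 0))
     (For ''i'' (Const k) (If_then (at_most (V ''nn'') (scale k (Cell ''cnt'' (V ''i'')))) (assign ''h'' (V ''i''))))"

definition add_cost :: com where
  "add_cost = assign ''y'' (Plus (V ''y'') (Cell ''cost'' (Plus (Cell ''crow'' (V ''h'')) (V ''e''))))"

definition total_cost :: com where
  "total_cost = Seq (assign ''y'' (Const 0)) (For ''e'' (V ''m'') (If_then undecided add_cost))"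

text \<open>Inverse transform sampling: \<open>y\<close> runs through the prefix sums of the costs,
  and the last undecided hyperedge whose prefix sum does not exceed the draw \<open>z\<close>
  remains selected.\<close>

definition locate :: com where
  "locate = Seq (assign ''y'' (Const 0)) (For ''e'' (V ''m'') (If_then undecided
     (Seq (If_then (at_most (V ''y'') (V ''z'')) (assign ''sel'' (V ''e''))) add_cost)))"

definition guess :: com where
  "guess = Seq (Rand ''z'' (Const 0) (V ''m''))
     (Cond (Less (V ''z'') (Const 1)) (assign ''sel'' (V ''big'')) (Store ''del'' (V ''big'') (Const 1)))"

text \<open>\<open>Rand\<close> includes its upper end, hence the subtraction of 1: \<open>z\<close>
  is uniform below the total cost whenever that is positive.\<close>

definition sample :: "nat \<Rightarrow> com" where
  "sample k = Seq (find_objective k) (Seq total_cost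
     (Seq (Rand ''z'' (Const 0) (Minus (V ''y'') (Const 1))) locate))"

definition pick :: "nat \<Rightarrow> com" where
  "pick k = Seq (find_large k) (Seq (assign ''sel'' (V ''m'')) (Cond (Less (V ''big'') (V ''m'')) guess (sample k)))"

text \<open>The relabelling loop reads \<open>lab\<close> only at the vertex it is about to
  overwrite, so it sees the old labels throughout, and \<open>w\<close> was computed for
  these.\<close>

definition contract :: com where
  "contract = If_then (Conj (Less (V ''sel'') (V ''m'')) (Less (Const 1) (Cell ''sz'' (V ''sel''))))
     (Seq (assign ''h'' (Const 0))
     (Seq (For ''v'' (V ''n'') (If_then (Less (Const 0) (Cell ''w'' (Plus (Cell ''row'' (V ''sel'')) (V ''v''))))
            (assign ''h'' (V ''v''))))
          (For ''v'' (V ''n'') (If_then (Less (Const 0) (Cell ''w'' (Plus (Cell ''row'' (V ''sel'')) (Cell ''lab'' (V ''v'')))))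
            (Store ''lab'' (V ''v'') (V ''h''))))))"

definition step :: "nat \<Rightarrow> com" where
  "step k = If_then (Less (V ''found'') (Const 1)) (Seq traces (Seq count_blocks
     (If_then (Less (Const 1) (V ''nn'')) (Seq (test_stars k)
        (If_then (Less (V ''found'') (Const 1)) (Seq (pick k) contract))))))"

definition reset :: com where
  "reset = Seq (For ''v'' (V ''n'') (Store ''lab'' (V ''v'') (V ''v'')))
     (For ''e'' (V ''m'') (Store ''del'' (V ''e'') (Const 0)))"

text \<open>In a run without mistakes every step that finds no star settles an undecided hyperedge,
  so none is left after \<open>m\<close> such steps; one more step tests the stars of what
  remains.\<close>

definition trial :: "nat \<Rightarrow> com" where
  "trial k = Seq reset (For ''t'' (Plus (V ''m'') (Const 1)) (step k))"

lemmas step_defs = trace_row_def traces_def count_blocks_def star_cost_def test_star_def return_star_def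
  test_stars_def find_large_def find_objective_def add_cost_def total_cost_def locate_def guess_def
  sample_def pick_def contract_def step_def

definition work :: "string set" where
  "work = {''w'', ''sz'', ''nn'', ''y'', ''bad'', ''cnt'', ''found'', ''out'', ''big'', ''h'', ''z'', ''sel'', ''del'',
     ''lab'', ''e'', ''v'', ''i'', ''t''}"

lemma writes_step: "writes (step k) \<subseteq> work - {''t''}"
  by (simp add: step_defs work_def)

lemma writes_trial: "writes (trial k) \<subseteq> work"
  by (simp add: trial_def reset_def step_defs work_def)

lemmas cost_bounded_intros = cost_bounded_Skip cost_bounded_Store cost_bounded_Rand cost_bounded_Seq
  cost_bounded_Cond cost_bounded_For_n cost_bounded_For_m cost_bounded_For_Suc_m cost_bounded_For_Const

lemma cost_bounded_step: "cost_bounded (step k) 1 1"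
  \<comment> \<open>In \<open>Suc\<close> form the exponents unify with those in the loop
    rules.\<close>
  unfolding One_nat_def step_defs
  by (intro cost_bounded_intros) (simp_all)

section \<open>Specification of the parts of a trial\<close>

lemma update_apply: "update s x i a y = (if y = x then (s x)(i := a) else s y)"
  by (simp add: update_def)

lemma post_SeqI:
  assumes "post p s P" "\<And>s'. agree (writes p) s s' \<Longrightarrow> P s' \<Longrightarrow> post q s' Q"
  shows "post (Seq p q) s Q"
  unfolding post_Seq using assms by (rule post_weaken)

lemma index_eq_iff:
  assumes "v < n" "v' < (n :: nat)"
  shows "e * n + v = e' * n + v' \<longleftrightarrow> e = e' \<and> v = v'"
proof
  assume *: "e * n + v = e' * n + v'"
  have "(e * n + v) div n = e" "(e' * n + v') div n = e'" using assms by auto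
  then show "e = e' \<and> v = v'" using * by auto
qed simp

lemma insert_less_Suc: "{v \<in> A. v < Suc j} = (if j \<in> A then insert j {v \<in> A. v < j} else {v \<in> A. v < j})"
  by (auto simp: less_Suc_eq)

section \<open>Memory invariants and the incidence matrix of the contracted hypergraph\<close>

context costed_hypergraph
begin

text \<open>The input and the offset tables: memory on which trials rely and which they never
  write.\<close>

definition env :: "state \<Rightarrow> bool" where
  "env s \<longleftrightarrow> s ''n'' 0 = n \<and> s ''m'' 0 = m \<and> (\<forall>e<m. s ''row'' e = e * n) \<and> (\<forall>i<k. s ''crow'' i = i * m) \<and>
     (\<forall>e<m. \<forall>v<n. 0 < s ''inc'' (e * n + v) \<longleftrightarrow> v \<in> E e) \<and>
     (\<forall>i<k. \<forall>e<m. s ''cost'' (i * m + e) = c i e) \<and> (\<forall>i<k. s ''budget'' i = b i)"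

lemma env_agree:
  assumes "env s" "agree W s s'" "{''n'', ''m'', ''row'', ''crow'', ''inc'', ''cost'', ''budget''} \<inter> W = {}"
  shows "env s'"
proof -
  have "s' x = s x" if "x \<in> {''n'', ''m'', ''row'', ''crow'', ''inc'', ''cost'', ''budget''}" for x
    using assms(2,3) that by (intro agreeD[OF assms(2)]) blast
  then show ?thesis using assms(1) unfolding env_def by simp
qed

definition recorded :: "state \<Rightarrow> nat \<Rightarrow> bool" where
  "recorded s e \<longleftrightarrow> (\<forall>v<n. s ''w'' (e * n + v) = (if v \<in> trace (s ''lab'') e then 1 else 0)) \<and>
     s ''sz'' e = card (trace (s ''lab'') e)"

lemma post_trace_row:
  assumes env: "env s" and l: "labelling (s ''lab'')" and e: "s ''e'' 0 = e" "e < m"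
    and old: "\<And>f. f < e \<Longrightarrow> recorded s f"
  shows "post trace_row s (\<lambda>s'. \<forall>f < Suc e. recorded s' f)"
proof -
  let ?l = "s ''lab''" and ?s = "update s ''sz'' e 0"
  have ln: "?l v < n" if "v < n" for v using l that by (simp add: labelling_def)
  have En: "v < n" if "v \<in> E e" for v using E[OF e(2)] that by auto
  let ?old = "\<lambda>s'. \<forall>f<e. \<forall>v<n. s' ''w'' (f * n + v) = s ''w'' (f * n + v)"
  let ?o = "Store ''w'' (Plus (Cell ''row'' (V ''e'')) (V ''v'')) (Const 0)"
  let ?p = "If_then (Conj (Less (Const 0) (Cell ''inc'' (Plus (Cell ''row'' (V ''e'')) (V ''v''))))
             (Less (Cell ''w'' (Plus (Cell ''row'' (V ''e'')) (Cell ''lab'' (V ''v'')))) (Const 1)))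
           (Seq (Store ''w'' (Plus (Cell ''row'' (V ''e'')) (Cell ''lab'' (V ''v''))) (Const 1))
                (Store ''sz'' (V ''e'') (Plus (Cell ''sz'' (V ''e'')) (Const 1))))"
  have "post (Seq (For ''v'' (V ''n'') ?o) (For ''v'' (V ''n'') ?p)) ?s (\<lambda>s'. \<forall>f < Suc e. recorded s' f)"
  proof (rule post_SeqI[where P = "\<lambda>s'. (\<forall>v<n. s' ''w'' (e * n + v) = 0) \<and> ?old s'"])
    show "post (For ''v'' (V ''n'') ?o) ?s (\<lambda>s'. (\<forall>v<n. s' ''w'' (e * n + v) = 0) \<and> ?old s')"
    proof (rule post_For[where I = "\<lambda>j s'. (\<forall>v<j. s' ''w'' (e * n + v) = 0) \<and> ?old s'" and B = n])
      fix s' assume *: "agree (insert ''v'' (writes ?o)) ?s s'"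
      have e': "s' ''n'' = s ''n''" "s' ''row'' = s ''row''" "s' ''e'' = s ''e''"
        by (auto intro!: agreeD[OF *, THEN trans] simp: update_apply)
      show "aval (V ''n'') s' = n" using env e' by (simp add: env_def)
      fix j assume "j < n" "s' ''v'' 0 = j" "(\<forall>v<j. s' ''w'' (e * n + v) = 0) \<and> ?old s'"
      then show "post ?o s' (\<lambda>s''. (\<forall>v<Suc j. update s'' ''v'' 0 (Suc j) ''w'' (e * n + v) = 0) \<and>
          ?old (update s'' ''v'' 0 (Suc j)))"
        using e' env e index_eq_iff[of _ n j _ e] by (auto simp: update_apply env_def less_Suc_eq)
    qed (simp_all add: update_apply)
  next
    fix s1 assume a1: "agree (writes (For ''v'' (V ''n'') ?o)) ?s s1"
      and 1: "(\<forall>v<n. s1 ''w'' (e * n + v) = 0) \<and> ?old s1"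
    have s1: "s1 ''lab'' = ?l" "s1 ''e'' = s ''e''" "s1 ''sz'' = (s ''sz'')(e := 0)"
      by (auto intro!: agreeD[OF a1, THEN trans] simp: update_apply)
    have "env ?s" by (rule env_agree[OF env, of "{''sz''}"]) (simp_all add: agree_update)
    then have env1: "env s1" by (rule env_agree[OF _ a1]) simp
    \<comment> \<open>The part of the trace contributed by the vertices below
      \<open>j\<close>.\<close>
    let ?T = "\<lambda>j. ?l ` {u \<in> E e. u < j}"
    let ?I = "\<lambda>j s'. (\<forall>v<n. s' ''w'' (e * n + v) = (if v \<in> ?T j then 1 else 0)) \<and> ?old s' \<and>
      s' ''sz'' = (s ''sz'')(e := card (?T j))"
    show "post (For ''v'' (V ''n'') ?p) s1 (\<lambda>s'. \<forall>f < Suc e. recorded s' f)"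
    proof (rule post_For[where I = ?I and B = n])
      fix s' assume *: "agree (insert ''v'' (writes ?p)) s1 s'"
      have e': "s' ''n'' = s1 ''n''" "s' ''row'' = s1 ''row''" "s' ''e'' = s1 ''e''" "s' ''inc'' = s1 ''inc''" "s' ''lab'' = s1 ''lab''"
        by (auto intro!: agreeD[OF *])
      show "aval (V ''n'') s' = n" using env1 e' by (simp add: env_def)
      have "?T n = trace ?l e" using En by (auto simp: trace_def)
      then show "?I n s' \<Longrightarrow> \<forall>f < Suc e. recorded s' f"
        using e' s1 old by (simp add: recorded_def less_Suc_eq)
      fix j assume j: "j < n" "s' ''v'' 0 = j" and I: "?I j s'"
      have T: "?T (Suc j) = (if j \<in> E e then insert (?l j) (?T j) else ?T j)" by (simp add: insert_less_Suc)
      have "finite (?T j)" by simp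
      moreover have "s' ''row'' (s' ''e'' 0) = e * n" "0 < s' ''inc'' (e * n + j) \<longleftrightarrow> j \<in> E e" "s' ''lab'' j = ?l j" "s' ''e'' 0 = e"
        using e' env1 s1 e j by (simp_all add: env_def)
      moreover have "s' ''w'' (e * n + ?l j) < 1 \<longleftrightarrow> ?l j \<notin> ?T j" using I ln[OF j(1)] by auto
      ultimately show "post ?p s' (\<lambda>s''. ?I (Suc j) (update s'' ''v'' 0 (Suc j)))"
        using j I ln[OF j(1)] index_eq_iff[of _ n "?l j" _ e] unfolding T
        by (auto simp: update_apply insert_absorb)
    qed (use 1 s1 in \<open>simp_all add: update_apply\<close>)
  qed
  then show ?thesis using e by (simp add: trace_row_def)
qed

text \<open>Describes the memory between \<open>traces\<close> and the relabelling in
  \<open>contract\<close>, which makes \<open>w\<close> and \<open>sz\<close> stale; hence they are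
  recomputed at the start of every active step.\<close>

definition ready :: "state \<Rightarrow> bool" where
  "ready s \<longleftrightarrow> env s \<and> labelling (s ''lab'') \<and> (\<forall>e<m. recorded s e)"

lemma ready_agree:
  assumes "ready s" "agree W s s'"
    "{''n'', ''m'', ''row'', ''crow'', ''inc'', ''cost'', ''budget'', ''w'', ''sz'', ''lab''} \<inter> W = {}"
  shows "ready s'"
proof -
  have "env s'" using assms by (intro env_agree[OF _ assms(2)]) (auto simp: ready_def)
  moreover have "s' x = s x" if "x \<in> {''w'', ''sz'', ''lab''}" for x
    using assms(3) that by (intro agreeD[OF assms(2)]) blast
  ultimately show ?thesis using assms(1) unfolding ready_def recorded_def by simp
qed

lemma post_traces:
  assumes env: "env s" and l: "labelling (s ''lab'')"
  shows "post traces s ready"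
  unfolding traces_def
proof (rule post_For[where I = "\<lambda>j s'. \<forall>f<j. recorded s' f" and B = m])
  show "''e'' \<notin> writes trace_row" by (simp add: trace_row_def)
  fix s' assume *: "agree (insert ''e'' (writes trace_row)) s s'"
  have env': "env s'" by (rule env_agree[OF env *]) (simp add: trace_row_def)
  have lab: "s' ''lab'' = s ''lab''" by (rule agreeD[OF *]) (simp add: trace_row_def)
  show "aval (V ''m'') s' = m" using env' by (simp add: env_def)
  show "\<forall>f<m. recorded s' f \<Longrightarrow> ready s'" using env' lab l by (simp add: ready_def)
  fix j assume "j < m" "s' ''e'' 0 = j" "\<forall>f<j. recorded s' f"
  then have "post trace_row s' (\<lambda>s''. \<forall>f<Suc j. recorded s'' f)"
    using env' lab l by (intro post_trace_row) auto
  then show "post trace_row s' (\<lambda>s''. (\<forall>f<Suc j. recorded (update s'' ''e'' 0 (Suc j)) f))"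
    by (rule post_weaken) (simp add: recorded_def update_apply)
qed simp

section \<open>Counting blocks and testing stars\<close>

lemma bval_is_block [simp]: "bval is_block s \<longleftrightarrow> s ''lab'' (s ''v'' 0) = s ''v'' 0"
  by (auto simp: is_block_def)

lemma bval_in_star:
  assumes "ready s" "s ''e'' 0 < m" "s ''v'' 0 < n"
  shows "bval in_star s \<longleftrightarrow> s ''e'' 0 \<in> star (s ''lab'') (s ''v'' 0)"
  using assms by (auto simp: in_star_def ready_def env_def recorded_def star_def crossing_def)

lemma post_count_blocks:
  assumes "env s"
  shows "post count_blocks s (\<lambda>s'. s' ''nn'' 0 = card (blocks (s ''lab'')))"
proof -
  let ?p = "If_then is_block (assign ''nn'' (Plus (V ''nn'') (Const 1)))"
  let ?s = "update s ''nn'' 0 0"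
  have "post (For ''v'' (V ''n'') ?p) ?s (\<lambda>s'. s' ''nn'' 0 = card (blocks (s ''lab'')))"
  proof (rule post_For[where I = "\<lambda>j s'. s' ''nn'' 0 = card {v \<in> blocks (s ''lab''). v < j}" and B = n])
    fix s' assume *: "agree (insert ''v'' (writes ?p)) ?s s'"
    have 1: "s' ''n'' = s ''n''" "s' ''lab'' = s ''lab''"
      using agreeD[OF *, of "''n''"] agreeD[OF *, of "''lab''"] by (simp_all add: update_apply)
    show "aval (V ''n'') s' = n" using 1 assms by (simp add: env_def)
    have "{v \<in> blocks (s ''lab''). v < n} = blocks (s ''lab'')" by (auto simp: blocks_def)
    then show "s' ''nn'' 0 = card {v \<in> blocks (s ''lab''). v < n} \<Longrightarrow> s' ''nn'' 0 = card (blocks (s ''lab''))" by simp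
    fix j assume "j < n" "s' ''v'' 0 = j" "s' ''nn'' 0 = card {v \<in> blocks (s ''lab''). v < j}"
    then show "post ?p s' (\<lambda>s''. update s'' ''v'' 0 (Suc j) ''nn'' 0 = card {v \<in> blocks (s ''lab''). v < Suc j})"
      using 1 by (auto simp: insert_less_Suc update_apply) (auto simp: blocks_def)
  qed (simp_all add: update_apply)
  then show ?thesis by (simp add: count_blocks_def)
qed

lemma post_star_cost:
  assumes "ready s" "s ''v'' 0 < n" "s ''i'' 0 < k"
  shows "post star_cost s (\<lambda>s'. s' ''y'' 0 = sum (c (s ''i'' 0)) (star (s ''lab'') (s ''v'' 0)))"
proof -
  let ?p = "If_then in_star (assign ''y'' (Plus (V ''y'') (Cell ''cost'' (Plus (Cell ''crow'' (V ''i'')) (V ''e'')))))"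
  let ?s = "update s ''y'' 0 0" and ?S = "star (s ''lab'') (s ''v'' 0)" and ?c = "c (s ''i'' 0)"
  have "post (For ''e'' (V ''m'') ?p) ?s (\<lambda>s'. s' ''y'' 0 = sum ?c ?S)"
  proof (rule post_For[where I = "\<lambda>j s'. s' ''y'' 0 = sum ?c {e \<in> ?S. e < j}" and B = m])
    fix s' assume *: "agree (insert ''e'' (writes ?p)) ?s s'"
    have r: "ready s'"
      by (rule ready_agree[where s = ?s, OF ready_agree[where s = s and W = "{''y''}", OF assms(1)] *]) (simp_all add: agree_update)
    have 1: "s' ''v'' = s ''v''" "s' ''lab'' = s ''lab''" "s' ''i'' = s ''i''"
      using agreeD[OF *, of "''v''"] agreeD[OF *, of "''lab''"] agreeD[OF *, of "''i''"] by (simp_all add: update_apply)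
    show "aval (V ''m'') s' = m" using r by (simp add: ready_def env_def)
    have "{e \<in> ?S. e < m} = ?S" by (auto simp: star_def crossing_def)
    then show "s' ''y'' 0 = sum ?c {e \<in> ?S. e < m} \<Longrightarrow> s' ''y'' 0 = sum ?c ?S" by simp
    fix j assume j: "j < m" "s' ''e'' 0 = j" and y: "s' ''y'' 0 = sum ?c {e \<in> ?S. e < j}"
    have "bval in_star s' \<longleftrightarrow> j \<in> ?S" using bval_in_star[OF r] j 1 assms by simp
    moreover have "s' ''crow'' (s' ''i'' 0) = s ''i'' 0 * m" "s' ''cost'' (s ''i'' 0 * m + j) = ?c j"
      using r j assms(3) 1 by (simp_all add: ready_def env_def)
    ultimately show "post ?p s' (\<lambda>s''. update s'' ''e'' 0 (Suc j) ''y'' 0 = sum ?c {e \<in> ?S. e < Suc j})"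
      using y j by (auto simp: insert_less_Suc update_apply)
  qed (simp_all add: update_apply)
  then show ?thesis by (simp add: star_cost_def)
qed

lemma post_test_star:
  assumes "ready s" "s ''v'' 0 = v" "v \<in> blocks (s ''lab'')"
  shows "post (test_star k) s (\<lambda>s'. (s' ''bad'' 0 = 0 \<longleftrightarrow> (\<forall>i<k. v \<notin> violators (s ''lab'') i)) \<and>
    (\<forall>i<k. s' ''cnt'' i = s ''cnt'' i + of_bool (v \<in> violators (s ''lab'') i)))"
proof -
  let ?q = "If_then (Less (Cell ''budget'' (V ''i'')) (V ''y''))
          (Seq (assign ''bad'' (Const 1)) (Store ''cnt'' (V ''i'') (Plus (Cell ''cnt'' (V ''i'')) (Const 1))))"
  let ?p = "Seq star_cost ?q"
  let ?s = "update s ''bad'' 0 0" and ?V = "violators (s ''lab'')"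
  let ?I = "\<lambda>j s'. (s' ''bad'' 0 = 0 \<longleftrightarrow> (\<forall>i<j. v \<notin> ?V i)) \<and>
    (\<forall>i<k. s' ''cnt'' i = s ''cnt'' i + of_bool (i < j \<and> v \<in> ?V i))"
  have "post (For ''i'' (Const k) ?p) ?s (\<lambda>s'. (s' ''bad'' 0 = 0 \<longleftrightarrow> (\<forall>i<k. v \<notin> ?V i)) \<and>
    (\<forall>i<k. s' ''cnt'' i = s ''cnt'' i + of_bool (v \<in> ?V i)))"
  proof (rule post_For[where I = ?I and B = k])
    fix s' assume *: "agree (insert ''i'' (writes ?p)) ?s s'"
    have r: "ready s'"
      by (rule ready_agree[where s = ?s, OF ready_agree[where s = s and W = "{''bad''}", OF assms(1)] *])
        (simp_all add: agree_update star_cost_def)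
    have 1: "s' ''v'' = s ''v''" "s' ''lab'' = s ''lab''"
      using agreeD[OF *, of "''v''"] agreeD[OF *, of "''lab''"] by (simp_all add: update_apply star_cost_def)
    have vn: "v < n" using assms(3) by (simp add: blocks_def)
    fix j assume j: "j < k" "s' ''i'' 0 = j" and I: "?I j s'"
    show "post ?p s' (\<lambda>s''. ?I (Suc j) (update s'' ''i'' 0 (Suc j)))"
    proof (rule post_SeqI[OF post_star_cost[OF r]])
      fix s1 assume a: "agree (writes star_cost) s' s1"
        and y: "s1 ''y'' 0 = sum (c (s' ''i'' 0)) (star (s' ''lab'') (s' ''v'' 0))"
      have 2: "s1 ''bad'' = s' ''bad''" "s1 ''cnt'' = s' ''cnt''" "s1 ''budget'' = s' ''budget''" "s1 ''i'' = s' ''i''"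
        by (auto intro!: agreeD[OF a] simp: star_cost_def)
      have "s' ''budget'' j < s1 ''y'' 0 \<longleftrightarrow> v \<in> ?V j"
        using y j 1 r assms(2,3) by (simp add: violators_def ready_def env_def)
      then show "post ?q s1 (\<lambda>s''. ?I (Suc j) (update s'' ''i'' 0 (Suc j)))"
        using 2 I j by (auto simp: update_apply less_Suc_eq)
    qed (use 1 assms(2) vn j in simp_all)
  qed (simp_all add: update_apply star_cost_def)
  then show ?thesis by (simp add: test_star_def)
qed

lemma post_return_star:
  assumes "ready s" "s ''v'' 0 = v" "v < n"
  shows "post return_star s (\<lambda>s'. s' ''found'' 0 = 1 \<and> {e. e < m \<and> s' ''out'' e \<noteq> 0} = star (s ''lab'') v)"
proof -
  let ?p = "Cond in_star (Store ''out'' (V ''e'') (Const 1)) (Store ''out'' (V ''e'') (Const 0))"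
  let ?s = "update s ''found'' 0 1" and ?S = "star (s ''lab'') v"
  let ?I = "\<lambda>j s'. s' ''found'' 0 = 1 \<and> (\<forall>e<j. s' ''out'' e \<noteq> 0 \<longleftrightarrow> e \<in> ?S)"
  have "post (For ''e'' (V ''m'') ?p) ?s (\<lambda>s'. s' ''found'' 0 = 1 \<and> {e. e < m \<and> s' ''out'' e \<noteq> 0} = ?S)"
  proof (rule post_For[where I = ?I and B = m])
    fix s' assume *: "agree (insert ''e'' (writes ?p)) ?s s'"
    have r: "ready s'"
      by (rule ready_agree[where s = ?s, OF ready_agree[where s = s and W = "{''found''}", OF assms(1)] *])
        (simp_all add: agree_update)
    have 1: "s' ''v'' = s ''v''" "s' ''lab'' = s ''lab''"
      using agreeD[OF *, of "''v''"] agreeD[OF *, of "''lab''"] by (simp_all add: update_apply)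
    show "aval (V ''m'') s' = m" using r by (simp add: ready_def env_def)
    have "?S \<subseteq> {e. e < m}" by (auto simp: star_def crossing_def)
    then show "?I m s' \<Longrightarrow> s' ''found'' 0 = 1 \<and> {e. e < m \<and> s' ''out'' e \<noteq> 0} = ?S" by auto
    fix j assume j: "j < m" "s' ''e'' 0 = j" and I: "?I j s'"
    have "bval in_star s' \<longleftrightarrow> j \<in> ?S" using bval_in_star[OF r] j 1 assms by simp
    then show "post ?p s' (\<lambda>s''. ?I (Suc j) (update s'' ''e'' 0 (Suc j)))"
      using I j by (auto simp: update_apply less_Suc_eq)
  qed (simp_all add: update_apply)
  then show ?thesis by (simp add: return_star_def)
qed

definition all_violated :: "(nat \<Rightarrow> nat) \<Rightarrow> bool" where
  "all_violated l \<longleftrightarrow> (\<forall>v \<in> blocks l. \<exists>i<k. v \<in> violators l i)"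

definition star_found :: "(nat \<Rightarrow> nat) \<Rightarrow> state \<Rightarrow> bool" where
  "star_found l s \<longleftrightarrow> s ''found'' 0 = 1 \<and>
     (\<exists>v \<in> blocks l. (\<forall>i<k. v \<notin> violators l i) \<and> {e. e < m \<and> s ''out'' e \<noteq> 0} = star l v)"

lemma post_test_stars:
  assumes "ready s" "s ''found'' 0 = 0"
  shows "post (test_stars k) s (\<lambda>s'. star_found (s ''lab'') s' \<or> s' ''found'' 0 = 0 \<and>
    all_violated (s ''lab'') \<and> (\<forall>i<k. s' ''cnt'' i = card (violators (s ''lab'') i)))"
proof -
  let ?l = "s ''lab''"
  let ?r = "If_then (Less (V ''bad'') (Const 1)) return_star"
  let ?p = "If_then is_block (Seq (test_star k) ?r)"
  \<comment> \<open>The first alternative is stable: later rounds change \<open>out\<close> only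
    when they find another feasible star.\<close>
  let ?I = "\<lambda>j s'. (star_found ?l s' \<or> s' ''found'' 0 = 0 \<and> (\<forall>v \<in> blocks ?l. v < j \<longrightarrow> (\<exists>i<k. v \<in> violators ?l i))) \<and>
     (\<forall>i<k. s' ''cnt'' i = card {v \<in> violators ?l i. v < j})"
  let ?init = "Store ''cnt'' (V ''i'') (Const 0)"
  have fin: "finite (violators ?l i)" for i by (simp add: violators_def)
  show ?thesis
    unfolding test_stars_def
  proof (rule post_SeqI[where P = "\<lambda>s'. \<forall>i<k. s' ''cnt'' i = 0"])
    show "post (For ''i'' (Const k) ?init) s (\<lambda>s'. \<forall>i<k. s' ''cnt'' i = 0)"
      by (rule post_For[where I = "\<lambda>j s'. \<forall>i<j. s' ''cnt'' i = 0" and B = k]) (auto simp: update_apply less_Suc_eq)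
  next
    fix s1 assume a: "agree (writes (For ''i'' (Const k) ?init)) s s1" and 1: "\<forall>i<k. s1 ''cnt'' i = 0"
    have r1: "ready s1" by (rule ready_agree[OF assms(1) a]) simp
    have s1: "s1 ''lab'' = ?l" "s1 ''found'' = s ''found''" by (auto intro!: agreeD[OF a])
    show "post (For ''v'' (V ''n'') ?p) s1 (\<lambda>s'. star_found ?l s' \<or> s' ''found'' 0 = 0 \<and> all_violated ?l \<and>
      (\<forall>i<k. s' ''cnt'' i = card (violators ?l i)))"
    proof (rule post_For[where I = ?I and B = n])
      show "''v'' \<notin> writes ?p" by (simp add: test_star_def star_cost_def return_star_def)
      show "?I 0 (update s1 ''v'' 0 0)" using 1 s1 assms(2) by (simp add: update_apply)
      fix s' assume *: "agree (insert ''v'' (writes ?p)) s1 s'"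
      have r: "ready s'" by (rule ready_agree[OF r1 *]) (simp add: test_star_def star_cost_def return_star_def)
      have lab: "s' ''lab'' = ?l"
        using agreeD[OF *, of "''lab''"] s1 by (simp add: test_star_def star_cost_def return_star_def)
      show "aval (V ''n'') s' = n" using r by (simp add: ready_def env_def)
      have "{v \<in> violators ?l i. v < n} = violators ?l i" for i by (auto simp: violators_def blocks_def)
      then show "?I n s' \<Longrightarrow> star_found ?l s' \<or> s' ''found'' 0 = 0 \<and> all_violated ?l \<and>
        (\<forall>i<k. s' ''cnt'' i = card (violators ?l i))"
        by (auto simp: all_violated_def blocks_def)
      fix j assume j: "j < n" "s' ''v'' 0 = j" and I: "?I j s'"
      let ?Q = "\<lambda>s''. ?I (Suc j) (update s'' ''v'' 0 (Suc j))"
      show "post ?p s' ?Q"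
      proof (cases "j \<in> blocks ?l")
        case False
        then have b: "v < j" if "v \<in> blocks ?l" "v < Suc j" for v using that by (auto simp: less_Suc_eq)
        then have eq: "{v \<in> violators ?l i. v < Suc j} = {v \<in> violators ?l i. v < j}" for i
          by (auto simp: violators_def)
        have "?I (Suc j) s'" using I b unfolding eq by blast
        moreover have "\<not> bval is_block s'" using False j lab by (simp add: blocks_def)
        ultimately show ?thesis by (simp add: update_apply star_found_def)
      next
        case True
        have "post (Seq (test_star k) ?r) s' ?Q"
        proof (rule post_SeqI[OF post_test_star[OF r j(2)]])
          show "j \<in> blocks (s' ''lab'')" using True lab by simp
          fix s2 assume a2: "agree (writes (test_star k)) s' s2"
            and 2: "(s2 ''bad'' 0 = 0 \<longleftrightarrow> (\<forall>i<k. j \<notin> violators (s' ''lab'') i)) \<and>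
              (\<forall>i<k. s2 ''cnt'' i = s' ''cnt'' i + of_bool (j \<in> violators (s' ''lab'') i))"
          have s2: "s2 ''found'' = s' ''found''" "s2 ''out'' = s' ''out''" "s2 ''lab'' = s' ''lab''" "s2 ''v'' = s' ''v''"
            by (auto intro!: agreeD[OF a2] simp: test_star_def star_cost_def)
          have r2: "ready s2" by (rule ready_agree[OF r a2]) (simp add: test_star_def star_cost_def)
          have cnt: "s2 ''cnt'' i = card {v \<in> violators ?l i. v < Suc j}" if "i < k" for i
            using 2 I that fin[of i] lab by (simp add: insert_less_Suc)
          show "post ?r s2 ?Q"
          proof (cases "s2 ''bad'' 0 = 0")
            case True
            have "post return_star s2 (\<lambda>s'. s' ''found'' 0 = 1 \<and> {e. e < m \<and> s' ''out'' e \<noteq> 0} = star (s2 ''lab'') j)"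
              using j s2 by (intro post_return_star[OF r2]) auto
            then have "post return_star s2 ?Q"
            proof (rule post_weaken)
              fix s3 assume a3: "agree (writes return_star) s2 s3"
                and 3: "s3 ''found'' 0 = 1 \<and> {e. e < m \<and> s3 ''out'' e \<noteq> 0} = star (s2 ''lab'') j"
              have "s3 ''cnt'' = s2 ''cnt''" by (rule agreeD[OF a3]) (simp add: return_star_def)
              moreover have "star_found ?l s3"
                using 3 2 True s2 lab \<open>j \<in> blocks ?l\<close> by (auto simp: star_found_def)
              ultimately show "?Q s3"
                using cnt by (simp add: update_apply star_found_def)
            qed
            then show ?thesis using True by simp
          next
            case False
            then obtain i where "i < k" "j \<in> violators ?l i" using 2 lab by auto
            then show ?thesis using False I s2 cnt by (auto simp: update_apply star_found_def less_Suc_eq)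
          qed
        qed
        then show ?thesis using True j lab by (simp add: blocks_def)
      qed
    qed
  qed
qed

end

section \<open>Selection of a hyperedge and its contraction\<close>

lemma sum_upto_Suc:
  fixes w :: "nat \<Rightarrow> 'a :: comm_monoid_add"
  assumes "finite R"
  shows "sum w {e \<in> R. e < Suc j} = (if j \<in> R then sum w {e \<in> R. e < j} + w j else sum w {e \<in> R. e < j})"
  using assms by (simp add: insert_less_Suc add.commute)

text \<open>The draws that lead to \<open>e\<close> form an interval of length \<open>w e\<close>,
  and these intervals tile the range below \<open>sum w R\<close>; so a uniform draw averages
  \<open>val\<close> with weights \<open>w\<close>.\<close>

lemma sum_located_le:
  fixes w :: "nat \<Rightarrow> nat" and f val :: "nat \<Rightarrow> ennreal"
  assumes R: "finite R"
    and le: "\<And>e r. e \<in> R \<Longrightarrow> sum w {f \<in> R. f < e} \<le> r \<Longrightarrow> r < sum w {f \<in> R. f < e} + w e \<Longrightarrow> val e \<le> f r"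
  shows "(\<Sum>e \<in> R. of_nat (w e) * val e) \<le> (\<Sum>r < sum w R. f r)"
proof -
  have "(\<Sum>e \<in> {e \<in> R. e < j}. of_nat (w e) * val e) \<le> (\<Sum>r < sum w {e \<in> R. e < j}. f r)" for j
  proof (induction j)
    case (Suc j)
    let ?p = "sum w {e \<in> R. e < j}"
    show ?case
    proof (cases "j \<in> R")
      case True
      have "of_nat (w j) * val j = (\<Sum>r \<in> {?p..<?p + w j}. val j)" by simp
      also have "\<dots> \<le> sum f {?p..<?p + w j}" using le[OF True] by (intro sum_mono) auto
      finally have "(\<Sum>e \<in> {e \<in> R. e < j}. of_nat (w e) * val e) + of_nat (w j) * val j
          \<le> (\<Sum>r < ?p. f r) + sum f {?p..<?p + w j}"
        using Suc by (intro add_mono)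
      also have "\<dots> = (\<Sum>r < ?p + w j. f r)"
        by (subst sum.union_disjoint[symmetric]) (auto intro!: sum.cong)
      finally show ?thesis using True R by (simp add: sum_upto_Suc)
    qed (use Suc R in \<open>simp add: sum_upto_Suc\<close>)
  qed simp
  moreover obtain j where "\<forall>e \<in> R. e < j" using R finite_nat_set_iff_bounded by blast
  then have "{e \<in> R. e < j} = R" by blast
  ultimately show ?thesis by metis
qed

text \<open>The intervals are disjoint, so whatever \<open>locate\<close> selects is the hyperedge
  whose interval contains the draw.\<close>

lemma location_unique:
  fixes w :: "nat \<Rightarrow> nat"
  assumes R: "finite R" "e \<in> R" "e' \<in> R"
    and r: "sum w {f \<in> R. f < e} \<le> r" "r < sum w {f \<in> R. f < e} + w e"
    and r': "sum w {f \<in> R. f < e'} \<le> r" "r < sum w {f \<in> R. f < e'} + w e'"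
  shows "e = e'"
proof -
  have *: "sum w {f \<in> R. f < x} + w x \<le> sum w {f \<in> R. f < y}" if "x < y" "x \<in> R" for x y
  proof -
    have "sum w {f \<in> R. f < x} + w x = sum w {f \<in> R. f < Suc x}" using that R by (simp add: sum_upto_Suc)
    also have "\<dots> \<le> sum w {f \<in> R. f < y}" using R that by (intro sum_mono2) auto
    finally show ?thesis .
  qed
  show ?thesis using *[of e e'] *[of e' e] R r r' by (cases e e' rule: linorder_cases) auto
qed

text \<open>Almost sure termination is read off the running-time bounds and never argued
  separately.\<close>

lemma cost_bounded_lossless:
  assumes "cost_bounded p i j" "1 \<le> s ''n'' 0" "1 \<le> s ''m'' 0"
  shows "lossless_spmf (exec p s)"
  using assms unfolding cost_bounded_def cost_bounded_by_def by (blast dest: runs_within_lossless)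

lemma expect_Skip: "expect Skip f s = f s"
  by (simp add: expect_def measure_spmf_return_spmf nn_integral_return)

lemma potential_antimono: "u' \<le> u \<Longrightarrow> potential k m u N \<le> potential k m u' N"
  using potential_contract[of u' u m k N 0] by (simp add: potential_def)

context costed_hypergraph
begin

definition decided :: "state \<Rightarrow> nat set" where
  "decided s = {e. e < m \<and> s ''del'' e \<noteq> 0}"

definition live :: "state \<Rightarrow> nat set" where
  "live s = crossing (s ''lab'') - decided s"

lemma finite_live [simp]: "finite (live s)"
  by (simp add: live_def)

lemma live_less: "e \<in> live s \<Longrightarrow> e < m"
  by (simp add: live_def crossing_def)

lemma bval_undecided:
  assumes "ready s" "s ''e'' 0 < m"
  shows "bval undecided s \<longleftrightarrow> s ''e'' 0 \<in> live s"
  using assms by (auto simp: undecided_def ready_def recorded_def live_def crossing_def decided_def)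

lemma live_cong: "s' ''lab'' = s ''lab'' \<Longrightarrow> s' ''del'' = s ''del'' \<Longrightarrow> live s' = live s"
  by (simp add: live_def decided_def)

lemma ready_update:
  assumes "ready s" "x \<notin> {''n'', ''m'', ''row'', ''crow'', ''inc'', ''cost'', ''budget'', ''w'', ''sz'', ''lab''}"
  shows "ready (update s x i a)"
  using assms by (intro ready_agree[OF assms(1), of "{x}"]) (auto simp: agree_update)

lemma post_find_large:
  assumes "ready s"
  shows "post (find_large k) s (\<lambda>s'.
    s' ''big'' 0 = m \<and> (\<forall>e \<in> live s. 3 * k * (card (trace (s ''lab'') e) - 1) < s ''nn'' 0 - 1) \<or>
    s' ''big'' 0 \<in> live s \<and> s ''nn'' 0 - 1 \<le> 3 * k * (card (trace (s ''lab'') (s' ''big'' 0)) - 1))"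
proof -
  let ?large = "\<lambda>e. s ''nn'' 0 - 1 \<le> 3 * k * (card (trace (s ''lab'') e) - 1)"
  let ?p = "If_then (Conj undecided
          (at_most (Minus (V ''nn'') (Const 1)) (scale (3 * k) (Minus (Cell ''sz'' (V ''e'')) (Const 1)))))
        (assign ''big'' (V ''e''))"
  let ?s = "update s ''big'' 0 m"
  let ?I = "\<lambda>j s'. s' ''big'' 0 = m \<and> (\<forall>e \<in> live s. e < j \<longrightarrow> \<not> ?large e) \<or> s' ''big'' 0 \<in> live s \<and> ?large (s' ''big'' 0)"
  have "post (For ''e'' (V ''m'') ?p) ?s (?I m)"
  proof (rule post_For[where I = ?I and B = m])
    fix s' assume *: "agree (insert ''e'' (writes ?p)) ?s s'"
    have r: "ready s'" by (rule ready_agree[OF ready_update[OF assms] *]) simp_all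
    have 1: "s' ''lab'' = s ''lab''" "s' ''nn'' = s ''nn''" "s' ''del'' = s ''del''"
      using agreeD[OF *, of "''nn''"] agreeD[OF *, of "''lab''"] agreeD[OF *, of "''del''"] by (simp_all add: update_apply)
    show "aval (V ''m'') s' = m" using r by (simp add: ready_def env_def)
    fix j assume j: "j < m" "s' ''e'' 0 = j" and I: "?I j s'"
    have "bval undecided s' \<longleftrightarrow> j \<in> live s" "s' ''sz'' j = card (trace (s ''lab'') j)"
      using bval_undecided[OF r] j 1 live_cong[OF 1(1,3)] r by (simp_all add: ready_def recorded_def)
    then show "post ?p s' (\<lambda>s''. ?I (Suc j) (update s'' ''e'' 0 (Suc j)))"
      using I j 1 by (auto simp: update_apply less_Suc_eq)
  qed (simp_all add: update_apply)
  then have "post (find_large k) s (?I m)"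
    using assms by (simp add: find_large_def ready_def env_def)
  then show ?thesis by (rule post_weaken) (auto simp: not_le live_less)
qed

lemma post_find_objective:
  "post (find_objective k) s (\<lambda>s'. s' ''h'' 0 < k \<and>
     ((\<exists>i<k. s ''nn'' 0 \<le> k * s ''cnt'' i) \<longrightarrow> s ''nn'' 0 \<le> k * s ''cnt'' (s' ''h'' 0)))"
proof -
  let ?p = "If_then (at_most (V ''nn'') (scale k (Cell ''cnt'' (V ''i'')))) (assign ''h'' (V ''i''))"
  let ?I = "\<lambda>j s'. s' ''h'' 0 < k \<and> ((\<exists>i<j. s ''nn'' 0 \<le> k * s ''cnt'' i) \<longrightarrow> s ''nn'' 0 \<le> k * s ''cnt'' (s' ''h'' 0))"
  have "post (For ''i'' (Const k) ?p) (update s ''h'' 0 0) (?I k)"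
  proof (rule post_For[where I = ?I and B = k])
    fix j s' assume *: "agree (insert ''i'' (writes ?p)) (update s ''h'' 0 0) s'"
      and j: "j < k" "s' ''i'' 0 = j" and I: "?I j s'"
    have "s' ''nn'' = s ''nn''" "s' ''cnt'' = s ''cnt''"
      using agreeD[OF *, of "''nn''"] agreeD[OF *, of "''cnt''"] by (simp_all add: update_apply)
    then show "post ?p s' (\<lambda>s''. ?I (Suc j) (update s'' ''i'' 0 (Suc j)))"
      using I j by (auto simp: update_apply less_Suc_eq)
  qed (use k in \<open>simp_all add: update_apply\<close>)
  then show ?thesis by (simp add: find_objective_def)
qed

lemma post_total_cost:
  assumes "ready s" "s ''h'' 0 < k"
  shows "post total_cost s (\<lambda>s'. s' ''y'' 0 = sum (c (s ''h'' 0)) (live s))"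
proof -
  let ?p = "If_then undecided add_cost" and ?c = "c (s ''h'' 0)" and ?s = "update s ''y'' 0 0"
  have "post (For ''e'' (V ''m'') ?p) ?s (\<lambda>s'. s' ''y'' 0 = sum ?c (live s))"
  proof (rule post_For[where I = "\<lambda>j s'. s' ''y'' 0 = sum ?c {e \<in> live s. e < j}" and B = m])
    fix s' assume *: "agree (insert ''e'' (writes ?p)) ?s s'"
    have r: "ready s'" by (rule ready_agree[OF ready_update[OF assms(1)] *]) (simp_all add: add_cost_def)
    have 1: "s' ''lab'' = s ''lab''" "s' ''h'' = s ''h''" "s' ''del'' = s ''del''"
      using agreeD[OF *, of "''h''"] agreeD[OF *, of "''lab''"] agreeD[OF *, of "''del''"]
      by (simp_all add: update_apply add_cost_def)
    show "aval (V ''m'') s' = m" using r by (simp add: ready_def env_def)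
    have "{e \<in> live s. e < m} = live s" by (auto simp: live_less)
    then show "s' ''y'' 0 = sum ?c {e \<in> live s. e < m} \<Longrightarrow> s' ''y'' 0 = sum ?c (live s)" by simp
    fix j assume j: "j < m" "s' ''e'' 0 = j" and y: "s' ''y'' 0 = sum ?c {e \<in> live s. e < j}"
    have "bval undecided s' \<longleftrightarrow> j \<in> live s" using bval_undecided[OF r] j live_cong[OF 1(1,3)] by simp
    moreover have "s' ''crow'' (s ''h'' 0) = s ''h'' 0 * m" "s' ''cost'' (s ''h'' 0 * m + j) = ?c j"
      using r j assms(2) 1 by (simp_all add: ready_def env_def)
    ultimately show "post ?p s' (\<lambda>s''. update s'' ''e'' 0 (Suc j) ''y'' 0 = sum ?c {e \<in> live s. e < Suc j})"
      using y j 1 by (auto simp: sum_upto_Suc update_apply add_cost_def)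
  qed (simp_all add: update_apply add_cost_def)
  then show ?thesis by (simp add: total_cost_def)
qed

definition located :: "state \<Rightarrow> nat \<Rightarrow> nat \<Rightarrow> nat \<Rightarrow> bool" where
  "located s i r e \<longleftrightarrow> e \<in> live s \<and> sum (c i) {f \<in> live s. f < e} \<le> r \<and> r < sum (c i) {f \<in> live s. f < e} + c i e"

lemma post_locate:
  assumes "ready s" "s ''h'' 0 < k"
  shows "post locate s (\<lambda>s'. (s' ''sel'' 0 = s ''sel'' 0 \<or> s' ''sel'' 0 \<in> live s) \<and>
    (s ''z'' 0 < sum (c (s ''h'' 0)) (live s) \<longrightarrow> located s (s ''h'' 0) (s ''z'' 0) (s' ''sel'' 0)))"
proof -
  let ?p = "If_then undecided (Seq (If_then (at_most (V ''y'') (V ''z'')) (assign ''sel'' (V ''e''))) add_cost)"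
  let ?c = "c (s ''h'' 0)" and ?s = "update s ''y'' 0 0" and ?P = "\<lambda>j. sum (c (s ''h'' 0)) {f \<in> live s. f < j}"
  let ?I = "\<lambda>j s'. s' ''y'' 0 = ?P j \<and> (s' ''sel'' 0 = s ''sel'' 0 \<or> s' ''sel'' 0 \<in> live s) \<and>
    (s ''z'' 0 < ?P j \<longrightarrow> located s (s ''h'' 0) (s ''z'' 0) (s' ''sel'' 0))"
  have "post (For ''e'' (V ''m'') ?p) ?s (\<lambda>s'. (s' ''sel'' 0 = s ''sel'' 0 \<or> s' ''sel'' 0 \<in> live s) \<and>
    (s ''z'' 0 < sum ?c (live s) \<longrightarrow> located s (s ''h'' 0) (s ''z'' 0) (s' ''sel'' 0)))"
  proof (rule post_For[where I = ?I and B = m])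
    fix s' assume *: "agree (insert ''e'' (writes ?p)) ?s s'"
    have r: "ready s'" by (rule ready_agree[OF ready_update[OF assms(1)] *]) (simp_all add: add_cost_def)
    have 1: "s' ''lab'' = s ''lab''" "s' ''h'' = s ''h''" "s' ''del'' = s ''del''" "s' ''z'' = s ''z''"
      using agreeD[OF *, of "''h''"] agreeD[OF *, of "''lab''"] agreeD[OF *, of "''del''"] agreeD[OF *, of "''z''"]
      by (simp_all add: update_apply add_cost_def)
    show "aval (V ''m'') s' = m" using r by (simp add: ready_def env_def)
    have "{e \<in> live s. e < m} = live s" by (auto simp: live_less)
    then show "?I m s' \<Longrightarrow> (s' ''sel'' 0 = s ''sel'' 0 \<or> s' ''sel'' 0 \<in> live s) \<and>
      (s ''z'' 0 < sum ?c (live s) \<longrightarrow> located s (s ''h'' 0) (s ''z'' 0) (s' ''sel'' 0))" by simp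
    fix j assume j: "j < m" "s' ''e'' 0 = j" and I: "?I j s'"
    have b: "bval undecided s' \<longleftrightarrow> j \<in> live s" using bval_undecided[OF r] j live_cong[OF 1(1,3)] by simp
    have cost: "s' ''crow'' (s ''h'' 0) = s ''h'' 0 * m" "s' ''cost'' (s ''h'' 0 * m + j) = ?c j"
      using r j assms(2) 1 by (simp_all add: ready_def env_def)
    show "post ?p s' (\<lambda>s''. ?I (Suc j) (update s'' ''e'' 0 (Suc j)))"
    proof (cases "j \<in> live s")
      case True
      have P: "?P (Suc j) = ?P j + ?c j" using True by (simp add: sum_upto_Suc)
      show ?thesis
      proof (cases "?P j \<le> s ''z'' 0")
        \<comment> \<open>Hyperedge \<open>j\<close> is selected now. It is the right one unless the
          draw lies beyond its interval as well, and then nothing is claimed yet.\<close>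
        case le: True
        then show ?thesis using True b cost I j 1 unfolding P by (simp add: update_apply add_cost_def located_def)
      next
        case False
        then show ?thesis using True b cost I j 1 unfolding P by (simp add: update_apply add_cost_def)
      qed
    next
      case False
      then have "?P (Suc j) = ?P j" by (simp add: sum_upto_Suc)
      then show ?thesis using False b I by (simp add: update_apply)
    qed
  qed (simp_all add: update_apply add_cost_def)
  then show ?thesis by (simp add: locate_def)
qed

lemma post_contract:
  assumes "ready s" "s ''sel'' 0 = e" "e \<in> crossing (s ''lab'')"
  shows "post contract s (\<lambda>s'. contracts (s ''lab'') e (s' ''lab''))"
proof -
  let ?l = "s ''lab''" and ?T = "trace (s ''lab'') e"
  have em: "e < m" and T: "?T \<noteq> {}" using assms(3) by (auto simp: crossing_def)
  have Tn: "v < n" if "v \<in> ?T" for v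
    using that trace_subset_blocks[OF _ em, of ?l] assms(1) by (auto simp: ready_def blocks_def)
  let ?p = "If_then (Less (Const 0) (Cell ''w'' (Plus (Cell ''row'' (V ''sel'')) (V ''v'')))) (assign ''h'' (V ''v''))"
  let ?q = "If_then (Less (Const 0) (Cell ''w'' (Plus (Cell ''row'' (V ''sel'')) (Cell ''lab'' (V ''v'')))))
            (Store ''lab'' (V ''v'') (V ''h''))"
  let ?s = "update s ''h'' 0 0"
  have "post (Seq (For ''v'' (V ''n'') ?p) (For ''v'' (V ''n'') ?q)) ?s (\<lambda>s'. contracts ?l e (s' ''lab''))"
  proof (rule post_SeqI[where P = "\<lambda>s'. s' ''h'' 0 \<in> ?T"])
    show "post (For ''v'' (V ''n'') ?p) ?s (\<lambda>s'. s' ''h'' 0 \<in> ?T)"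
    proof (rule post_For[where I = "\<lambda>j s'. (\<exists>v \<in> ?T. v < j) \<longrightarrow> s' ''h'' 0 \<in> ?T" and B = n])
      fix s' assume *: "agree (insert ''v'' (writes ?p)) ?s s'"
      have r: "ready s'" by (rule ready_agree[OF ready_update[OF assms(1)] *]) simp_all
      have 1: "s' ''lab'' = ?l" "s' ''sel'' = s ''sel''"
        using agreeD[OF *, of "''lab''"] agreeD[OF *, of "''sel''"] by (simp_all add: update_apply)
      show "aval (V ''n'') s' = n" using r by (simp add: ready_def env_def)
      show "(\<exists>v \<in> ?T. v < n) \<longrightarrow> s' ''h'' 0 \<in> ?T \<Longrightarrow> s' ''h'' 0 \<in> ?T" using T Tn by blast
      fix j assume j: "j < n" "s' ''v'' 0 = j" and I: "(\<exists>v \<in> ?T. v < j) \<longrightarrow> s' ''h'' 0 \<in> ?T"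
      have "0 < s' ''w'' (s' ''row'' e + j) \<longleftrightarrow> j \<in> ?T"
        using r em j 1 by (simp add: ready_def env_def recorded_def)
      then show "post ?p s' (\<lambda>s''. (\<exists>v \<in> ?T. v < Suc j) \<longrightarrow> update s'' ''v'' 0 (Suc j) ''h'' 0 \<in> ?T)"
        using I j 1 assms(2) by (auto simp: update_apply less_Suc_eq)
    qed (simp_all add: update_apply)
  next
    fix s1 assume a: "agree (writes (For ''v'' (V ''n'') ?p)) ?s s1" and h: "s1 ''h'' 0 \<in> ?T"
    have r1: "ready s1" by (rule ready_agree[OF ready_update[OF assms(1)] a]) simp_all
    have s1: "s1 ''lab'' = ?l" "s1 ''sel'' = s ''sel''"
      using agreeD[OF a, of "''lab''"] agreeD[OF a, of "''sel''"] by (simp_all add: update_apply)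
    let ?I = "\<lambda>j s'. \<forall>v<n. s' ''lab'' v = (if v < j \<and> ?l v \<in> ?T then s1 ''h'' 0 else ?l v)"
    show "post (For ''v'' (V ''n'') ?q) s1 (\<lambda>s'. contracts ?l e (s' ''lab''))"
    proof (rule post_For[where I = ?I and B = n])
      fix s' assume *: "agree (insert ''v'' (writes ?q)) s1 s'"
      have env: "env s'" by (rule env_agree[OF _ *]) (use r1 in \<open>simp_all add: ready_def\<close>)
      have 1: "s' ''h'' = s1 ''h''" "s' ''sel'' = s ''sel''" "s' ''w'' = s1 ''w''"
        using agreeD[OF *, of "''h''"] agreeD[OF *, of "''sel''"] agreeD[OF *, of "''w''"] s1 by simp_all
      show "aval (V ''n'') s' = n" using env by (simp add: env_def)
      show "?I n s' \<Longrightarrow> contracts ?l e (s' ''lab'')"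
        using h unfolding contracts_def by (intro bexI[of _ "s1 ''h'' 0"]) auto
      fix j assume j: "j < n" "s' ''v'' 0 = j" and I: "?I j s'"
      have "?l j < n" using r1 s1 j by (simp add: ready_def labelling_def)
      then have "0 < s' ''w'' (s' ''row'' e + ?l j) \<longleftrightarrow> ?l j \<in> ?T"
        using r1 em env 1 s1 by (simp add: ready_def env_def recorded_def)
      moreover have "s' ''lab'' j = ?l j" using I j by simp
      ultimately show "post ?q s' (\<lambda>s''. ?I (Suc j) (update s'' ''v'' 0 (Suc j)))"
        using I j 1 assms(2) by (auto simp: update_apply less_Suc_eq)
    qed (use s1 in \<open>simp_all add: update_apply\<close>)
  qed
  moreover have "s ''m'' 0 = m" "1 < s ''sz'' e"
    using assms em by (simp_all add: ready_def env_def recorded_def crossing_def)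
  ultimately show ?thesis using em assms(2) by (simp add: contract_def)
qed

end

section \<open>Success probability of a step\<close>

lemma cost_bounded_parts:
  "cost_bounded traces 1 1" "cost_bounded count_blocks 1 1" "cost_bounded (test_stars k) 1 1"
  "cost_bounded (find_large k) 1 1" "cost_bounded (find_objective k) 1 1" "cost_bounded total_cost 1 1"
  "cost_bounded locate 1 1" "cost_bounded contract 1 1"
  unfolding One_nat_def step_defs by (intro cost_bounded_intros; simp)+

lemma le_divide_ennreal:
  assumes "a * ennreal q \<le> x" "0 < q"
  shows "a \<le> x / ennreal q"
  using divide_right_mono_ennreal[OF assms(1), of "ennreal q"] assms(2)
  by (simp add: mult_divide_eq_ennreal)

context costed_hypergraph
begin

definition solved :: "state \<Rightarrow> bool" where
  "solved s \<longleftrightarrow> (\<exists>U. U \<noteq> {} \<and> U \<subset> {..<n} \<and> {e. e < m \<and> s ''out'' e \<noteq> 0} = cut U \<and>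
     (\<forall>i<k. sum (c i) (cut U) \<le> b i))"

lemma star_found_solved:
  assumes "star_found l s" "1 < card (blocks l)"
  shows "solved s"
proof -
  obtain v where v: "v \<in> blocks l" "\<And>i. i < k \<Longrightarrow> v \<notin> violators l i" "{e. e < m \<and> s ''out'' e \<noteq> 0} = star l v"
    using assms(1) by (auto simp: star_found_def)
  have "sum (c i) (star l v) \<le> b i" if "i < k" for i
    using v(1) v(2)[OF that] by (simp add: violators_def not_less)
  then show ?thesis
    unfolding solved_def star_eq_cut using block_proper[OF v(1) assms(2)] v(3)[unfolded star_eq_cut]
    by (intro exI[of _ "{u. u < n \<and> l u = v}"] conjI allI impI)
qed

text \<open>The run is still searching and has made no mistake about the target side
  \<open>U\<close>: no contraction has joined the two sides, and only hyperedges of the target cut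
  were deleted.\<close>

definition consistent :: "nat set \<Rightarrow> state \<Rightarrow> bool" where
  "consistent U s \<longleftrightarrow> s ''found'' 0 = 0 \<and> labelling (s ''lab'') \<and> saturated (s ''lab'') U \<and> decided s \<subseteq> cut U"

definition state_potential :: "state \<Rightarrow> real" where
  "state_potential s = potential k m (card (live s)) (card (blocks (s ''lab'')) - 1)"

text \<open>Further hyperedges may stop crossing along with \<open>e\<close>; the potential only
  grows when fewer are undecided, so counting one fewer is safe.\<close>

lemma expect_contract:
  assumes s: "ready s" "consistent U s" "s ''sel'' 0 = e" "e \<in> live s" "e \<notin> cut U"
    and nm: "1 \<le> n" "1 \<le> m"
    and g: "\<And>s'. env s' \<Longrightarrow> consistent U s' \<Longrightarrow> card (live s') < card (live s) \<Longrightarrow> ennreal (state_potential s') \<le> g s'"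
  shows "ennreal (potential k m (card (live s) - 1) (card (blocks (s ''lab'')) - 1 - (card (trace (s ''lab'') e) - 1)))
    \<le> expect contract g s"
proof (rule expect_ge_post)
  show "lossless_spmf (exec contract s)"
    using s(1) nm by (intro cost_bounded_lossless[OF cost_bounded_parts(8)]) (simp_all add: ready_def env_def)
  show "post contract s (\<lambda>s'. contracts (s ''lab'') e (s' ''lab''))"
    using s by (intro post_contract) (simp_all add: live_def)
  fix s' assume con: "contracts (s ''lab'') e (s' ''lab'')" and a: "agree (writes contract) s s'"
  have em: "e < m" using s(4) by (rule live_less)
  have l: "labelling (s ''lab'')" using s(1) by (simp add: ready_def)
  have eq: "s' ''del'' = s ''del''" "s' ''found'' = s ''found''"
    by (auto intro!: agreeD[OF a] simp: contract_def)
  have env: "env s'" by (rule env_agree[OF _ a]) (use s(1) in \<open>simp_all add: ready_def contract_def\<close>)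
  have cons: "consistent U s'"
    using s contracts_labelling[OF l con em] contracts_saturated[OF _ con em] eq
    by (auto simp: consistent_def decided_def)
  have "live s' \<subseteq> live s - {e}"
    using contracts_crossing[OF con em] eq by (auto simp: live_def decided_def)
  then have "card (live s') \<le> card (live s - {e})" by (intro card_mono) auto
  then have le: "card (live s') \<le> card (live s) - 1" using s(4) by simp
  have pos: "0 < card (live s)" using s(4) by (auto simp: card_gt_0_iff)
  have "card (blocks (s' ''lab'')) - 1 = card (blocks (s ''lab'')) - 1 - (card (trace (s ''lab'') e) - 1)"
    using contracts_blocks[OF l con em] by simp
  then have "potential k m (card (live s) - 1) (card (blocks (s ''lab'')) - 1 - (card (trace (s ''lab'') e) - 1)) \<le> state_potential s'"
    unfolding state_potential_def using potential_antimono[OF le] by simp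
  also have "ennreal (state_potential s') \<le> g s'" using env cons le pos by (intro g) auto
  finally show "ennreal (potential k m (card (live s) - 1) (card (blocks (s ''lab'')) - 1 - (card (trace (s ''lab'') e) - 1))) \<le> g s'"
    by (simp add: ennreal_leI)
qed

text \<open>Both sides of the target cut contain a block, and a hyperedge outside the cut reaches
  only one side. Hence \<open>N\<close> stays positive after its contraction, as
  \<open>depth_shrink\<close> demands.\<close>

lemma trace_not_all_blocks:
  assumes "labelling l" "saturated l U" "e < m" "e \<notin> cut U" "U \<noteq> {}" "U \<subset> {..<n}"
  shows "card (trace l e) < card (blocks l)"
proof -
  have sub: "trace l e \<subseteq> blocks l" by (rule trace_subset_blocks[OF assms(1,3)])
  obtain u v where uv: "u \<in> U" "u < n" "v < n" "v \<notin> U" using assms(5,6) by blast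
  have bl: "l u \<in> blocks l" "l v \<in> blocks l" using uv assms(1) by (auto simp: blocks_def labelling_def)
  have "\<not> (l u \<in> trace l e \<and> l v \<in> trace l e)"
  proof
    assume "l u \<in> trace l e \<and> l v \<in> trace l e"
    then obtain u' v' where *: "u' \<in> E e" "v' \<in> E e" "l u = l u'" "l v = l v'" by (auto simp: trace_def)
    moreover have "u' < n" "v' < n" using * E[OF assms(3)] by auto
    ultimately have "u' \<in> U" "v' \<notin> U" using uv assms(2) unfolding saturated_def by blast+
    then show False using * assms(3,4) by (auto simp: cut_def)
  qed
  then show ?thesis using sub bl by (intro psubset_card_mono) auto
qed

text \<open>One answer of the guess is right, and only that answer is counted: \<open>m\<close> of
  the \<open>m + 1\<close> draws if the hyperedge lies in the target cut, the draw 0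
  otherwise.\<close>

lemma expect_guess:
  assumes s: "ready s" "consistent U s" "s ''sel'' 0 = m" "s ''big'' 0 \<in> live s"
    and U: "U \<noteq> {}" "U \<subset> {..<n}"
    and large: "card (blocks (s ''lab'')) - 1 \<le> 3 * k * (card (trace (s ''lab'') (s ''big'' 0)) - 1)"
    and nm: "1 \<le> n" "1 \<le> m"
    and g: "\<And>s'. env s' \<Longrightarrow> consistent U s' \<Longrightarrow> card (live s') < card (live s) \<Longrightarrow> ennreal (state_potential s') \<le> g s'"
  shows "ennreal (state_potential s) \<le> expect guess (expect contract g) s"
proof -
  let ?e = "s ''big'' 0" and ?l = "s ''lab''" and ?u = "card (live s)"
  let ?N = "card (blocks ?l) - 1" and ?x = "card (trace ?l ?e) - 1"
  define F where "F r = expect (Cond (Less (V ''z'') (Const 1)) (assign ''sel'' (V ''big'')) (Store ''del'' (V ''big'') (Const 1)))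
     (expect contract g) (update s ''z'' 0 r)" for r
  have ms: "s ''m'' 0 = m" using s(1) by (simp add: ready_def env_def)
  have em: "?e < m" using s(4) by (rule live_less)
  have u0: "0 < ?u" using s(4) by (auto simp: card_gt_0_iff)
  have exp: "expect guess (expect contract g) s = (\<Sum>r\<le>m. F r) / ennreal (real m + 1)"
    by (simp add: guess_def expect_Seq expect_Rand F_def ms ennreal_plus ennreal_of_nat_eq_real_of_nat add.commute)
  have "ennreal (state_potential s) * ennreal (real m + 1) \<le> (\<Sum>r\<le>m. F r)"
  proof (cases "?e \<in> cut U")
    case True
    have F: "ennreal (potential k m (?u - 1) ?N) \<le> F r" if "r \<in> {1..m}" for r
    proof -
      let ?s = "update (update s ''z'' 0 r) ''del'' ?e 1"
      have "F r = expect contract g ?s"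
        using that by (simp add: F_def expect_Cond expect_Store update_apply)
      \<comment> \<open>\<open>sel\<close> still has the value \<open>m\<close>, so
        \<open>contract\<close> does nothing.\<close>
      also have "\<dots> = g ?s"
        using s(3) ms by (simp add: contract_def expect_Cond expect_Skip update_apply)
      finally have "F r = g ?s" .
      moreover have env: "env ?s"
        by (rule env_agree[where s = s and W = "{''z'', ''del''}"]) (use s(1) in \<open>simp_all add: ready_def agree_update\<close>)
      moreover have dec: "decided ?s = insert ?e (decided s)" using em by (auto simp: decided_def update_apply)
      then have "consistent U ?s"
        using s(2) True by (simp add: consistent_def) (simp add: update_apply)
      moreover have liv: "live ?s = live s - {?e}"
        unfolding live_def dec by (auto simp: update_apply)
      moreover have "state_potential ?s = potential k m (?u - 1) ?N"
        unfolding state_potential_def liv using s(4) by (simp add: update_apply)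
      ultimately show ?thesis using g[of ?s] s(4) u0 by simp
    qed
    have "state_potential s * (real m + 1) \<le> real m * potential k m (?u - 1) ?N"
      using potential_delete[of "?u - 1" ?u k m ?N] u0 by (simp add: state_potential_def field_simps)
    then have "ennreal (state_potential s) * ennreal (real m + 1) \<le> ennreal (real m * potential k m (?u - 1) ?N)"
      by (subst ennreal_mult[symmetric]) (auto simp: state_potential_def potential_nonneg intro: ennreal_leI)
    also have "\<dots> = (\<Sum>r \<in> {1..m}. ennreal (potential k m (?u - 1) ?N))"
      by (simp add: ennreal_mult potential_nonneg ennreal_of_nat_eq_real_of_nat)
    also have "\<dots> \<le> (\<Sum>r \<in> {1..m}. F r)" using F by (rule sum_mono)
    also have "\<dots> \<le> (\<Sum>r\<le>m. F r)" by (intro sum_mono2) auto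
    finally show ?thesis .
  next
    case False
    let ?s = "update (update s ''z'' 0 0) ''sel'' 0 ?e"
    have "F 0 = expect contract g ?s"
      by (simp add: F_def expect_Cond expect_Store update_apply)
    moreover have "ready ?s" using s(1) by (intro ready_update) simp_all
    moreover have lab: "?s ''lab'' = ?l" "?s ''del'' = s ''del''" "?s ''found'' = s ''found''" by (simp_all add: update_apply)
    moreover have liv: "live ?s = live s" by (rule live_cong) (simp_all add: update_apply)
    moreover have "consistent U ?s"
      using s(2) unfolding consistent_def decided_def lab .
    ultimately have "ennreal (potential k m (?u - 1) (?N - ?x)) \<le> F 0"
      using expect_contract[of ?s U ?e g] s(4) False nm g by (simp add: liv)
    moreover have "potential k m ?u ?N \<le> 1 / (real m + 1) * potential k m (?u - 1) (?N - ?x)"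
    proof (rule potential_contract_large)
      have "1 < card (trace ?l ?e)" using s(4) by (simp add: live_def crossing_def)
      then show "1 \<le> ?x" by linarith
      have "card (trace ?l ?e) < card (blocks ?l)"
        using s(2) False em U by (intro trace_not_all_blocks) (auto simp: consistent_def)
      then show "?x < ?N" using \<open>1 \<le> ?x\<close> by linarith
    qed (use large k in simp_all)
    then have "state_potential s * (real m + 1) \<le> potential k m (?u - 1) (?N - ?x)"
      by (simp add: state_potential_def field_simps)
    then have "ennreal (state_potential s) * ennreal (real m + 1) \<le> ennreal (potential k m (?u - 1) (?N - ?x))"
      by (subst ennreal_mult[symmetric]) (auto simp: state_potential_def potential_nonneg intro: ennreal_leI)
    moreover have "F 0 \<le> (\<Sum>r\<le>m. F r)" by (rule member_le_sum) auto
    ultimately show ?thesis by (meson order_trans)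
  qed
  then show ?thesis
    unfolding exp by (rule le_divide_ennreal) simp
qed


lemma expect_sample:
  assumes s: "ready s" "consistent U s" "s ''sel'' 0 = m" "s ''nn'' 0 = card (blocks (s ''lab''))"
    and U: "U \<noteq> {}" "U \<subset> {..<n}" "\<And>i. i < k \<Longrightarrow> sum (c i) (cut U) \<le> b i"
    and viol: "all_violated (s ''lab'')" "\<And>i. i < k \<Longrightarrow> s ''cnt'' i = card (violators (s ''lab'') i)"
    and small: "\<And>e. e \<in> live s \<Longrightarrow> 3 * k * (card (trace (s ''lab'') e) - 1) < card (blocks (s ''lab'')) - 1"
    and nm: "1 \<le> n" "1 \<le> m"
    and g: "\<And>s'. env s' \<Longrightarrow> consistent U s' \<Longrightarrow> card (live s') < card (live s) \<Longrightarrow> ennreal (state_potential s') \<le> g s'"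
  shows "ennreal (state_potential s) \<le> expect (sample k) (expect contract g) s"
proof -
  let ?l = "s ''lab''" and ?u = "card (live s)"
  let ?N = "card (blocks ?l) - 1"
  have l: "labelling ?l" and sat: "saturated ?l U" and dec: "decided s \<subseteq> cut U"
    using s(2) by (auto simp: consistent_def)
  have blocks2: "1 < card (blocks ?l)" by (rule two_blocks[OF l sat U(1,2)])
  have lossless: "lossless_spmf (exec p s')" if "cost_bounded p 1 1" "ready s'" for p s'
    using that nm by (intro cost_bounded_lossless[OF that(1)]) (simp_all add: ready_def env_def)
  \<comment> \<open>Pigeonhole principle: otherwise the \<open>k\<close> sets of violators could not
    cover the blocks.\<close>
  have heavy: "\<exists>i<k. card (blocks ?l) \<le> k * card (violators ?l i)"
  proof (rule ccontr)
    assume "\<not> ?thesis"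
    then have "k * card (violators ?l i) < card (blocks ?l)" if "i < k" for i using that by (auto simp: not_le)
    then have "(\<Sum>i<k. k * card (violators ?l i)) < (\<Sum>i<k. card (blocks ?l))"
      using k by (intro sum_strict_mono) (auto simp: lessThan_empty_iff)
    then have "(\<Sum>i<k. card (violators ?l i)) < card (blocks ?l)" by (simp add: sum_distrib_left[symmetric])
    moreover have "card (blocks ?l) \<le> card (\<Union>i<k. violators ?l i)"
      using viol(1) by (intro card_mono) (auto simp: all_violated_def violators_def)
    moreover have "card (\<Union>i<k. violators ?l i) \<le> (\<Sum>i<k. card (violators ?l i))"
      by (intro card_UN_le) simp
    ultimately show False by linarith
  qed
  show ?thesis
    unfolding sample_def expect_Seq
  proof (rule expect_ge_post[OF lossless[OF cost_bounded_parts(5) s(1)] post_find_objective])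
    fix s1 assume h: "s1 ''h'' 0 < k \<and> ((\<exists>i<k. s ''nn'' 0 \<le> k * s ''cnt'' i) \<longrightarrow> s ''nn'' 0 \<le> k * s ''cnt'' (s1 ''h'' 0))"
      and a1: "agree (writes (find_objective k)) s s1"
    define i where "i = s1 ''h'' 0"
    have i: "i < k" "card (blocks ?l) \<le> k * card (violators ?l i)"
      using h heavy viol(2) s(4) by (auto simp: i_def)
    have r1: "ready s1" by (rule ready_agree[OF s(1) a1]) (simp add: find_objective_def)
    have e1: "s1 ''lab'' = ?l" "s1 ''del'' = s ''del''" "s1 ''found'' = s ''found''" "s1 ''sel'' = s ''sel''"
      by (auto intro!: agreeD[OF a1] simp: find_objective_def)
    have live1: "live s1 = live s" by (rule live_cong[OF e1(1,2)])
    let ?W = "sum (c i) (live s)"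
    have cutX: "cut U \<subseteq> crossing ?l" by (rule cut_subset_crossing[OF sat])
    have total: "(?N + 1) * (sum (c i) (cut U - decided s) + 1) \<le> k * (\<Sum>e \<in> live s. c i e * card (trace ?l e))"
      using violators_cost[OF l sat U(3) dec i] blocks2 by (simp add: live_def)
    \<comment> \<open>A total of 0 would contradict the \<open>+ 1\<close> in \<open>total\<close>.
      In particular, the stars cannot all be violated once no undecided hyperedge is left.\<close>
    have W: "0 < ?W"
    proof (rule ccontr)
      assume "\<not> 0 < ?W"
      then have "\<forall>e \<in> live s. c i e = 0" by simp
      then show False using total by simp
    qed
    define pot where "pot e = potential k m (?u - 1) (?N - (card (trace ?l e) - 1))" for e
    show "ennreal (state_potential s) \<le> expect total_cost
      (expect (Rand ''z'' (Const 0) (Minus (V ''y'') (Const 1))) (expect locate (expect contract g))) s1"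
    proof (rule expect_ge_post[OF lossless[OF cost_bounded_parts(6) r1] post_total_cost[OF r1]])
      show "s1 ''h'' 0 < k" using h by simp
      fix s2 assume y: "s2 ''y'' 0 = sum (c (s1 ''h'' 0)) (live s1)" and a2: "agree (writes total_cost) s1 s2"
      have r2: "ready s2" by (rule ready_agree[OF r1 a2]) (simp add: total_cost_def add_cost_def)
      have e2: "s2 ''lab'' = ?l" "s2 ''del'' = s ''del''" "s2 ''found'' = s ''found''" "s2 ''sel'' = s ''sel''" "s2 ''h'' = s1 ''h''"
        using e1 by (auto intro!: agreeD[OF a2, THEN trans] simp: total_cost_def add_cost_def)
      have y': "s2 ''y'' 0 = ?W" using y live1 by (simp add: i_def)
      define F where "F r = expect locate (expect contract g) (update s2 ''z'' 0 r)" for r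
      \<comment> \<open>A draw that hits the target cut is written off as a failure.\<close>
      have F: "(if e \<in> cut U then 0 else ennreal (pot e)) \<le> F r"
        if e: "e \<in> live s" and r: "sum (c i) {f \<in> live s. f < e} \<le> r" "r < sum (c i) {f \<in> live s. f < e} + c i e" for e r
      proof (cases "e \<in> cut U")
        case False
        let ?s = "update s2 ''z'' 0 r"
        have rs: "ready ?s" by (rule ready_update[OF r2]) simp
        have es: "?s ''lab'' = ?l" "?s ''del'' = s ''del''" "?s ''found'' = s ''found''" "?s ''h'' 0 = i" "?s ''z'' 0 = r"
          using e2 by (simp_all add: update_apply i_def)
        have lives: "live ?s = live s" by (rule live_cong[OF es(1,2)])
        have "r < ?W"
        proof -
          have "sum (c i) {f \<in> live s. f < e} + c i e = sum (c i) {f \<in> live s. f < Suc e}"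
            using e by (simp add: sum_upto_Suc)
          also have "\<dots> \<le> ?W" by (intro sum_mono2) auto
          finally show ?thesis using r by simp
        qed
        have "ennreal (pot e) \<le> F r"
          unfolding F_def
        proof (rule expect_ge_post[OF lossless[OF cost_bounded_parts(7) rs] post_locate[OF rs]])
          show "?s ''h'' 0 < k" using es i by simp
          fix s3 assume 3: "(s3 ''sel'' 0 = ?s ''sel'' 0 \<or> s3 ''sel'' 0 \<in> live ?s) \<and>
            (?s ''z'' 0 < sum (c (?s ''h'' 0)) (live ?s) \<longrightarrow> located ?s (?s ''h'' 0) (?s ''z'' 0) (s3 ''sel'' 0))"
            and a3: "agree (writes locate) ?s s3"
          have "located ?s i r (s3 ''sel'' 0)" using 3 \<open>r < ?W\<close> unfolding es lives by blast
          then have sel: "s3 ''sel'' 0 = e"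
            unfolding located_def lives using e r by (intro location_unique[of "live s" _ e "c i" r]) auto
          have r3: "ready s3" by (rule ready_agree[OF rs a3]) (simp add: locate_def add_cost_def)
          have e3: "s3 ''lab'' = ?l" "s3 ''del'' = s ''del''" "s3 ''found'' = s ''found''"
            using es by (auto intro!: agreeD[OF a3, THEN trans] simp: locate_def add_cost_def)
          have live3: "live s3 = live s" by (rule live_cong[OF e3(1,2)])
          have "consistent U s3" using s(2) unfolding consistent_def decided_def e3 .
          then show "ennreal (pot e) \<le> expect contract g s3"
            using expect_contract[OF r3 _ sel _ False nm, of g] g e live3 e3(1) by (simp add: pot_def)
        qed
        then show ?thesis using False by simp
      qed simp
      have "real ?W * state_potential s \<le> (\<Sum>e \<in> live s - (cut U - decided s). real (c i e) * pot e)"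
        unfolding state_potential_def pot_def
      proof (rule potential_weighted[OF _ k])
        show "2 \<le> card (trace ?l e) \<and> 3 * k * (card (trace ?l e) - 1) < ?N" if "e \<in> live s" for e
          using small[OF that] that by (simp add: live_def crossing_def)
        show "cut U - decided s \<subseteq> live s" using cutX by (auto simp: live_def)
      qed (use total in simp_all)
      also have "live s - (cut U - decided s) = live s - cut U" by (auto simp: live_def)
      finally have W_le: "real ?W * state_potential s \<le> (\<Sum>e \<in> live s - cut U. real (c i e) * pot e)" .
      have "ennreal (state_potential s) * ennreal (real ?W) \<le> ennreal (\<Sum>e \<in> live s - cut U. real (c i e) * pot e)"
        using W_le by (subst ennreal_mult[symmetric])
          (auto simp: state_potential_def potential_nonneg mult.commute intro: ennreal_leI sum_nonneg)
      also have "\<dots> = (\<Sum>e \<in> live s - cut U. of_nat (c i e) * ennreal (pot e))"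
        by (subst sum_ennreal[symmetric])
          (auto simp: pot_def potential_nonneg ennreal_mult ennreal_of_nat_eq_real_of_nat)
      also have "\<dots> = (\<Sum>e \<in> live s - cut U. of_nat (c i e) * (if e \<in> cut U then 0 else ennreal (pot e)))"
        by (intro sum.cong) auto
      also have "\<dots> \<le> (\<Sum>e \<in> live s. of_nat (c i e) * (if e \<in> cut U then 0 else ennreal (pot e)))"
        by (intro sum_mono2) auto
      also have "\<dots> \<le> (\<Sum>r < ?W. F r)" using F by (intro sum_located_le) auto
      finally have "ennreal (state_potential s) \<le> (\<Sum>r < ?W. F r) / ennreal (real ?W)"
        using W by (intro le_divide_ennreal) (simp_all only: of_nat_0_less_iff)
      also have "\<dots> = expect (Rand ''z'' (Const 0) (Minus (V ''y'') (Const 1))) (expect locate (expect contract g)) s2"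
      proof -
        have "{..?W - 1} = {..<?W}" using W by auto
        moreover have "of_nat (?W - 1) + 1 = ennreal (real ?W)"
          using W by (metis Suc_diff_1 add.commute ennreal_of_nat_eq_real_of_nat of_nat_Suc)
        ultimately show ?thesis by (simp add: expect_Rand y' F_def add.commute)
      qed
      finally show "ennreal (state_potential s) \<le> \<dots>" .
    qed
  qed
qed

text \<open>In martingale terms: the potential, set to 1 on success and to 0 after a mistake, does
  not decrease in expectation. \<open>g\<close> is the value of the remaining run, of which only the
  two stated lower bounds are known.\<close>

lemma expect_step:
  assumes s: "env s" "consistent U s"
    and U: "U \<noteq> {}" "U \<subset> {..<n}" "\<And>i. i < k \<Longrightarrow> sum (c i) (cut U) \<le> b i"
    and nm: "1 \<le> n" "1 \<le> m"
    and g1: "\<And>s'. env s' \<Longrightarrow> s' ''found'' 0 = 1 \<Longrightarrow> solved s' \<Longrightarrow> 1 \<le> g s'"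
    and g0: "\<And>s'. env s' \<Longrightarrow> consistent U s' \<Longrightarrow> card (live s') < card (live s) \<Longrightarrow> ennreal (state_potential s') \<le> g s'"
  shows "ennreal (state_potential s) \<le> expect (step k) g s"
proof -
  let ?l = "s ''lab''"
  have l: "labelling ?l" and sat: "saturated ?l U" and found: "s ''found'' 0 = 0"
    using s(2) by (auto simp: consistent_def)
  have blocks2: "1 < card (blocks ?l)" by (rule two_blocks[OF l sat U(1,2)])
  have lossless: "lossless_spmf (exec p s')" if "cost_bounded p 1 1" "env s'" for p s'
    using that nm by (intro cost_bounded_lossless[OF that(1)]) (simp_all add: env_def)
  let ?choose = "Seq (assign ''sel'' (V ''m'')) (Cond (Less (V ''big'') (V ''m'')) guess (sample k))"
  let ?pick = "If_then (Less (V ''found'') (Const 1)) (Seq (pick k) contract)"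
  let ?test = "If_then (Less (Const 1) (V ''nn'')) (Seq (test_stars k) ?pick)"
  have "ennreal (state_potential s) \<le> expect traces (expect count_blocks (expect ?test g)) s"
  proof (rule expect_ge_post[OF lossless[OF cost_bounded_parts(1) s(1)] post_traces[OF s(1) l]])
    fix s1 assume r1: "ready s1" and a1: "agree (writes traces) s s1"
    have e1: "s1 ''lab'' = ?l" "s1 ''del'' = s ''del''" "s1 ''found'' = s ''found''"
      by (auto intro!: agreeD[OF a1] simp: traces_def trace_row_def)
    have env1: "env s1" using r1 by (simp add: ready_def)
    show "ennreal (state_potential s) \<le> expect count_blocks (expect ?test g) s1"
    proof (rule expect_ge_post[OF lossless[OF cost_bounded_parts(2) env1] post_count_blocks[OF env1]])
      fix s2 assume nn: "s2 ''nn'' 0 = card (blocks (s1 ''lab''))" and a2: "agree (writes count_blocks) s1 s2"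
      have r2: "ready s2" by (rule ready_agree[OF r1 a2]) (simp add: count_blocks_def)
      have e2: "s2 ''lab'' = ?l" "s2 ''del'' = s ''del''" "s2 ''found'' = s ''found''"
        using e1 by (auto intro!: agreeD[OF a2, THEN trans] simp: count_blocks_def)
      have env2: "env s2" using r2 by (simp add: ready_def)
      have "expect ?test g s2 = expect (test_stars k) (expect ?pick g) s2"
        using nn e1 blocks2 by (simp add: expect_Cond expect_Seq)
      moreover have "ennreal (state_potential s) \<le> expect (test_stars k) (expect ?pick g) s2"
      proof (rule expect_ge_post[OF lossless[OF cost_bounded_parts(3) env2] post_test_stars[OF r2]])
        show "s2 ''found'' 0 = 0" using e2 found by simp
        fix s3 assume 3: "star_found (s2 ''lab'') s3 \<or> s3 ''found'' 0 = 0 \<and> all_violated (s2 ''lab'') \<and>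
            (\<forall>i<k. s3 ''cnt'' i = card (violators (s2 ''lab'') i))"
          and a3: "agree (writes (test_stars k)) s2 s3"
        have r3: "ready s3" by (rule ready_agree[OF r2 a3]) (simp add: test_stars_def test_star_def star_cost_def return_star_def)
        have env3: "env s3" using r3 by (simp add: ready_def)
        have e3: "s3 ''lab'' = ?l" "s3 ''del'' = s ''del''"  "s3 ''nn'' = s2 ''nn''"
          using e2 by (auto intro!: agreeD[OF a3, THEN trans] simp: test_stars_def test_star_def star_cost_def return_star_def)
        show "ennreal (state_potential s) \<le> expect ?pick g s3"
        proof (cases "star_found (s2 ''lab'') s3")
          case True
          then have "expect ?pick g s3 = g s3" by (simp add: expect_Cond expect_Skip star_found_def)
          moreover have "1 \<le> g s3"
            using True e2 star_found_solved[OF True] blocks2 env3 by (intro g1) (simp_all add: star_found_def)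
          moreover have "ennreal (state_potential s) \<le> 1"
            by (simp add: state_potential_def potential_le_1)
          ultimately show ?thesis by (metis order_trans)
        next
          case False
          then have found3: "s3 ''found'' 0 = 0" and viol: "all_violated ?l"
            "\<And>i. i < k \<Longrightarrow> s3 ''cnt'' i = card (violators ?l i)"
            using 3 e2 by auto
          have "expect ?pick g s3 = expect (find_large k) (expect ?choose (expect contract g)) s3"
            using found3 by (simp add: expect_Cond expect_Seq pick_def)
          moreover have "ennreal (state_potential s) \<le> \<dots>"
          proof (rule expect_ge_post[OF lossless[OF cost_bounded_parts(4) env3] post_find_large[OF r3]])
            fix s4 assume 4: "s4 ''big'' 0 = m \<and> (\<forall>e \<in> live s3. 3 * k * (card (trace (s3 ''lab'') e) - 1) < s3 ''nn'' 0 - 1) \<or>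
                s4 ''big'' 0 \<in> live s3 \<and> s3 ''nn'' 0 - 1 \<le> 3 * k * (card (trace (s3 ''lab'') (s4 ''big'' 0)) - 1)"
              and a4: "agree (writes (find_large k)) s3 s4"
            let ?s = "update s4 ''sel'' 0 m"
            have r4: "ready s4" by (rule ready_agree[OF r3 a4]) (simp add: find_large_def)
            have rs: "ready ?s" by (rule ready_update[OF r4]) simp
            have e4: "s4 ''lab'' = ?l" "s4 ''del'' = s ''del''" "s4 ''nn'' = s3 ''nn''" "s4 ''found'' = s3 ''found''" "s4 ''cnt'' = s3 ''cnt''"
              using e3 by (auto intro!: agreeD[OF a4, THEN trans] simp: find_large_def)
            have es: "?s ''lab'' = ?l" "?s ''del'' = s ''del''" "?s ''sel'' 0 = m" "?s ''big'' = s4 ''big''" "?s ''cnt'' = s3 ''cnt''"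
              "?s ''nn'' 0 = card (blocks ?l)" "?s ''found'' 0 = 0"
              using e4 e3 nn e1 found3 by (simp_all add: update_apply)
            have lives: "live ?s = live s" "live s3 = live s"
              using es e3 by (auto intro!: live_cong)
            have pots: "state_potential ?s = state_potential s" unfolding state_potential_def lives es ..
            have cons: "consistent U ?s" using s(2) unfolding consistent_def decided_def es by simp
            have "s4 ''m'' 0 = m" using r4 by (simp add: ready_def env_def)
            then have "expect ?choose (expect contract g) s4
                = (if s4 ''big'' 0 < m then expect guess (expect contract g) ?s else expect (sample k) (expect contract g) ?s)"
              by (simp add: expect_Seq expect_Store expect_Cond update_apply)
            moreover have "ennreal (state_potential s) \<le> \<dots>"
            proof (cases "s4 ''big'' 0 < m")
              case True
              then have "s4 ''big'' 0 \<in> live s" "card (blocks ?l) - 1 \<le> 3 * k * (card (trace ?l (s4 ''big'' 0)) - 1)"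
                using 4 lives e3 nn e1 by auto
              then have "ennreal (state_potential ?s) \<le> expect guess (expect contract g) ?s"
                using lives es g0 by (intro expect_guess[OF rs cons es(3) _ U(1,2) _ nm]) simp_all
              then show ?thesis using True pots by simp
            next
              case False
              then have "3 * k * (card (trace ?l e) - 1) < card (blocks ?l) - 1" if "e \<in> live s" for e
                using 4 lives e3 nn e1 that live_less[of "s4 ''big'' 0" s] by auto
              then have "ennreal (state_potential ?s) \<le> expect (sample k) (expect contract g) ?s"
                using lives es g0 viol by (intro expect_sample[OF rs cons es(3) _ U _ _ _ nm]) simp_all
              then show ?thesis using False pots by simp
            qed
            ultimately show "ennreal (state_potential s) \<le> expect ?choose (expect contract g) s4" by simp
          qed
          ultimately show ?thesis by simp
        qed
      qed
      ultimately show "ennreal (state_potential s) \<le> expect ?test g s2" by simp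
    qed
  qed
  then show ?thesis
    using found by (simp add: step_def expect_Cond expect_Seq[abs_def])
qed

end

section \<open>Trials\<close>

lemma cost_bounded_reset: "cost_bounded reset 1 1" "cost_bounded reset 1 2"
  unfolding One_nat_def numeral_2_eq_2 reset_def by (intro cost_bounded_intros; simp)+

lemma cost_bounded_trial: "cost_bounded (trial k) 1 2"
  unfolding trial_def
proof (intro cost_bounded_Seq cost_bounded_reset)
  show "cost_bounded (For ''t'' (Plus (V ''m'') (Const 1)) (step k)) 1 2"
    unfolding numeral_2_eq_2 using cost_bounded_step[of k] writes_step[of k]
    by (intro cost_bounded_For_Suc_m) (auto simp: work_def)
qed (simp_all add: reset_def)

text \<open>Made for amplification: with \<open>f\<close> the indicator of success, \<open>a\<close>
  is the chance left to later trials and \<open>b\<close> the part of the probability that only the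
  present trial can supply.\<close>

lemma expect_affine:
  assumes "lossless_spmf (exec p s)" "post p s (\<lambda>s'. a + b * f s' \<le> g s')" "q \<le> expect p f s"
  shows "a + b * q \<le> expect p g s"
proof -
  have "a + b * q \<le> a + b * expect p f s" using assms(3) by (intro add_left_mono mult_left_mono) auto
  also have "\<dots> = (\<integral>\<^sup>+ r. a + b * f (fst r) \<partial>measure_spmf (exec p s))"
    using assms(1) unfolding expect_def
    by (simp add: nn_integral_add nn_integral_cmult measure_spmf.emeasure_eq_measure lossless_spmf_def weight_spmf_def)
  also have "\<dots> \<le> expect p g s"
    unfolding expect_def using assms(2) by (intro nn_integral_mono_AE) (auto simp: post_def)
  finally show ?thesis .
qed

section \<open>Soundness and success probability of one trial\<close>

context costed_hypergraph
begin

definition sound :: "state \<Rightarrow> bool" where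
  "sound s \<longleftrightarrow> s ''found'' 0 = 0 \<or> solved s"

lemma post_step:
  assumes "env s" "labelling (s ''lab'')" "sound s"
  shows "post (step k) s (\<lambda>s'. labelling (s' ''lab'') \<and> sound s')"
proof (cases "s ''found'' 0 = 0")
  case False
  then show ?thesis using assms by (simp add: step_def)
next
  case found: True
  let ?pick = "If_then (Less (V ''found'') (Const 1)) (Seq (pick k) contract)"
  let ?test = "If_then (Less (Const 1) (V ''nn'')) (Seq (test_stars k) ?pick)"
  let ?Q = "\<lambda>s'. labelling (s' ''lab'') \<and> sound s'"
  have "post (Seq traces (Seq count_blocks ?test)) s ?Q"
  proof (rule post_SeqI[OF post_traces[OF assms(1,2)]])
    fix s1 assume r1: "ready s1" and a1: "agree (writes traces) s s1"
    have e1: "s1 ''found'' = s ''found''" by (rule agreeD[OF a1]) (simp add: traces_def trace_row_def)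
    have env1: "env s1" using r1 by (simp add: ready_def)
    show "post (Seq count_blocks ?test) s1 ?Q"
    proof (rule post_SeqI[OF post_count_blocks[OF env1]])
      fix s2 assume nn: "s2 ''nn'' 0 = card (blocks (s1 ''lab''))" and a2: "agree (writes count_blocks) s1 s2"
      have r2: "ready s2" by (rule ready_agree[OF r1 a2]) (simp add: count_blocks_def)
      have e2: "s2 ''found'' = s ''found''" "s2 ''lab'' = s1 ''lab''"
        using e1 by (auto intro!: agreeD[OF a2, THEN trans] simp: count_blocks_def)
      have l2: "labelling (s2 ''lab'')" using r2 by (simp add: ready_def)
      have "post (Seq (test_stars k) ?pick) s2 ?Q" if blocks2: "1 < card (blocks (s2 ''lab''))"
      proof (rule post_SeqI[OF post_test_stars[OF r2]])
        show "s2 ''found'' 0 = 0" using e2 found by simp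
        fix s3 assume 3: "star_found (s2 ''lab'') s3 \<or> s3 ''found'' 0 = 0 \<and> all_violated (s2 ''lab'') \<and>
            (\<forall>i<k. s3 ''cnt'' i = card (violators (s2 ''lab'') i))"
          and a3: "agree (writes (test_stars k)) s2 s3"
        have r3: "ready s3" by (rule ready_agree[OF r2 a3]) (simp add: test_stars_def test_star_def star_cost_def return_star_def)
        have l3: "labelling (s3 ''lab'')" using r3 by (simp add: ready_def)
        show "post ?pick s3 ?Q"
        proof (cases "star_found (s2 ''lab'') s3")
          case True
          then have "solved s3" using blocks2 by (rule star_found_solved)
          then show ?thesis using True l3 by (simp add: star_found_def sound_def)
        next
          case False
          then have found3: "s3 ''found'' 0 = 0" using 3 by blast
          have "post (Seq (pick k) contract) s3 ?Q"
          \<comment> \<open>Soundness needs nothing about the random choice: deletions leave the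
            labels alone, and contracting any crossing hyperedge gives a labelling.\<close>
          proof (rule post_SeqI[where P = "\<lambda>_. True"])
            fix s4 assume a4: "agree (writes (pick k)) s3 s4"
            have r4: "ready s4" by (rule ready_agree[OF r3 a4]) (simp add: step_defs)
            have e4: "s4 ''found'' = s3 ''found''" "s4 ''lab'' = s3 ''lab''"
              by (auto intro!: agreeD[OF a4] simp: step_defs)
            show "post contract s4 ?Q"
            proof (cases "s4 ''sel'' 0 < m \<and> 1 < s4 ''sz'' (s4 ''sel'' 0)")
              case True
              then have *: "s4 ''sel'' 0 \<in> crossing (s4 ''lab'')"
                using r4 unfolding ready_def recorded_def crossing_def by auto
              show ?thesis
              proof (rule post_weaken[OF post_contract[OF r4 refl *]])
                fix s5 assume con: "contracts (s4 ''lab'') (s4 ''sel'' 0) (s5 ''lab'')" and a5: "agree (writes contract) s4 s5"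
                have "labelling (s5 ''lab'')" using contracts_labelling[OF _ con] True l3 e4 by simp
                moreover have "s5 ''found'' = s4 ''found''" by (rule agreeD[OF a5]) (simp add: contract_def)
                ultimately show "?Q s5" using e4 found3 by (simp add: sound_def)
              qed
            next
              case False
              moreover have "s4 ''m'' 0 = m" using r4 by (simp add: ready_def env_def)
              ultimately show ?thesis using e4 found3 l3 by (auto simp: contract_def sound_def)
            qed
          qed (simp add: post_def)
          then show ?thesis using found3 by simp
        qed
      qed
      then show "post ?test s2 ?Q" using nn e2 l2 found by (simp add: sound_def)
    qed
  qed
  then show ?thesis using found by (simp add: step_def)
qed

lemma env_agree_work: "env s \<Longrightarrow> agree W s s' \<Longrightarrow> W \<subseteq> work \<Longrightarrow> env s'"
  by (erule env_agree) (auto simp: work_def)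

definition fresh :: "state \<Rightarrow> bool" where
  "fresh s \<longleftrightarrow> (\<forall>v<n. s ''lab'' v = v) \<and> decided s = {}"

lemma fresh_labelling: "fresh s \<Longrightarrow> labelling (s ''lab'')"
  by (simp add: fresh_def labelling_def)

lemma post_reset:
  assumes "env s"
  shows "post reset s fresh"
  unfolding reset_def
proof (rule post_SeqI[where P = "\<lambda>s'. \<forall>v<n. s' ''lab'' v = v"])
  let ?p = "Store ''lab'' (V ''v'') (V ''v'')" and ?q = "Store ''del'' (V ''e'') (Const 0)"
  show "post (For ''v'' (V ''n'') ?p) s (\<lambda>s'. \<forall>v<n. s' ''lab'' v = v)"
  proof (rule post_For[where I = "\<lambda>j s'. \<forall>v<j. s' ''lab'' v = v" and B = n])
    fix s' assume *: "agree (insert ''v'' (writes ?p)) s s'"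
    show "aval (V ''n'') s' = n" using agreeD[OF *, of "''n''"] assms by (simp add: env_def)
  qed (auto simp: update_apply less_Suc_eq)
  fix s1 assume a1: "agree (writes (For ''v'' (V ''n'') ?p)) s s1" and 1: "\<forall>v<n. s1 ''lab'' v = v"
  have env1: "env s1" by (rule env_agree[OF assms a1]) simp
  show "post (For ''e'' (V ''m'') ?q) s1 fresh"
  proof (rule post_For[where I = "\<lambda>j s'. \<forall>e<j. s' ''del'' e = 0" and B = m])
    fix s' assume *: "agree (insert ''e'' (writes ?q)) s1 s'"
    show "aval (V ''m'') s' = m" using agreeD[OF *, of "''m''"] env1 by (simp add: env_def)
    show "\<forall>e<m. s' ''del'' e = 0 \<Longrightarrow> fresh s'"
      using agreeD[OF *, of "''lab''"] 1 by (simp add: fresh_def decided_def)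
  qed (auto simp: update_apply less_Suc_eq)
qed

lemma writes_reset: "writes reset = {''v'', ''lab'', ''e'', ''del''}"
  by (auto simp: reset_def)

text \<open>A reset keeps an answer found earlier, so the remaining trials run idle and cannot lose
  it.\<close>

lemma reset_facts:
  assumes "env s" "agree (writes reset) s s'"
  shows "env s'" "s' ''found'' = s ''found''" "s' ''out'' = s ''out''"
  using env_agree[OF assms] agreeD[OF assms(2), of "''found''"] agreeD[OF assms(2), of "''out''"]
  by (simp_all add: writes_reset)

lemma insert_t_writes_step: "insert ''t'' (writes (step k)) \<subseteq> work"
proof -
  have "''t'' \<in> work" by (simp add: work_def)
  then show ?thesis using writes_step[of k] by blast
qed

lemma t_writes_step: "''t'' \<notin> writes (step k)"
  using writes_step[of k] by blast

lemma post_trial: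
  assumes env: "env s" and "sound s"
  shows "post (trial k) s (\<lambda>s'. env s' \<and> sound s' \<and> (s ''found'' 0 \<noteq> 0 \<longrightarrow> s' ''found'' 0 \<noteq> 0))"
  unfolding trial_def
proof (rule post_SeqI[OF post_reset[OF env]])
  fix s1 assume a1: "agree (writes reset) s s1" and 1: "fresh s1"
  note f1 = reset_facts[OF env a1]
  let ?K = "\<lambda>s'. s ''found'' 0 \<noteq> 0 \<longrightarrow> s' ''found'' 0 \<noteq> 0"
  let ?I = "\<lambda>j s'. (labelling (s' ''lab'') \<and> sound s') \<and> ?K s'"
  show "post (For ''t'' (Plus (V ''m'') (Const 1)) (step k)) s1 (\<lambda>s'. env s' \<and> sound s' \<and> (s ''found'' 0 \<noteq> 0 \<longrightarrow> s' ''found'' 0 \<noteq> 0))"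
  proof (rule post_For[where I = ?I and B = "m + 1"])
    show "''t'' \<notin> writes (step k)" by (rule t_writes_step)
    show "?I 0 (update s1 ''t'' 0 0)"
      using fresh_labelling[OF 1] f1 assms(2) by (simp add: update_apply sound_def solved_def)
    fix s' assume *: "agree (insert ''t'' (writes (step k))) s1 s'"
    have env': "env s'" by (rule env_agree_work[OF f1(1) * insert_t_writes_step])
    show "aval (Plus (V ''m'') (Const 1)) s' = m + 1" using env' by (simp add: env_def)
    show "?I (m + 1) s' \<Longrightarrow> env s' \<and> sound s' \<and> ?K s'" using env' by simp
    fix j assume I: "?I j s'"
    have "post (step k) s' (\<lambda>s'. labelling (s' ''lab'') \<and> sound s')" using env' I by (intro post_step) auto
    moreover have "post (step k) s' ?K"
      using I by (cases "s' ''found'' 0 = 0") (simp_all add: step_def post_def)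
    ultimately have "post (step k) s' (\<lambda>s'. (labelling (s' ''lab'') \<and> sound s') \<and> ?K s')"
      unfolding post_def by blast
    then show "post (step k) s' (\<lambda>s''. ?I (Suc j) (update s'' ''t'' 0 (Suc j)))"
      by (rule post_weaken) (simp add: update_apply sound_def solved_def)
  qed
qed

definition win :: "state \<Rightarrow> ennreal" where
  "win s = (if s ''found'' 0 \<noteq> 0 \<and> solved s then 1 else 0)"

lemma expect_trial:
  assumes env: "env s" and found: "s ''found'' 0 = 0"
    and U: "U \<noteq> {}" "U \<subset> {..<n}" "\<And>i. i < k \<Longrightarrow> sum (c i) (cut U) \<le> b i"
    and nm: "1 \<le> n" "1 \<le> m"
  shows "ennreal (potential k m m (n - 1)) \<le> expect (trial k) win s"
  unfolding trial_def expect_Seq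
proof (rule expect_ge_post[OF _ post_reset[OF env]])
  show "lossless_spmf (exec reset s)"
    using env nm by (intro cost_bounded_lossless[OF cost_bounded_reset(1)]) (simp_all add: env_def)
  fix s1 assume a1: "agree (writes reset) s s1" and 1: "fresh s1"
  note f1 = reset_facts[OF env a1]
  \<comment> \<open>The counter limits the undecided hyperedges, so after \<open>m + 1\<close>
    rounds the second alternative is impossible and the run has won.\<close>
  define G where "G j s p \<longleftrightarrow> env s \<and> (s ''found'' 0 \<noteq> 0 \<and> solved s \<and> p \<le> 1 \<or>
    consistent U s \<and> card (live s) + j \<le> m \<and> p \<le> ennreal (state_potential s))" for j :: nat and s and p :: ennreal
  have G_update: "G j (update s ''t'' 0 i) p \<longleftrightarrow> G j s p" for j s i p
  proof -
    let ?s = "update s ''t'' 0 i"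
    have "?s x = s x" if "x \<noteq> ''t''" for x using that by (simp add: update_apply)
    then show ?thesis
      unfolding G_def env_def solved_def consistent_def live_def decided_def state_potential_def by simp
  qed
  show "ennreal (potential k m m (n - 1)) \<le> expect (For ''t'' (Plus (V ''m'') (Const 1)) (step k)) win s1"
  proof (rule expect_For_ge[where G = G and B = "m + 1"])
    show "''t'' \<notin> writes (step k)" by (rule t_writes_step)
    show "G 0 (update s1 ''t'' 0 0) (ennreal (potential k m m (n - 1)))"
    proof -
      have id: "s1 ''lab'' v = v" if "v < n" for v using 1 that by (simp add: fresh_def)
      have "blocks (s1 ''lab'') = {..<n}" using id by (auto simp: blocks_def)
      moreover have "card (live s1) \<le> m"
        using card_mono[of "{..<m}" "live s1"] live_less by auto
      moreover have "saturated (s1 ''lab'') U" using id by (simp add: saturated_def)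
      then have "consistent U s1"
        using 1 found f1 fresh_labelling[OF 1] by (simp add: consistent_def fresh_def)
      ultimately show ?thesis
        unfolding G_update unfolding G_def using f1(1)
        by (auto simp: state_potential_def intro!: ennreal_leI potential_antimono)
    qed
    fix s' assume *: "agree (insert ''t'' (writes (step k))) s1 s'"
    have env': "env s'" by (rule env_agree_work[OF f1(1) * insert_t_writes_step])
    show "aval (Plus (V ''m'') (Const 1)) s' = m + 1" using env' by (simp add: env_def)
    show "G (m + 1) s' p \<Longrightarrow> p \<le> win s'" for p by (auto simp: G_def win_def)
    fix j p g assume j: "j < m + 1" and G: "G j s' p"
      and g: "\<And>s'' p'. G (Suc j) (update s'' ''t'' 0 (Suc j)) p' \<Longrightarrow> p' \<le> g s''"
    show "p \<le> expect (step k) g s'"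
    proof (cases "s' ''found'' 0 = 0")
      case False
      then have "expect (step k) g s' = g s'" by (simp add: step_def expect_Cond expect_Skip)
      moreover have "G (Suc j) s' p" using G False by (auto simp: G_def consistent_def)
      ultimately show ?thesis using g[of s' p] by (simp add: G_update)
    next
      case True
      then have s': "consistent U s'" "card (live s') + j \<le> m" "p \<le> ennreal (state_potential s')"
        using G by (auto simp: G_def)
      have "ennreal (state_potential s') \<le> expect (step k) g s'"
      proof (rule expect_step[OF env' s'(1) U nm])
        show "1 \<le> g s''" if "env s''" "s'' ''found'' 0 = 1" "solved s''" for s''
          using that by (intro g, unfold G_update) (simp add: G_def)
        show "ennreal (state_potential s'') \<le> g s''" if "env s''" "consistent U s''" "card (live s'') < card (live s')" for s''
          using that s'(2) by (intro g, unfold G_update) (simp add: G_def)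
      qed
      then show ?thesis using s'(3) by (rule order_trans[rotated])
    qed
  qed
qed

end

section \<open>The algorithm\<close>

definition offsets :: "string \<Rightarrow> string \<Rightarrow> aexp \<Rightarrow> aexp \<Rightarrow> com" where
  "offsets A x a d = Seq (assign ''y'' (Const 0))
     (For x a (Seq (Store A (V x) (V ''y'')) (assign ''y'' (Plus (V ''y'') d))))"

text \<open>Repeated addition takes time linear in the value of \<open>a\<close>, so
  \<open>a\<close> is always \<open>n\<close> or \<open>m + 1\<close> and never the accumulated
  product.\<close>

definition multiply :: "string \<Rightarrow> aexp \<Rightarrow> com" where
  "multiply x a = Seq (assign ''y'' (Const 0)) (Seq (For x a (assign ''y'' (Plus (V ''y'') (V ''R''))))
     (assign ''R'' (V ''y'')))"

text \<open>Division by search: the last \<open>v\<close> that passes the test is the next argument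
  in the recursion of \<open>depth\<close>.\<close>

definition shrink :: "nat \<Rightarrow> com" where
  "shrink k = Seq (assign ''z'' (Const 0))
     (Seq (For ''v'' (V ''n'') (If_then (at_most (scale (3 * k) (V ''v'')) (scale (3 * k - 1) (V ''h'')))
        (assign ''z'' (V ''v''))))
     (assign ''h'' (V ''z'')))"

text \<open>Each active pass of the last loop follows one unfolding of \<open>depth (3 * k)\<close>
  and contributes a factor \<open>m + 1\<close>. \<open>n\<close> passes suffice, as
  \<open>h\<close> starts at \<open>n - 1\<close> and decreases while it exceeds 1.\<close>

definition repetitions :: "nat \<Rightarrow> com" where
  "repetitions k = Seq (assign ''R'' (Const 6))
     (Seq (For ''i'' (Const k) (multiply ''v'' (V ''n'')))
     (Seq (assign ''h'' (Minus (V ''n'') (Const 1)))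
          (For ''u'' (V ''n'') (If_then (Less (Const 1) (V ''h''))
            (Seq (multiply ''e'' (Plus (V ''m'') (Const 1))) (shrink k))))))"

definition prepare :: "nat \<Rightarrow> com" where
  "prepare k = Seq (offsets ''row'' ''e'' (V ''m'') (V ''n''))
     (Seq (offsets ''crow'' ''i'' (Const k) (V ''m'')) (repetitions k))"

abbreviation main_loop :: "nat \<Rightarrow> com" where
  "main_loop k \<equiv> For ''q'' (V ''R'') (trial k)"

text \<open>A single vertex admits no cut. With two or more vertices but no hyperedge the empty set
  is a cut of cost 0, and any content of \<open>out\<close> is read as the empty set. The cost
  bounds hold only beyond these cases.\<close>

definition algorithm :: "nat \<Rightarrow> com" where
  "algorithm k = Cond (Less (V ''n'') (Const 2)) Skip (Cond (Less (V ''m'') (Const 1)) (assign ''found'' (Const 1))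
     (Seq (prepare k) (main_loop k)))"

lemmas prepare_defs = offsets_def multiply_def shrink_def repetitions_def prepare_def

lemma cost_bounded_prepare: "cost_bounded (prepare k) 2 1"
proof -
  have "cost_bounded (prepare k) (Suc (Suc 0)) (Suc 0)"
    unfolding prepare_defs by (intro cost_bounded_intros) simp_all
  then show ?thesis by (simp add: numeral_2_eq_2)
qed

section \<open>Specification of the preparation\<close>

lemma post_offsets:
  assumes "\<And>s'. agree {A, x, ''y''} s s' \<Longrightarrow> aval a s' = B \<and> aval d s' = D" "distinct [A, x, ''y'']"
  shows "post (offsets A x a d) s (\<lambda>s'. \<forall>j<B. s' A j = j * D)"
proof -
  let ?p = "Seq (Store A (V x) (V ''y'')) (assign ''y'' (Plus (V ''y'') d))" and ?s = "update s ''y'' 0 0"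
  have "post (For x a ?p) ?s (\<lambda>s'. \<forall>j<B. s' A j = j * D)"
  proof (rule post_For[where I = "\<lambda>j s'. s' ''y'' 0 = j * D \<and> (\<forall>i<j. s' A i = i * D)" and B = B])
    fix s' assume *: "agree (insert x (writes ?p)) ?s s'"
    then have ag: "agree {A, x, ''y''} s s'" by (auto simp: agree_def update_apply)
    then show "aval a s' = B" using assms(1) by blast
    have "aval d (update s' A i u) = D" for i u using assms(1)[of "update s' A i u"] ag by (simp add: agree_update)
    moreover fix j assume "s' x 0 = j" "s' ''y'' 0 = j * D \<and> (\<forall>i<j. s' A i = i * D)"
    ultimately show "post ?p s' (\<lambda>s''. update s'' x 0 (Suc j) ''y'' 0 = Suc j * D \<and>
        (\<forall>i<Suc j. update s'' x 0 (Suc j) A i = i * D))"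
      using assms(2) by (auto simp: update_apply less_Suc_eq)
  qed (use assms(2) in \<open>auto simp: update_apply\<close>)
  then show ?thesis by (simp add: offsets_def)
qed

lemma post_multiply:
  assumes a: "\<And>s'. agree (insert x {''y'', ''R''}) s s' \<Longrightarrow> aval a s' = B" and x: "x \<noteq> ''y''" "x \<noteq> ''R''"
  shows "post (multiply x a) s (\<lambda>s'. s' ''R'' 0 = s ''R'' 0 * B)"
proof -
  let ?p = "assign ''y'' (Plus (V ''y'') (V ''R''))" and ?s = "update s ''y'' 0 0"
  have "post (For x a ?p) ?s (\<lambda>s'. s' ''y'' 0 = s ''R'' 0 * B)"
  proof (rule post_For[where I = "\<lambda>j s'. s' ''y'' 0 = s ''R'' 0 * j" and B = B])
    fix s' assume *: "agree (insert x (writes ?p)) ?s s'"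
    then have "agree (insert x {''y'', ''R''}) s s'" by (auto simp: agree_def update_apply)
    then show "aval a s' = B" by (rule a)
    fix j assume "s' x 0 = j" "s' ''y'' 0 = s ''R'' 0 * j"
    moreover have "s' ''R'' = s ''R''" using agreeD[OF *, of "''R''"] x by (simp add: update_apply)
    ultimately show "post ?p s' (\<lambda>s''. update s'' x 0 (Suc j) ''y'' 0 = s ''R'' 0 * Suc j)"
      using x by (simp add: update_apply)
  qed (use x in \<open>simp_all add: update_apply\<close>)
  then show ?thesis
    unfolding multiply_def by (simp add: update_apply)
qed

context costed_hypergraph
begin

definition input :: "state \<Rightarrow> bool" where
  "input s \<longleftrightarrow> s ''n'' 0 = n \<and> s ''m'' 0 = m \<and> s ''found'' 0 = 0 \<and>
     (\<forall>e<m. \<forall>v<n. 0 < s ''inc'' (e * n + v) \<longleftrightarrow> v \<in> E e) \<and>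
     (\<forall>i<k. \<forall>e<m. s ''cost'' (i * m + e) = c i e) \<and> (\<forall>i<k. s ''budget'' i = b i)"

lemma input_agree:
  assumes "input s" "agree W s s'" "{''n'', ''m'', ''found'', ''inc'', ''cost'', ''budget''} \<inter> W = {}"
  shows "input s'"
proof -
  have "s' x = s x" if "x \<in> {''n'', ''m'', ''found'', ''inc'', ''cost'', ''budget''}" for x
    using assms(2,3) that by (intro agreeD[OF assms(2)]) blast
  then show ?thesis using assms(1) unfolding input_def by simp
qed

lemma post_shrink:
  assumes "s ''n'' 0 = n" "1 < s ''h'' 0" "s ''h'' 0 < n"
  shows "post (shrink k) s (\<lambda>s'. s' ''h'' 0 = (3 * k - 1) * s ''h'' 0 div (3 * k))"
proof -
  let ?p = "If_then (at_most (scale (3 * k) (V ''v'')) (scale (3 * k - 1) (V ''h''))) (assign ''z'' (V ''v''))"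
  let ?s = "update s ''z'' 0 0" and ?D = "(3 * k - 1) * s ''h'' 0 div (3 * k)"
  have le_D: "j * (3 * k) \<le> (3 * k - 1) * s ''h'' 0 \<longleftrightarrow> j \<le> ?D" for j
    using k by (simp add: less_eq_div_iff_mult_less_eq)
  have "(3 * k - 1) * s ''h'' 0 < s ''h'' 0 * (3 * k)" using k assms(2) by (simp add: mult.commute)
  then have "?D < s ''h'' 0" by (rule less_mult_imp_div_less)
  then have D: "?D \<le> n - 1" using assms(3) by linarith
  have "post (For ''v'' (V ''n'') ?p) ?s (\<lambda>s'. s' ''z'' 0 = ?D)"
  \<comment> \<open>The largest candidate below \<open>j\<close> that passes the test; truncated
    subtraction gives the initial 0 for \<open>j = 0\<close>.\<close>
  proof (rule post_For[where I = "\<lambda>j s'. s' ''z'' 0 = min (j - 1) ?D" and B = n])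
    fix s' assume *: "agree (insert ''v'' (writes ?p)) ?s s'"
    have e: "s' ''n'' = s ''n''" "s' ''h'' = s ''h''"
      using agreeD[OF *, of "''n''"] agreeD[OF *, of "''h''"] by (simp_all add: update_apply)
    show "aval (V ''n'') s' = n" using e assms(1) by simp
    show "s' ''z'' 0 = min (n - 1) ?D \<Longrightarrow> s' ''z'' 0 = ?D" using D by simp
    fix j assume j: "s' ''v'' 0 = j" "s' ''z'' 0 = min (j - 1) ?D"
    have "bval (at_most (scale (3 * k) (V ''v'')) (scale (3 * k - 1) (V ''h''))) s' \<longleftrightarrow> j \<le> ?D"
      using le_D[of j] j e by (simp add: not_less mult.commute)
    then show "post ?p s' (\<lambda>s''. update s'' ''v'' 0 (Suc j) ''z'' 0 = min (Suc j - 1) ?D)"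
      using j by (simp add: update_apply del: bval.simps)
  qed (simp_all add: update_apply)
  then show ?thesis by (simp add: shrink_def update_apply)
qed

lemma post_repetitions:
  assumes "s ''n'' 0 = n" "s ''m'' 0 = m" "1 \<le> n"
  shows "post (repetitions k) s (\<lambda>s'. s' ''R'' 0 = 6 * n ^ k * (m + 1) ^ depth (3 * k) (n - 1))"
proof -
  let ?p = "multiply ''v'' (V ''n'')"
  let ?q = "If_then (Less (Const 1) (V ''h'')) (Seq (multiply ''e'' (Plus (V ''m'') (Const 1))) (shrink k))"
  let ?s = "update s ''R'' 0 6" and ?d = "depth (3 * k)"
  have "post (Seq (For ''i'' (Const k) ?p) (Seq (assign ''h'' (Minus (V ''n'') (Const 1))) (For ''u'' (V ''n'') ?q))) ?s
     (\<lambda>s'. s' ''R'' 0 = 6 * n ^ k * (m + 1) ^ ?d (n - 1))"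
  proof (rule post_SeqI[where P = "\<lambda>s'. s' ''R'' 0 = 6 * n ^ k"])
    show "post (For ''i'' (Const k) ?p) ?s (\<lambda>s'. s' ''R'' 0 = 6 * n ^ k)"
    proof (rule post_For[where I = "\<lambda>j s'. s' ''R'' 0 = 6 * n ^ j" and B = k])
      fix j s' assume *: "agree (insert ''i'' (writes ?p)) ?s s'" "s' ''R'' 0 = 6 * n ^ j"
      have "s' ''n'' 0 = n" using agreeD[OF *(1), of "''n''"] assms by (simp add: multiply_def update_apply)
      then have "post ?p s' (\<lambda>s''. s'' ''R'' 0 = s' ''R'' 0 * n)"
        by (intro post_multiply) (auto simp: agree_def)
      then show "post ?p s' (\<lambda>s''. update s'' ''i'' 0 (Suc j) ''R'' 0 = 6 * n ^ Suc j)"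
        by (rule post_weaken) (simp add: *(2) update_apply)
    qed (simp_all add: update_apply multiply_def)
  next
    fix s1 assume a1: "agree (writes (For ''i'' (Const k) ?p)) ?s s1" and 1: "s1 ''R'' 0 = 6 * n ^ k"
    have e1: "s1 ''n'' 0 = n" "s1 ''m'' 0 = m"
      using agreeD[OF a1, of "''n''"] agreeD[OF a1, of "''m''"] assms by (simp_all add: multiply_def update_apply)
    let ?s1 = "update s1 ''h'' 0 (n - 1)"
    \<comment> \<open>The product is constant while factors move from the power into
      \<open>R\<close>. The last conjunct forces \<open>h <= 1\<close> after \<open>n\<close>
      rounds.\<close>
    let ?I = "\<lambda>j s'. s' ''R'' 0 * (m + 1) ^ ?d (s' ''h'' 0) = 6 * n ^ k * (m + 1) ^ ?d (n - 1) \<and> s' ''h'' 0 < n \<and>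
      (s' ''h'' 0 \<le> 1 \<or> s' ''h'' 0 + j \<le> n - 1)"
    have "post (For ''u'' (V ''n'') ?q) ?s1 (\<lambda>s'. s' ''R'' 0 = 6 * n ^ k * (m + 1) ^ ?d (n - 1))"
    proof (rule post_For[where I = ?I and B = n])
      show "''u'' \<notin> writes ?q" by (simp add: multiply_def shrink_def)
      show "?I 0 (update ?s1 ''u'' 0 0)" using 1 assms(3) by (simp add: update_apply)
      fix s' assume *: "agree (insert ''u'' (writes ?q)) ?s1 s'"
      have e: "s' ''n'' 0 = n" "s' ''m'' 0 = m"
        using agreeD[OF *, of "''n''"] agreeD[OF *, of "''m''"] e1 by (simp_all add: multiply_def shrink_def update_apply)
      show "aval (V ''n'') s' = n" using e by simp
      show "?I n s' \<Longrightarrow> s' ''R'' 0 = 6 * n ^ k * (m + 1) ^ ?d (n - 1)"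
      proof -
        assume I: "?I n s'"
        then have "s' ''h'' 0 \<le> 1" using assms(3) by linarith
        then have "?d (s' ''h'' 0) = 0" by (simp add: depth.simps[of _ "s' ''h'' 0"])
        then show ?thesis using I by simp
      qed
      fix j assume j: "j < n" "s' ''u'' 0 = j" and I: "?I j s'"
      let ?Q = "\<lambda>s''. ?I (Suc j) (update s'' ''u'' 0 (Suc j))"
      show "post ?q s' ?Q"
      proof (cases "1 < s' ''h'' 0")
        case False
        then have "s' ''h'' 0 \<le> 1" by simp
        then show ?thesis using False I by (simp add: update_apply)
      next
        case True
        have "post (Seq (multiply ''e'' (Plus (V ''m'') (Const 1))) (shrink k)) s' ?Q"
        proof (rule post_SeqI[where P = "\<lambda>s''. s'' ''R'' 0 = s' ''R'' 0 * (m + 1)"])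
          show "post (multiply ''e'' (Plus (V ''m'') (Const 1))) s' (\<lambda>s''. s'' ''R'' 0 = s' ''R'' 0 * (m + 1))"
            using e by (intro post_multiply) (auto simp: agree_def)
          fix s2 assume a2: "agree (writes (multiply ''e'' (Plus (V ''m'') (Const 1)))) s' s2"
            and 2: "s2 ''R'' 0 = s' ''R'' 0 * (m + 1)"
          have e2: "s2 ''n'' = s' ''n''" "s2 ''h'' = s' ''h''" by (auto intro!: agreeD[OF a2] simp: multiply_def)
          show "post (shrink k) s2 ?Q"
          proof (rule post_weaken[OF post_shrink])
            fix s3 assume a3: "agree (writes (shrink k)) s2 s3"
              and h: "s3 ''h'' 0 = (3 * k - 1) * s2 ''h'' 0 div (3 * k)"
            have R: "s3 ''R'' = s2 ''R''" by (rule agreeD[OF a3]) (simp add: shrink_def)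
            have h': "s3 ''h'' 0 = (3 * k - 1) * s' ''h'' 0 div (3 * k)" using h e2 by simp
            have d: "?d (s' ''h'' 0) = Suc (?d (s3 ''h'' 0))"
              using True k by (subst depth.simps) (simp add: h')
            have "(3 * k - 1) * s' ''h'' 0 < s' ''h'' 0 * (3 * k)" using k True by (simp add: mult.commute)
            then have "s3 ''h'' 0 < s' ''h'' 0" unfolding h' by (rule less_mult_imp_div_less)
            moreover have "s3 ''R'' 0 * (m + 1) ^ ?d (s3 ''h'' 0) = s' ''R'' 0 * (m + 1) ^ ?d (s' ''h'' 0)"
              unfolding R 2 d by (simp only: power_Suc mult.assoc)
            ultimately have "?I (Suc j) s3" using I True by (simp only:) linarith
            then show "?Q s3" by (simp add: update_apply)
          qed (use e e2 True I in simp_all)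
        qed
        then show ?thesis using True by simp
      qed
    qed
    then show "post (Seq (assign ''h'' (Minus (V ''n'') (Const 1))) (For ''u'' (V ''n'') ?q)) s1
      (\<lambda>s'. s' ''R'' 0 = 6 * n ^ k * (m + 1) ^ ?d (n - 1))"
      using e1 by simp
  qed
  then show ?thesis by (simp add: repetitions_def)
qed

definition rounds :: nat where
  "rounds = 6 * n ^ k * (m + 1) ^ depth (3 * k) (n - 1)"

lemma post_prepare:
  assumes "input s" "1 \<le> n"
  shows "post (prepare k) s (\<lambda>s'. env s' \<and> s' ''found'' 0 = 0 \<and> s' ''R'' 0 = rounds)"
  unfolding prepare_def
proof (rule post_SeqI[OF post_offsets[where B = m and D = n]])
  let ?r = "offsets ''row'' ''e'' (V ''m'') (V ''n'')" and ?c = "offsets ''crow'' ''i'' (Const k) (V ''m'')"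
  show "aval (V ''m'') s' = m \<and> aval (V ''n'') s' = n" if "agree {''row'', ''e'', ''y''} s s'" for s'
    using input_agree[OF assms(1) that] by (simp add: input_def)
  fix s1 assume a1: "agree (writes ?r) s s1" and 1: "\<forall>e<m. s1 ''row'' e = e * n"
  have i1: "input s1" by (rule input_agree[OF assms(1) a1]) (simp add: offsets_def)
  show "post (Seq ?c (repetitions k)) s1 (\<lambda>s'. env s' \<and> s' ''found'' 0 = 0 \<and> s' ''R'' 0 = rounds)"
  proof (rule post_SeqI[OF post_offsets[where B = k and D = m]])
    show "aval (Const k) s' = k \<and> aval (V ''m'') s' = m" if "agree {''crow'', ''i'', ''y''} s1 s'" for s'
      using input_agree[OF i1 that] by (simp add: input_def)
    fix s2 assume a2: "agree (writes ?c) s1 s2" and 2: "\<forall>i<k. s2 ''crow'' i = i * m"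
    have i2: "input s2" by (rule input_agree[OF i1 a2]) (simp add: offsets_def)
    have row2: "s2 ''row'' = s1 ''row''" by (rule agreeD[OF a2]) (simp add: offsets_def)
    show "post (repetitions k) s2 (\<lambda>s'. env s' \<and> s' ''found'' 0 = 0 \<and> s' ''R'' 0 = rounds)"
    proof (rule post_weaken[OF post_repetitions])
      fix s3 assume a3: "agree (writes (repetitions k)) s2 s3"
        and R: "s3 ''R'' 0 = 6 * n ^ k * (m + 1) ^ depth (3 * k) (n - 1)"
      have i3: "input s3" by (rule input_agree[OF i2 a3]) (simp add: repetitions_def multiply_def shrink_def)
      have "s3 ''row'' = s2 ''row''" "s3 ''crow'' = s2 ''crow''"
        by (auto intro!: agreeD[OF a3] simp: repetitions_def multiply_def shrink_def)
      then show "env s3 \<and> s3 ''found'' 0 = 0 \<and> s3 ''R'' 0 = rounds"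
        using i3 1 2 row2 R by (simp add: env_def input_def rounds_def)
    qed (use i2 assms(2) in \<open>simp_all add: input_def\<close>)
  qed simp
qed simp

end

section \<open>Running time and success probability\<close>

lemma expected_time_le:
  assumes "runs_within s p T" "real T \<le> x"
  shows "expected_time p s \<le> ennreal x"
proof -
  have l: "lossless_spmf (exec p s)" by (rule runs_within_lossless[OF assms(1)])
  have "(\<integral>\<^sup>+ r. ennreal (real (snd r)) \<partial>measure_spmf (exec p s)) \<le> (\<integral>\<^sup>+ r. ennreal x \<partial>measure_spmf (exec p s))"
    using runs_withinD[OF assms(1)] assms(2) by (intro nn_integral_mono_AE) (fastforce intro!: ennreal_leI)
  also have "\<dots> = ennreal x"
    using l by (simp add: measure_spmf.emeasure_eq_measure lossless_spmf_def weight_spmf_def)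
  finally show ?thesis using l by (simp add: expected_time_def)
qed

text \<open>The reciprocal of \<open>(1 + 1 / m)^m <= e <= 3\<close>: getting up to \<open>m\<close>
  deletions right costs only a constant factor.\<close>

lemma one_third_le_power: "1 / 3 \<le> (real m / (real m + 1)) ^ m"
proof (cases "m = 0")
  case False
  have "(1 + 1 / real m) ^ m \<le> exp (1 / real m) ^ m"
    using exp_ge_add_one_self[of "1 / real m"] by (intro power_mono) auto
  also have "\<dots> = exp 1" using False by (simp add: exp_of_nat_mult[symmetric])
  also have "\<dots> \<le> 3" by (rule exp_le)
  finally have "1 / 3 \<le> 1 / (1 + 1 / real m) ^ m"
    by (intro divide_left_mono) (auto intro!: mult_pos_pos zero_less_power add_pos_nonneg)
  also have "\<dots> = (1 / (1 + 1 / real m)) ^ m" by (simp add: power_one_over)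
  also have "1 / (1 + 1 / real m) = real m / (real m + 1)" using False by (simp add: field_simps)
  finally show ?thesis .
qed simp

lemma potential_initial:
  assumes "1 \<le> n"
  shows "1 / (3 * (real m + 1) ^ depth (3 * k) (n - 1) * real n ^ (3 * k)) \<le> potential k m m (n - 1)"
proof -
  have "1 / real n ^ (3 * k) \<le> decay k (n - 1)"
    unfolding decay_def using assms by (intro divide_left_mono power_mono mult_pos_pos zero_less_power) auto
  then have "1 / 3 * (1 / (real m + 1)) ^ depth (3 * k) (n - 1) * (1 / real n ^ (3 * k)) \<le> potential k m m (n - 1)"
    unfolding potential_def using one_third_le_power[of m] by (intro mult_mono) auto
  then show ?thesis by (simp add: power_one_over)
qed

text \<open>Bernoulli's inequality \<open>1 + r q <= (1 + q)^r\<close> gives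
  \<open>(1 - q)^r (1 + r q) <= (1 - q^2)^r <= 1\<close>.\<close>

lemma amplification:
  fixes q :: real
  assumes "0 \<le> q" "q \<le> 1"
  shows "real r * q / (1 + real r * q) \<le> 1 - (1 - q) ^ r"
proof -
  have "(1 - q) ^ r * (1 + real r * q) \<le> (1 - q) ^ r * (1 + q) ^ r"
    using assms by (intro mult_left_mono Bernoulli_inequality) auto
  also have "\<dots> = (1 - q\<^sup>2) ^ r" by (simp add: power_mult_distrib[symmetric] power2_eq_square algebra_simps)
  also have "\<dots> \<le> 1" using assms by (intro power_le_one) (auto simp: power_le_one)
  finally have "(1 - q) ^ r \<le> 1 / (1 + real r * q)"
    using assms by (simp add: pos_le_divide_eq add_pos_nonneg)
  moreover have "real r * q / (1 + real r * q) = 1 - 1 / (1 + real r * q)"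
    using assms by (simp add: field_simps add_pos_nonneg add_nonneg_eq_0_iff)
  ultimately show ?thesis by linarith
qed

text \<open>With the rational bound \<open>ln 2 <= 25 / 36\<close>, the factor 3 becomes
  \<open>25 / 12\<close>.\<close>

lemma depth_le_log:
  assumes "1 \<le> k" "2 \<le> n"
  shows "real (depth (3 * k) (n - 1)) \<le> 25 / 12 * real k * log 2 (real n)"
proof -
  have "ln (real n) = ln 2 * log 2 (real n)" by (simp add: log_def)
  also have "\<dots> \<le> 25 / 36 * log 2 (real n)"
    using assms ln2_le_25_over_36 by (intro mult_right_mono) auto
  finally have ln: "ln (real n) \<le> 25 / 36 * log 2 (real n)" .
  have "real (depth (3 * k) (n - 1)) \<le> real (3 * k) * ln (real (n - 1))"
    using assms by (intro depth_le_ln) auto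
  also have "\<dots> \<le> real (3 * k) * ln (real n)" using assms by (intro mult_left_mono) auto
  also have "\<dots> \<le> real (3 * k) * (25 / 36 * log 2 (real n))" by (intro mult_left_mono ln) auto
  finally show ?thesis by simp
qed

text \<open>This is \<open>2^24 <= 5^11\<close>; the value \<open>24 / 11\<close> is what
  \<open>quasipolynomial_bound\<close> requires of \<open>k log n\<close>.\<close>

lemma log_five: "24 / 11 \<le> log 2 (5 :: real)"
proof -
  have "24 = log 2 (2 ^ 24 :: real)" by (subst log_nat_power) auto
  also have "\<dots> \<le> log 2 (5 ^ 11)" by (subst log_le_cancel_iff) auto
  also have "\<dots> = 11 * log 2 5" by (subst log_nat_power) auto
  finally show ?thesis by simp
qed

text \<open>As \<open>m + 1 >= 2\<close>, the power \<open>n^(k + 1)\<close> is at most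
  \<open>(m + 1)^((k + 1) L)\<close> with \<open>L = log 2 n\<close>. The exponents then sum to at
  most \<open>49 / 12 k L + 2\<close>, which is at most \<open>5 k L\<close> once
  \<open>k L >= 24 / 11\<close>, in particular for \<open>n >= 5\<close>. For \<open>n <= 4\<close>
  the power of \<open>n\<close> goes into the constant \<open>4^(k + 1)\<close> instead.\<close>

lemma quasipolynomial_bound:
  assumes k: "1 \<le> k" and n: "2 \<le> n" and m: "1 \<le> m"
  shows "real n ^ (k + 1) * (real m + 1) ^ (depth (3 * k) (n - 1) + 2)
    \<le> 4 ^ (k + 1) * (real m + 1) powr (5 * real k * log 2 (real n))"
proof -
  let ?L = "log 2 (real n)" and ?d = "depth (3 * k) (n - 1)" and ?M = "real m + 1"
  have L: "1 \<le> ?L" using n by (simp add: le_log_iff)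
  then have kL: "1 \<le> real k * ?L" using k mult_mono[of 1 "real k" 1 ?L] by simp
  have d: "real ?d \<le> 25 / 12 * (real k * ?L)" using depth_le_log[OF k n] by (simp add: mult.assoc)
  have M: "?M ^ (?d + 2) = ?M powr (real ?d + 2)"
    by (subst powr_realpow[symmetric]) (auto simp: add.commute)
  show ?thesis
  proof (cases "n \<le> 4")
    case True
    have "real n ^ (k + 1) \<le> 4 ^ (k + 1)" using True by (intro power_mono) auto
    moreover have "real ?d + 2 \<le> 5 * real k * ?L" using d kL by linarith
    then have "?M powr (real ?d + 2) \<le> ?M powr (5 * real k * ?L)" by (intro powr_mono) auto
    ultimately show ?thesis unfolding M by (intro mult_mono) auto
  next
    case False
    have "24 / 11 \<le> ?L"
      using log_five log_le_cancel_iff[of 2 5 "real n"] False by linarith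
    then have "24 / 11 \<le> real k * ?L" using k mult_mono[of 1 "real k" "24/11" ?L] by simp
    moreover have "?L \<le> real k * ?L" using k L mult_right_mono[of 1 "real k" ?L] by simp
    ultimately have "real (k + 1) * ?L + (real ?d + 2) \<le> 5 * real k * ?L" using d by (simp add: algebra_simps)
    then have e: "?M powr (real (k + 1) * ?L + (real ?d + 2)) \<le> ?M powr (5 * real k * ?L)"
      by (intro powr_mono) auto
    have "real n ^ (k + 1) = (2 powr ?L) powr real (k + 1)"
      using n by (subst powr_realpow[symmetric]) auto
    also have "\<dots> = 2 powr (real (k + 1) * ?L)" by (simp add: powr_powr mult.commute)
    also have "\<dots> \<le> ?M powr (real (k + 1) * ?L)"
      using m L by (intro powr_mono2) auto
    finally have "real n ^ (k + 1) * ?M ^ (?d + 2) \<le> ?M powr (real (k + 1) * ?L) * ?M powr (real ?d + 2)"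
      unfolding M by (intro mult_right_mono) auto
    also have "\<dots> \<le> ?M powr (5 * real k * ?L)" using e by (simp add: powr_add)
    also have "\<dots> \<le> 4 ^ (k + 1) * ?M powr (5 * real k * ?L)"
    proof -
      have "1 \<le> (4 :: real) ^ (k + 1)" by (rule one_le_power) simp
      from mult_right_mono[OF this powr_ge_zero] show ?thesis by (simp only: mult_1_left)
    qed
    finally show ?thesis .
  qed
qed

section \<open>Amplification by repeated trials\<close>

context costed_hypergraph
begin

lemma q_writes_trial: "''q'' \<notin> writes (trial k)" "''R'' \<notin> insert ''q'' (writes (trial k))"
  using writes_trial[of k] by (auto simp: work_def)

lemma main_loop_env:
  assumes "env s" "agree (insert ''q'' (writes (trial k))) s s'"
  shows "env s'" "s' ''R'' = s ''R''"
proof -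
  show "env s'"
  proof (rule env_agree[OF assms(1), of "insert ''q'' work"])
    show "agree (insert ''q'' work) s s'" using assms(2) writes_trial[of k] by (auto simp: agree_def)
  qed (simp add: work_def)
  show "s' ''R'' = s ''R''" by (rule agreeD[OF assms(2) q_writes_trial(2)])
qed

lemma post_main_loop:
  assumes "env s" "sound s"
  shows "post (main_loop k) s (\<lambda>s'. env s' \<and> sound s')"
proof (rule post_For[where I = "\<lambda>j. sound" and B = "s ''R'' 0"])
  show "sound (update s ''q'' 0 0)" using assms(2) by (simp add: sound_def solved_def update_apply)
  fix s' assume *: "agree (insert ''q'' (writes (trial k))) s s'"
  show "aval (V ''R'') s' = s ''R'' 0" using main_loop_env[OF assms(1) *] by simp
  show "sound s' \<Longrightarrow> env s' \<and> sound s'" using main_loop_env[OF assms(1) *] by simp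
  fix j assume "sound s'"
  then show "post (trial k) s' (\<lambda>s''. sound (update s'' ''q'' 0 (Suc j)))"
    by (intro post_weaken[OF post_trial[OF main_loop_env(1)[OF assms(1) *]]])
      (simp_all add: sound_def solved_def update_apply)
qed (rule q_writes_trial)

lemma lossless_trial:
  assumes "env s" "1 \<le> n" "1 \<le> m"
  shows "lossless_spmf (exec (trial k) s)"
  using assms by (intro cost_bounded_lossless[OF cost_bounded_trial]) (simp_all add: env_def)

lemma expect_main_loop:
  assumes env: "env s" and found: "s ''found'' 0 = 0"
    and U: "U \<noteq> {}" "U \<subset> {..<n}" "\<And>i. i < k \<Longrightarrow> sum (c i) (cut U) \<le> b i"
    and nm: "1 \<le> n" "1 \<le> m"
    and q: "0 \<le> q" "q \<le> potential k m m (n - 1)"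
  shows "ennreal (1 - (1 - q) ^ s ''R'' 0) \<le> expect (main_loop k) win s"
proof -
  let ?r = "s ''R'' 0"
  have q1: "q \<le> 1" using q potential_le_1[of k m m "n - 1"] by linarith
  \<comment> \<open>The success probability of \<open>?r - j\<close> independent trials that succeed
    with probability \<open>q\<close> each.\<close>
  define h where "h j = 1 - (1 - q) ^ (?r - j)" for j
  have h: "0 \<le> h j" "h j \<le> 1" for j
    unfolding h_def using q q1 power_le_one[of "1 - q" "?r - j"] by auto
  define G where "G j s p \<longleftrightarrow> env s \<and> (s ''found'' 0 \<noteq> 0 \<and> solved s \<and> p \<le> 1 \<or>
    s ''found'' 0 = 0 \<and> p \<le> ennreal (h j))" for j :: nat and s and p :: ennreal
  have G_update: "G j (update s ''q'' 0 i) p \<longleftrightarrow> G j s p" for j s i p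
  proof -
    have "update s ''q'' 0 i x = s x" if "x \<noteq> ''q''" for x using that by (simp add: update_apply)
    then show ?thesis unfolding G_def env_def solved_def by simp
  qed
  show ?thesis
  proof (rule expect_For_ge[where G = G and B = ?r])
    show "''q'' \<notin> writes (trial k)" by (rule q_writes_trial)
    show "G 0 (update s ''q'' 0 0) (ennreal (1 - (1 - q) ^ ?r))"
      unfolding G_update unfolding G_def using env found by (simp add: h_def)
    fix s' assume *: "agree (insert ''q'' (writes (trial k))) s s'"
    note env' = main_loop_env[OF env *]
    show "aval (V ''R'') s' = ?r" using env' by simp
    show "G ?r s' p \<Longrightarrow> p \<le> win s'" for p by (auto simp: G_def win_def h_def)
    fix j p g assume j: "j < ?r" and G: "G j s' p"
      and g: "\<And>s'' p'. G (Suc j) (update s'' ''q'' 0 (Suc j)) p' \<Longrightarrow> p' \<le> g s''"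
    have sound: "sound s'" using G by (auto simp: G_def sound_def)
    \<comment> \<open>Success of the present trial is worth 1, failure leaves the chance of the
      later ones.\<close>
    have g': "ennreal (h (Suc j)) + ennreal (1 - h (Suc j)) * win s'' \<le> g s''" if "env s''" "sound s''" for s''
    proof (cases "s'' ''found'' 0 = 0")
      case True
      have "ennreal (h (Suc j)) \<le> g s''" using that True by (intro g, unfold G_update) (simp add: G_def)
      then show ?thesis using True by (simp add: win_def)
    next
      case False
      have "1 \<le> g s''" using that False by (intro g, unfold G_update) (simp add: G_def sound_def)
      moreover have "ennreal (h (Suc j)) + ennreal (1 - h (Suc j)) = 1"
        using h[of "Suc j"] by (simp flip: ennreal_plus)
      ultimately show ?thesis using False that by (simp add: win_def sound_def)
    qed
    have post': "post (trial k) s' (\<lambda>s''. ennreal (h (Suc j)) + ennreal (1 - h (Suc j)) * win s'' \<le> g s'')"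
      using g' by (intro post_weaken[OF post_trial[OF env'(1) sound]]) auto
    show "p \<le> expect (trial k) g s'"
    proof (cases "s' ''found'' 0 = 0")
      case True
      have "ennreal q \<le> expect (trial k) win s'"
        using q(2) by (intro order_trans[OF _ expect_trial[OF env'(1) True U nm]] ennreal_leI) auto
      from expect_affine[OF lossless_trial[OF env'(1) nm] post' this]
      have "ennreal (h (Suc j)) + ennreal (1 - h (Suc j)) * ennreal q \<le> expect (trial k) g s'" .
      moreover have "ennreal (h (Suc j)) + ennreal (1 - h (Suc j)) * ennreal q = ennreal (h j)"
      proof -
        have "?r - j = Suc (?r - Suc j)" using j by simp
        then have "h j = h (Suc j) + (1 - h (Suc j)) * q" by (simp add: h_def algebra_simps)
        then show ?thesis using h[of "Suc j"] q by (simp add: ennreal_mult ennreal_plus)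
      qed
      moreover have "p \<le> ennreal (h j)" using G True by (simp add: G_def)
      ultimately show ?thesis by simp
    next
      case False
      have "post (trial k) s' (\<lambda>s''. env s'' \<and> sound s'' \<and> s'' ''found'' 0 \<noteq> 0)"
        using False by (intro post_weaken[OF post_trial[OF env'(1) sound]]) auto
      then have "1 \<le> expect (trial k) g s'"
      proof (rule expect_ge_post[OF lossless_trial[OF env'(1) nm]])
        fix s'' assume "env s'' \<and> sound s'' \<and> s'' ''found'' 0 \<noteq> 0"
        then show "1 \<le> g s''" by (intro g, unfold G_update) (simp add: G_def sound_def)
      qed
      moreover have "p \<le> 1" using G False by (simp add: G_def)
      ultimately show ?thesis by (rule order_trans[rotated])
    qed
  qed
qed


section \<open>Correctness and running time of the whole algorithm\<close>

lemma lossless_prepare: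
  assumes "input s" "1 \<le> n" "1 \<le> m"
  shows "lossless_spmf (exec (prepare k) s)"
  using assms by (intro cost_bounded_lossless[OF cost_bounded_prepare]) (simp_all add: input_def)

lemma solved_no_hyperedges:
  assumes "m = 0" "2 \<le> n"
  shows "solved s"
proof -
  have "cut {0} = {}" "{e. e < m \<and> s ''out'' e \<noteq> 0} = {}" unfolding cut_def using assms(1) by simp_all
  moreover have "0 \<in> {..<n}" "1 \<in> {..<n} - {0}" using assms(2) by simp_all
  then have "{0} \<subset> {..<n}" by blast
  ultimately show ?thesis
    unfolding solved_def by (intro exI[of _ "{0}"]) simp
qed

lemma post_algorithm:
  assumes s: "input s" and n: "1 \<le> n"
  shows "post (algorithm k) s sound"
proof (cases "n < 2")
  case True
  then show ?thesis using s by (simp add: algorithm_def input_def sound_def)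
next
  case n2: False
  show ?thesis
  proof (cases "m = 0")
    case True
    have "s ''m'' 0 = 0" "\<not> s ''n'' 0 < 2" using s True n2 unfolding input_def by simp_all
    moreover have "solved s'" for s' using True n2 by (intro solved_no_hyperedges) auto
    ultimately show ?thesis by (simp add: algorithm_def sound_def)
  next
    case False
    have "post (Seq (prepare k) (main_loop k)) s sound"
    proof (rule post_SeqI[OF post_prepare[OF s n]])
      fix s' assume "env s' \<and> s' ''found'' 0 = 0 \<and> s' ''R'' 0 = rounds"
      then show "post (main_loop k) s' sound"
        by (intro post_weaken[OF post_main_loop]) (auto simp: sound_def)
    qed
    then show ?thesis using n2 False s by (simp add: algorithm_def input_def)
  qed
qed

lemma expect_algorithm:
  assumes s: "input s" and n: "1 \<le> n"
    and U: "U \<noteq> {}" "U \<subset> {..<n}" "\<And>i. i < k \<Longrightarrow> sum (c i) (cut U) \<le> b i"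
  shows "ennreal (1 / real n ^ (2 * k)) \<le> expect (algorithm k) win s"
proof -
  have n2: "2 \<le> n"
  proof (rule ccontr)
    assume "\<not> 2 \<le> n"
    then have "{..<n} = {0}" using n by auto
    then show False using U by auto
  qed
  have n2k: "4 \<le> real n ^ (2 * k)"
  proof -
    have "(2::real) ^ 2 \<le> real n ^ 2" using n2 by (intro power_mono) auto
    also have "\<dots> \<le> real n ^ (2 * k)" using n2 k by (intro power_increasing) auto
    finally show ?thesis by simp
  qed
  show ?thesis
  proof (cases "m = 0")
    case True
    have "s ''m'' 0 = 0" "\<not> s ''n'' 0 < 2" using s True n2 unfolding input_def by simp_all
    moreover have "solved s'" for s' using True n2 by (rule solved_no_hyperedges)
    ultimately have "expect (algorithm k) win s = 1"
      by (simp add: algorithm_def expect_Cond expect_Store win_def update_apply)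
    moreover have "1 / real n ^ (2 * k) \<le> 1" using n2k by (subst divide_le_eq_1_pos) linarith+
    ultimately show ?thesis by simp
  next
    case False
    let ?M = "(real m + 1) ^ depth (3 * k) (n - 1)" and ?x = "real n ^ (2 * k)"
    define q where "q = 1 / (3 * ?M * real n ^ (3 * k))"
    have q: "0 \<le> q" "q \<le> potential k m m (n - 1)"
      using potential_initial[OF n, of m k] by (auto simp: q_def)
    have "real n ^ (3 * k) = real n ^ k * ?x" by (simp flip: power_add)
    moreover have "0 < real n ^ k" "0 < ?M" "0 < ?x" using n by (auto intro!: zero_less_power)
    moreover have "real rounds = 6 * real n ^ k * ?M"
      by (simp add: rounds_def add.commute)
    ultimately have rq: "real rounds * q = 2 / ?x"
      unfolding q_def by (simp add: field_simps)
    \<comment> \<open>The factor 2 in \<open>rounds * q\<close> is spent here.\<close>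
    have "1 / y \<le> 2 / y / (1 + 2 / y)" if "4 \<le> y" for y :: real
      using that by (simp add: field_simps)
    then have "1 / ?x \<le> 2 / ?x / (1 + 2 / ?x)" using n2k .
    also have "\<dots> \<le> 1 - (1 - q) ^ rounds"
      using amplification[of q rounds] q potential_le_1[of k m m "n - 1"] unfolding rq by linarith
    finally have le: "1 / ?x \<le> 1 - (1 - q) ^ rounds" .
    have "ennreal (1 / ?x) \<le> expect (prepare k) (expect (main_loop k) win) s"
    proof (rule expect_ge_post[OF lossless_prepare[OF s n] post_prepare[OF s n]])
      show "1 \<le> m" using False by simp
      fix s' assume s': "env s' \<and> s' ''found'' 0 = 0 \<and> s' ''R'' 0 = rounds"
      have "ennreal (1 - (1 - q) ^ s' ''R'' 0) \<le> expect (main_loop k) win s'"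
        using s' False by (intro expect_main_loop[OF _ _ U n _ q]) auto
      then show "ennreal (1 / ?x) \<le> expect (main_loop k) win s'"
        using le s' by (intro order_trans[OF ennreal_leI[OF le]]) simp
    qed
    then show ?thesis
      using n2 False s by (simp add: algorithm_def expect_Cond expect_Seq input_def)
  qed
qed

lemma runs_within_algorithm_trivial:
  assumes "input s" "n < 2 \<or> m = 0"
  shows "runs_within s (algorithm k) 20"
proof -
  have "s ''n'' 0 < 2 \<or> s ''m'' 0 = 0" using assms unfolding input_def by simp
  then show ?thesis by (auto simp: algorithm_def runs_within_def)
qed

text \<open>The main loop runs \<open>6 n^k (m + 1)^d\<close> trials of order
  \<open>n (m + 1)^2\<close>. The preparation, of order \<open>n^2 (m + 1)\<close>, is dominated by
  this because \<open>k >= 1\<close>.\<close>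

lemma runs_within_algorithm:
  assumes K: "cost_bounded_by K (prepare k) 2 1" and L: "cost_bounded_by L (trial k) 1 2"
    and s: "input s" and nm: "2 \<le> n" "1 \<le> m"
  shows "runs_within s (algorithm k)
    ((K + 6 * (L + 13) + 26) * (n ^ (k + 1) * (m + 1) ^ (depth (3 * k) (n - 1) + 2)))"
proof -
  let ?d = "depth (3 * k) (n - 1)"
  let ?X = "n ^ (k + 1) * (m + 1) ^ (?d + 2)" and ?T = "L * n ^ 1 * (m + 1) ^ 2"
  have n: "1 \<le> n" using nm by simp
  have "runs_within s (Seq (prepare k) (main_loop k))
      (K * n ^ 2 * (m + 1) ^ 1 + (rounds * (?T + 13) + 16))"
  proof (rule runs_within_Seq_post[OF _ post_prepare[OF s n]])
    show "runs_within s (prepare k) (K * n ^ 2 * (m + 1) ^ 1)"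
      using cost_bounded_byD[OF K, of s] s nm by (simp add: input_def)
    fix s' assume s': "env s' \<and> s' ''found'' 0 = 0 \<and> s' ''R'' 0 = rounds"
    have "runs_within s' (main_loop k) (rounds * (?T + acost (V ''R'') + 11) + (acost (V ''R'') + 14))"
    proof (rule runs_within_For[OF _ _ q_writes_trial(1)])
      fix s'' assume *: "agree (insert ''q'' (writes (trial k))) s' s''"
      have env: "env s'" using s' by simp
      note e = main_loop_env[OF env *]
      show "runs_within s'' (trial k) ?T" using cost_bounded_byD[OF L, of s''] e(1) nm by (simp add: env_def)
      show "aval (V ''R'') s'' = rounds" using e(2) s' by simp
    qed
    then show "runs_within s' (main_loop k) (rounds * (?T + 13) + 16)" by (simp add: add.commute)
  qed
  then have "runs_within s (algorithm k) (1 + bcost (Less (V ''n'') (Const 2)) + (1 + bcost (Less (V ''m'') (Const 1)) +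
      (K * n ^ 2 * (m + 1) ^ 1 + (rounds * (?T + 13) + 16))))"
    unfolding algorithm_def using s nm unfolding input_def by (intro runs_within_Cond) simp_all
  then have "runs_within s (algorithm k) (10 + (K * n ^ 2 * (m + 1) ^ 1 + (rounds * (?T + 13) + 16)))"
    by (rule runs_within_mono) simp
  moreover have "10 + (K * n ^ 2 * (m + 1) ^ 1 + (rounds * (?T + 13) + 16)) \<le> (K + 6 * (L + 13) + 26) * ?X"
  proof -
    have X1: "1 \<le> ?X" using n by (simp add: Suc_le_eq)
    have "n ^ 2 * (m + 1) ^ 1 \<le> ?X"
      using n k by (intro mult_le_mono power_increasing) auto
    then have 1: "K * n ^ 2 * (m + 1) ^ 1 \<le> K * ?X" unfolding mult.assoc by (rule mult_le_mono2)
    have "1 \<le> n * (m + 1) ^ 2" using n by (simp add: Suc_le_eq)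
    then have "?T + 13 \<le> (L + 13) * (n * (m + 1) ^ 2)"
      unfolding add_mult_distrib using mult_le_mono2[of 1 "n * (m + 1) ^ 2" 13] by (simp only: power_one_right mult.assoc)
    then have "rounds * (?T + 13) \<le> (6 * n ^ k * (m + 1) ^ ?d) * ((L + 13) * (n * (m + 1) ^ 2))"
      unfolding rounds_def by (rule mult_le_mono2)
    also have "\<dots> = 6 * (L + 13) * ?X" by (simp only: power_add power_one_right mult_ac)
    finally have 2: "rounds * (?T + 13) \<le> 6 * (L + 13) * ?X" .
    show ?thesis using 1 2 X1 unfolding add_mult_distrib by linarith
  qed
  ultimately show ?thesis by (rule runs_within_mono)
qed

end

theorem theorem1p1:
  fixes k :: nat
  assumes "k \<ge> 1"
  shows "\<exists>(p :: com) (C :: real). \<forall>(H :: (nat, nat) hypergraph) (c :: nat \<Rightarrow> nat \<Rightarrow> nat) (b :: nat \<Rightarrow> nat).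
    hypergraph H \<and> numbered H \<longrightarrow>
      ((\<exists>F. budget_feasible k H c b F) \<longrightarrow>
         measure (measure_spmf (answer_dist p k H c b)) {Cut F | F. budget_feasible k H c b F}
           \<ge> 1 / real (card (verts H)) ^ (2 * k)) \<and>
      ((\<nexists>F. budget_feasible k H c b F) \<longrightarrow> spmf (answer_dist p k H c b) FAIL = 1) \<and>
      expected_time p (encode k H c b)
        \<le> ennreal (C * real (card (hedges H) + 1) powr (5 * real k * log 2 (real (card (verts H)))))"
proof -
  obtain K where K: "cost_bounded_by K (prepare k) 2 1"
    using cost_bounded_prepare[of k] unfolding cost_bounded_def by blast
  obtain L where L: "cost_bounded_by L (trial k) 1 2"
    using cost_bounded_trial[of k] unfolding cost_bounded_def by blast
  \<comment> \<open>\<open>K\<close> and \<open>L\<close> are obtained before an instance is fixed,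
    so \<open>C\<close> depends on \<open>k\<close> only. The factor \<open>4^(k + 1)\<close> serves
    instances with at most four vertices.\<close>
  define C where "C = real (K + 6 * (L + 13) + 26) * 4 ^ (k + 1)"
  have C: "20 \<le> C"
  proof -
    have "1 \<le> (4 :: real) ^ (k + 1)" by (rule one_le_power) simp
    then have "real (K + 6 * (L + 13) + 26) * 1 \<le> C" unfolding C_def by (intro mult_left_mono) auto
    then show ?thesis by simp
  qed
  show ?thesis
  proof (rule exI[of _ "algorithm k"], rule exI[of _ C], intro allI impI conjI)
    fix H :: "(nat, nat) hypergraph" and c :: "nat \<Rightarrow> nat \<Rightarrow> nat" and b :: "nat \<Rightarrow> nat"
    assume H: "hypergraph H \<and> numbered H"
    define n m where "n = card (verts H)" and "m = card (hedges H)"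
    have verts: "verts H = {..<n}" and hedges: "hedges H = {..<m}"
      using H by (simp_all add: numbered_def n_def m_def)
    have E: "ends H e \<subseteq> {..<n}" if "e < m" for e
      using H that unfolding hypergraph_def verts hedges by blast
    interpret costed_hypergraph k n m "ends H" c b
      by unfold_locales (use assms E in auto)
    let ?s = "encode k H c b"
    have n: "1 \<le> n" using H verts by (cases n) (auto simp: hypergraph_def)
    have index: "e * l + v < l' * l" if "e < l'" "v < l" for e v l l' :: nat
    proof -
      have "e * l + v < Suc e * l" using that by simp
      also have "\<dots> \<le> l' * l" using that by (intro mult_le_mono1) simp
      finally show ?thesis .
    qed
    have input: "input ?s"
      using index by (auto simp: input_def encode_def Let_def n_def[symmetric] m_def[symmetric])
    have feasible: "budget_feasible k H c b F \<longleftrightarrow>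
        (\<exists>U. U \<noteq> {} \<and> U \<subset> {..<n} \<and> F = cut U \<and> (\<forall>i<k. sum (c i) (cut U) \<le> b i))" for F
      by (auto simp: budget_feasible_def is_cut_def verts boundary_def cut_def hedges lessThan_def)
    have solved: "solved s \<longleftrightarrow> budget_feasible k H c b {e \<in> hedges H. s ''out'' e \<noteq> 0}" for s
    proof -
      have "{e \<in> hedges H. s ''out'' e \<noteq> 0} = {e. e < m \<and> s ''out'' e \<noteq> 0}" by (auto simp: hedges)
      then show ?thesis unfolding solved_def feasible by metis
    qed
    have lossless: "lossless_spmf (exec (algorithm k) ?s)" and
      time: "expected_time (algorithm k) ?s \<le> ennreal (C * real (m + 1) powr (5 * real k * log 2 (real n)))"
    proof -
      let ?P = "real (m + 1) powr (5 * real k * log 2 (real n))"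
      obtain T where T: "runs_within ?s (algorithm k) T" "real T \<le> C * ?P"
      proof (cases "n < 2 \<or> m = 0")
        case True
        \<comment> \<open>For \<open>n = 1\<close> the exponent is 0 and for \<open>m = 0\<close>
          the base is 1, so the bare constant has to cover these inputs; hence
          \<open>20 <= C\<close>.\<close>
        have "1 \<le> ?P" using n by (intro ge_one_powr_ge_zero) auto
        then have "20 \<le> C * ?P" using C mult_mono[of 20 C 1 ?P] by simp
        then show ?thesis using that[OF runs_within_algorithm_trivial[OF input True]] by simp
      next
        case False
        then have nm: "2 \<le> n" "1 \<le> m" by auto
        let ?X = "n ^ (k + 1) * (m + 1) ^ (depth (3 * k) (n - 1) + 2)"
        have "real ?X = real n ^ (k + 1) * (real m + 1) ^ (depth (3 * k) (n - 1) + 2)"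
          by (simp only: of_nat_mult of_nat_power of_nat_add of_nat_1)
        also have "\<dots> \<le> 4 ^ (k + 1) * (real m + 1) powr (5 * real k * log 2 (real n))"
          by (rule quasipolynomial_bound[OF assms nm])
        finally have X: "real ?X \<le> 4 ^ (k + 1) * ?P" by (simp add: add.commute)
        have "real ((K + 6 * (L + 13) + 26) * ?X) = real (K + 6 * (L + 13) + 26) * real ?X" by (rule of_nat_mult)
        also have "\<dots> \<le> real (K + 6 * (L + 13) + 26) * (4 ^ (k + 1) * ?P)"
          using X by (intro mult_left_mono) auto
        finally have "real ((K + 6 * (L + 13) + 26) * ?X) \<le> C * ?P" by (simp only: C_def mult.assoc)
        then show ?thesis using that[OF runs_within_algorithm[OF K L input nm]] by simp
      qed
      then show "lossless_spmf (exec (algorithm k) ?s)" "expected_time (algorithm k) ?s \<le> ennreal (C * ?P)"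
        using runs_within_lossless expected_time_le by blast+
    qed
    have outcomes: "sound s'" if "(s', t) \<in> set_spmf (exec (algorithm k) ?s)" for s' t
      using post_algorithm[OF input n] that unfolding post_def by blast
    show "1 / real (card (verts H)) ^ (2 * k)
        \<le> measure (measure_spmf (answer_dist (algorithm k) k H c b)) {Cut F | F. budget_feasible k H c b F}"
      if ex: "\<exists>F. budget_feasible k H c b F"
    proof -
      from ex obtain F where "budget_feasible k H c b F" ..
      then obtain U where U: "U \<noteq> {}" "U \<subset> {..<n}" "\<forall>i<k. sum (c i) (cut U) \<le> b i"
        unfolding feasible by (elim exE conjE)
      let ?A = "(\<lambda>(s, t). decode H s) -` {Cut F | F. budget_feasible k H c b F}"
      have "win (fst r) \<le> indicator ?A r" for r :: "state \<times> nat"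
      proof (cases r)
        case (Pair s t)
        then show ?thesis using solved[of s] by (auto simp: win_def decode_def indicator_def)
      qed
      then have "expect (algorithm k) win ?s \<le> (\<integral>\<^sup>+ r. indicator ?A r \<partial>measure_spmf (exec (algorithm k) ?s))"
        unfolding expect_def by (intro nn_integral_mono)
      also have "\<dots> = ennreal (measure (measure_spmf (exec (algorithm k) ?s)) ?A)"
        by (simp add: measure_spmf.emeasure_eq_measure)
      finally have "ennreal (1 / real n ^ (2 * k)) \<le> \<dots>"
        using expect_algorithm[OF input n U(1,2) U(3)[rule_format]] by (rule order_trans[rotated])
      then show ?thesis by (simp add: answer_dist_def measure_map_spmf n_def)
    qed
    show "spmf (answer_dist (algorithm k) k H c b) FAIL = 1" if "\<nexists>F. budget_feasible k H c b F"
    proof -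
      have "decode H (fst r) = FAIL" if "r \<in> set_spmf (exec (algorithm k) ?s)" for r
        using outcomes[of "fst r" "snd r"] that \<open>\<nexists>F. budget_feasible k H c b F\<close> solved
        by (auto simp: sound_def decode_def)
      \<comment> \<open>Soundness confines the answers to \<open>FAIL\<close>; losslessness then
        makes its probability 1.\<close>
      then have "answer_dist (algorithm k) k H c b = map_spmf (\<lambda>_. FAIL) (exec (algorithm k) ?s)"
        unfolding answer_dist_def by (intro map_spmf_cong) auto
      then show ?thesis
        using lossless by (simp add: map_spmf_conv_bind_spmf bind_spmf_const lossless_spmf_def)
    qed
    show "expected_time (algorithm k) ?s
        \<le> ennreal (C * real (card (hedges H) + 1) powr (5 * real k * log 2 (real (card (verts H)))))"
      using time by (simp only: n_def m_def)
  qed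
qed

end
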